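(* Let $1\le m\le n$ be integers, let $X$ be an $\mathcal{H}^m$-$\sigma$-finite metric space, and let $A\subset\mathbb{R}^n$ be measurable with $\mathcal{H}^n(A)>0$. Let $f:A\to X$ be a Lipschitz map such that $\operatorname{rank}\,\mathrm{md}_a(f,p)=m$ for a.e. $p\in A$. Let $\pi:\mathbb{R}^n=\mathbb{R}^m\times\mathbb{R}^{n-m}\to\mathbb{R}^m$ be the orthogonal projection $\pi(x,y)=x$. Then there is a countable family $\{K_i\}$ of pairwise disjoint compact subsets of $A$ with $\mathcal{H}^n(A\setminus\bigcup_iK_i)=0$ such that for each $i$ there exist a $C^1$-diffeomorphism $G_i:\mathbb{R}^n\to\mathbb{R}^n=\mathbb{R}^m\times\mathbb{R}^{n-m}$ (onto $\mathbb{R}^n$) and a bi-Lipschitz map (onto its image) $\phi_i:\pi(G_i(K_i))\to X$ such that $$(f\circ G_i^{-1})(x,y)=(\phi_i\circ\pi)(x,y)=\phi_i(x)\qquad\text{for all }(x,y)\in G_i(K_i).$$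
   Context: A seminorm on $\mathbb{R}^n$ is a function $\sigma:\mathbb{R}^n\to[0,\infty)$ with $\sigma(\lambda v)=|\lambda|\sigma(v)$ and $\sigma(v+w)\le\sigma(v)+\sigma(w)$. Its rank is $\operatorname{rank}\sigma=n-\dim\{v:\sigma(v)=0\}$. A measurable map $f:A\to(X,d)$ on a measurable set $A\subset\mathbb{R}^n$ is approximately metrically differentiable at $x\in A$ if there are a measurable set $A_x\subset A$ having $x$ as a Lebesgue density point and a seminorm $\sigma_x$ on $\mathbb{R}^n$ such that $\lim_{A_x\ni y\to x}\frac{d(f(y),f(x))-\sigma_x(y-x)}{|y-x|}=0$; $\sigma_x$ is then unique and is denoted $\mathrm{md}_a(f,x)$. (For Lipschitz $f$ it exists at almost every $x\in A$, by Kirchheim's theorem.) $\mathcal{H}^s$ is the $s$-dimensional Hausdorff measure, normalized so that $\mathcal{H}^n$ equals Lebesgue measure on $\mathbb{R}^n$. $X$ is $\mathcal{H}^m$-$\sigma$-finite if it is a countable union of sets of finite $\mathcal{H}^m$-measure. *)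

theory Defs
  imports "HOL-Analysis.Analysis"
begin

section \<open>Hausdorff measure\<close>

text \<open>
  The weight of a covering set \<open>U\<close> is \<open>\<omega>\<^sub>d (diam U / 2)^d\<close> with \<open>\<omega>\<^sub>d\<close> the volume of the unit
  ball of \<open>\<real>\<^sup>d\<close>; this is the normalization under which the \<open>d\<close>-dimensional measure on \<open>\<real>\<^sup>d\<close> is
  Lebesgue measure. The empty set gets weight \<open>0\<close> (this matters only for \<open>d = 0\<close>, where
  \<open>0 ^ 0 = 1\<close>). Boundedness is required because \<open>diameter\<close> is unspecified on unbounded sets.
\<close>

definition hausdorff_content :: "nat \<Rightarrow> real \<Rightarrow> 'a::metric_space set \<Rightarrow> ennreal" where
  "hausdorff_content d \<delta> E =
     (INF U \<in> {U :: nat \<Rightarrow> 'a set. E \<subseteq> (\<Union>i. U i) \<and> (\<forall>i. bounded (U i) \<and> diameter (U i) \<le> \<delta>)}.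
        \<Sum>i. if U i = {} then 0
            else ennreal (unit_ball_vol (real d) * (diameter (U i) / 2) ^ d))"

definition hausdorff :: "nat \<Rightarrow> 'a::metric_space set \<Rightarrow> ennreal" where
  "hausdorff d E = (SUP \<delta>\<in>{0<..}. hausdorff_content d \<delta> E)"

definition hausdorff_sigma_finite :: "nat \<Rightarrow> 'a::metric_space set \<Rightarrow> bool" where
  "hausdorff_sigma_finite d X \<longleftrightarrow>
     (\<exists>\<S>. countable \<S> \<and> \<Union>\<S> = X \<and> (\<forall>S\<in>\<S>. hausdorff d S < \<infinity>))"


section \<open>Seminorms and approximate metric differentiability\<close>

definition is_seminorm :: "('a::real_vector \<Rightarrow> real) \<Rightarrow> bool" where
  "is_seminorm \<sigma> \<longleftrightarrow>
     (\<forall>v. 0 \<le> \<sigma> v) \<and> (\<forall>c v. \<sigma> (c *\<^sub>R v) = \<bar>c\<bar> * \<sigma> v) \<and> (\<forall>v w. \<sigma> (v + w) \<le> \<sigma> v + \<sigma> w)"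

definition seminorm_rank :: "('a::euclidean_space \<Rightarrow> real) \<Rightarrow> nat" where
  "seminorm_rank \<sigma> = DIM('a) - dim {v. \<sigma> v = 0}"

definition lebesgue_density_point :: "'a::euclidean_space \<Rightarrow> 'a set \<Rightarrow> bool" where
  "lebesgue_density_point x S \<longleftrightarrow>
     ((\<lambda>r. measure lebesgue (S \<inter> ball x r) / measure lebesgue (ball x r)) \<longlongrightarrow> 1) (at_right 0)"

definition has_approx_metric_derivative ::
    "('a::euclidean_space \<Rightarrow> 'b::metric_space) \<Rightarrow> 'a set \<Rightarrow> 'a \<Rightarrow> ('a \<Rightarrow> real) \<Rightarrow> bool" where
  "has_approx_metric_derivative f A x \<sigma> \<longleftrightarrow>
     is_seminorm \<sigma> \<and>
     (\<exists>S. S \<in> sets lebesgue \<and> S \<subseteq> A \<and> lebesgue_density_point x S \<and>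
        ((\<lambda>y. (dist (f y) (f x) - \<sigma> (y - x)) / norm (y - x)) \<longlongrightarrow> 0) (at x within S))"

definition approx_metric_differentiable ::
    "('a::euclidean_space \<Rightarrow> 'b::metric_space) \<Rightarrow> 'a set \<Rightarrow> 'a \<Rightarrow> bool" where
  "approx_metric_differentiable f A x \<longleftrightarrow> (\<exists>\<sigma>. has_approx_metric_derivative f A x \<sigma>)"

text \<open>Meaningful only where \<open>approx_metric_differentiable f A x\<close> holds.\<close>

definition md_a ::
    "('a::euclidean_space \<Rightarrow> 'b::metric_space) \<Rightarrow> 'a set \<Rightarrow> 'a \<Rightarrow> 'a \<Rightarrow> real" where
  "md_a f A x = (THE \<sigma>. has_approx_metric_derivative f A x \<sigma>)"


section \<open>Diffeomorphisms, bi-Lipschitz maps, coordinate projections\<close>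

definition C1_map :: "('a::real_normed_vector \<Rightarrow> 'b::real_normed_vector) \<Rightarrow> bool" where
  "C1_map g \<longleftrightarrow>
     (\<exists>g' :: 'a \<Rightarrow> 'a \<Rightarrow>\<^sub>L 'b.
        (\<forall>x. (g has_derivative blinfun_apply (g' x)) (at x)) \<and> continuous_on UNIV g')"

definition C1_diffeomorphism :: "('a::real_normed_vector \<Rightarrow> 'b::real_normed_vector) \<Rightarrow> bool" where
  "C1_diffeomorphism g \<longleftrightarrow> bij g \<and> C1_map g \<and> C1_map (inv g)"

definition bilipschitz_on :: "'a::metric_space set \<Rightarrow> ('a \<Rightarrow> 'b::metric_space) \<Rightarrow> bool" where
  "bilipschitz_on S \<phi> \<longleftrightarrow>
     (\<exists>L\<ge>1. \<forall>x\<in>S. \<forall>y\<in>S. dist x y / L \<le> dist (\<phi> x) (\<phi> y) \<and> dist (\<phi> x) (\<phi> y) \<le> L * dist x y)"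

text \<open>
  For an injection \<open>\<iota>\<close> of the index type of \<open>\<real>\<^sup>m\<close> into that of \<open>\<real>\<^sup>n\<close>, the coordinates in the range
  of \<open>\<iota>\<close> form the factor \<open>\<real>\<^sup>m\<close> and the remaining ones (possibly none, a factor that no type
  \<open>real ^ 'k\<close> could represent) form the factor \<open>\<real>\<^sup>n\<^sup>-\<^sup>m\<close>.
  The map below is the orthogonal projection onto the first factor.
\<close>

definition coord_proj :: "('m \<Rightarrow> 'n) \<Rightarrow> real ^ 'n \<Rightarrow> real ^ 'm" where
  "coord_proj \<iota> z = (\<chi> i. z $ \<iota> i)"

end

theory Submission
  imports Defs
begin

text \<open>
  By exhaustion it suffices to find, in every non-null measurable subset of \<open>A\<close>, a non-null compact
  subset on which \<open>f\<close> factors. Near almost every point some \<open>m\<close> distance functions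
  \<open>p \<mapsto> d(f p, x\<^sub>i)\<close> have linearly independent gradients: otherwise there are a direction \<open>v\<close> with
  \<open>\<sigma>\<^sub>p v > 0\<close> in which all distance functions are nearly stationary and a line along \<open>v\<close> that stays
  mostly in the bad set, and integrating along this line contradicts the metric derivative. These
  distance functions agree with \<open>C\<^sup>1\<close> functions on a large compact set and so become the first
  coordinates of a global diffeomorphism \<open>G\<close>. Writing \<open>h = f \<circ> G\<inverse>\<close> and \<open>\<psi> x = (d(x, x\<^sub>i))\<^sub>i\<close>, we have
  \<open>\<psi> \<circ> h = \<pi>\<close>. By Eilenberg's inequality and \<open>\<sigma>\<close>-finiteness almost every fibre of \<open>\<psi>\<close> is countable,
  so on almost every vertical slice \<open>h\<close> takes countably many values; by Fubini there is a horizontal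
  slice, at height \<open>q\<close>, such that \<open>h (x, y) = h (x, q)\<close> on a non-null compact set. There
  \<open>\<phi> x = h (x, q)\<close> is Lipschitz because \<open>h\<close> is, and its inverse is Lipschitz because \<open>\<psi>\<close> is.
\<close>

section \<open>Vitali covering, porosity and slices of null sets\<close>

text \<open>The set of bad points carries no evident measurability, since the bad direction and the
  seminorm vary freely with the point. It is therefore covered by countably many compact sets,
  indexed by a direction from a countable dense set and by reciprocals of integers, and each of
  these is shown to be null. Independence of \<open>m\<close> gradients is then a dimension count: a
  vector annihilated by all gradients lies in the kernel of the seminorm, which has codimension
  \<open>m\<close>. Countably many distance functions suffice, so one compact set serves for all
  their approximations. Distance functions are Lipschitz on all of the target space. So the first
  coordinates of \<open>G\<close> are a globally Lipschitz function of the value \<open>f p\<close>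
  alone; this gives both the count of fibres and the Lipschitz inverse of \<phi>. Countable fibres
  are what makes a level of positive measure appear: uncountably many null levels could fill a
  slice. Differentiability enters only up to a tolerance and with rational slopes, so that
  exceptional sets are countable unions; exact regularity arises by summing a series of
  mollifications.\<close>

lemma negligible_of_low_density_bounded:
  fixes S :: "'a::euclidean_space set"
  assumes "bounded S" and \<theta>: "0 \<le> \<theta>" "\<theta> < 1"
    and dens: "\<And>x r. x \<in> S \<Longrightarrow> 0 < r \<Longrightarrow> \<exists>a d U. 0 < d \<and> d < r \<and> x \<in> cball a d \<and> U \<in> lmeasurable \<and>
        S \<inter> cball a d \<subseteq> U \<and> measure lebesgue U \<le> \<theta> * measure lebesgue (cball a d)"
  shows "negligible S"
proof -
  \<comment> \<open>\<open>S\<close> need not be measurable, so \<open>m\<close> is its outer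
    measure, taken over measurable supersets.\<close>
  define M where "M = {measure lebesgue T |T. T \<in> lmeasurable \<and> S \<subseteq> T}"
  define m where "m = Inf M"
  obtain R where R: "S \<subseteq> cball 0 R" using bounded_subset_ballD[OF \<open>bounded S\<close>, of 0] ball_subset_cball by blast
  have "measure lebesgue (cball (0::'a) R) \<in> M"
    unfolding M_def using R by (intro CollectI exI[of _ "cball 0 R"]) simp
  then have "M \<noteq> {}" by blast
  have bdd: "bdd_below M" unfolding M_def by (rule bdd_belowI[of _ 0]) auto
  have m_le: "m \<le> measure lebesgue T" if "T \<in> lmeasurable" "S \<subseteq> T" for T
    unfolding m_def by (rule cInf_lower[OF _ bdd]) (use that in \<open>auto simp: M_def\<close>)
  have key: "m \<le> \<theta> * (m + 2 * \<epsilon>)" if "\<epsilon> > 0" for \<epsilon>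
  proof -
    obtain z where "z \<in> M" "z < m + \<epsilon>"
      using cInf_lessD[OF \<open>M \<noteq> {}\<close>, of "m + \<epsilon>"] \<open>\<epsilon> > 0\<close> unfolding m_def by auto
    then obtain T0 where T0: "T0 \<in> lmeasurable" "S \<subseteq> T0" "measure lebesgue T0 < m + \<epsilon>"
      unfolding M_def by blast
    obtain T where T: "open T" "T0 \<subseteq> T" "T \<in> lmeasurable" "measure lebesgue T < measure lebesgue T0 + \<epsilon>"
    proof -
      obtain T where T: "open T" "T0 \<subseteq> T" "T - T0 \<in> lmeasurable" "emeasure lebesgue (T - T0) < ennreal \<epsilon>"
        using sets_lebesgue_outer_open[OF fmeasurableD[OF T0(1)] \<open>\<epsilon> > 0\<close>] by blast
      have eq: "T = T0 \<union> (T - T0)" using T(2) by blast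
      have "measure lebesgue (T - T0) < \<epsilon>"
        using T(3,4) \<open>\<epsilon> > 0\<close> by (simp add: emeasure_eq_measure2 ennreal_less_iff)
      moreover have "measure lebesgue T = measure lebesgue T0 + measure lebesgue (T - T0)"
        using measurable_measure_Diff[of T lebesgue T0] fmeasurable.Un[OF T0(1) T(3)] T0(1) T(2) eq
        by (simp add: fmeasurableD)
      ultimately show ?thesis using that[OF T(1,2)] fmeasurable.Un[OF T0(1) T(3)] eq by auto
    qed
    define K where "K = {(a, d, U). 0 < d \<and> cball a d \<subseteq> T \<and> U \<in> lmeasurable \<and> S \<inter> cball a d \<subseteq> U \<and>
        measure lebesgue U \<le> \<theta> * measure lebesgue (cball a d)}"
    have cover: "\<exists>i. i \<in> K \<and> x \<in> cball (fst i) (fst (snd i)) \<and> fst (snd i) < d" if x: "x \<in> S" "0 < d" for x d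
    proof -
      obtain e where e: "e > 0" "cball x e \<subseteq> T" using T(1,2) T0(2) x open_contains_cball by blast
      obtain a d' U where *: "0 < d'" "d' < min d (e/2)" "x \<in> cball a d'" "U \<in> lmeasurable"
          "S \<inter> cball a d' \<subseteq> U" "measure lebesgue U \<le> \<theta> * measure lebesgue (cball a d')"
        using dens[OF x(1), of "min d (e/2)"] x(2) e(1) by auto
      have "cball a d' \<subseteq> cball x e"
      proof
        fix y assume "y \<in> cball a d'"
        then show "y \<in> cball x e" using *(2,3) dist_triangle[of x y a] by (simp add: dist_commute)
      qed
      then have "(a, d', U) \<in> K" using * e(2) unfolding K_def by auto
      with * show ?thesis by force
    qed
    have "0 < fst (snd i)" if "i \<in> K" for i using that by (auto simp: K_def)
    then obtain C where C: "countable C" "C \<subseteq> K"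
     "pairwise (\<lambda>i j. disjnt (cball (fst i) (fst (snd i))) (cball (fst j) (fst (snd j)))) C"
     "negligible(S - (\<Union>i \<in> C. cball (fst i) (fst (snd i))))"
      by (rule Vitali_covering_theorem_cballs[of K "\<lambda>i. fst (snd i)" S fst, OF _ cover])
    let ?V = "\<Union>i\<in>C. snd (snd i)"
    have fin: "measure lebesgue (\<Union>i\<in>I. snd (snd i)) \<le> \<theta> * measure lebesgue T" if I: "I \<subseteq> C" "finite I" for I
    proof -
      have IK: "snd (snd i) \<in> lmeasurable" "cball (fst i) (fst (snd i)) \<subseteq> T"
          "measure lebesgue (snd (snd i)) \<le> \<theta> * measure lebesgue (cball (fst i) (fst (snd i)))" if "i \<in> I" for i
        using subsetD[OF C(2) subsetD[OF I(1) that]] unfolding K_def by auto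
      have "measure lebesgue (\<Union>i\<in>I. snd (snd i)) \<le> (\<Sum>i\<in>I. measure lebesgue (snd (snd i)))"
        by (rule measure_UNION_le) (use I IK in auto)
      also have "\<dots> \<le> (\<Sum>i\<in>I. \<theta> * measure lebesgue (cball (fst i) (fst (snd i))))"
        by (rule sum_mono) (use IK in auto)
      also have "\<dots> = \<theta> * measure lebesgue (\<Union>i\<in>I. cball (fst i) (fst (snd i)))"
        by (subst measure_UNION'[OF I(2)]) (use C(3) I in \<open>auto simp: sum_distrib_left intro: pairwise_mono\<close>)
      also have "\<dots> \<le> \<theta> * measure lebesgue T"
        by (intro mult_left_mono \<theta> measure_mono_fmeasurable UN_least IK(2) T(3)) (use I in auto)
      finally show ?thesis .
    qed
    have UC: "snd (snd i) \<in> lmeasurable" if "i \<in> C" for i using C(2) that by (auto simp: K_def)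
    have V: "?V \<in> lmeasurable" "measure lebesgue ?V \<le> \<theta> * measure lebesgue T"
      by (rule fmeasurable_UN_bound[OF C(1) UC fin] measure_UN_bound[OF C(1) UC fin]; assumption)+
    let ?N = "S - (\<Union>i \<in> C. cball (fst i) (fst (snd i)))"
    have "S \<inter> cball (fst i) (fst (snd i)) \<subseteq> snd (snd i)" if "i \<in> C" for i
      using subsetD[OF C(2) that] unfolding K_def by auto
    then have "S \<subseteq> ?V \<union> ?N" by blast
    moreover have "?V \<union> ?N \<in> lmeasurable"
      using V C(4) by (simp add: fmeasurable.Un negligible_imp_measurable)
    moreover have "measure lebesgue (?V \<union> ?N) = measure lebesgue ?V"
      using C(4) V by (simp add: fmeasurableD measure_Un_null_set negligible_iff_null_sets)
    ultimately have "m \<le> \<theta> * measure lebesgue T" using m_le[of "?V \<union> ?N"] V(2) by linarith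
    also have "\<dots> \<le> \<theta> * (m + 2 * \<epsilon>)" using T0 T \<theta> by (intro mult_left_mono) auto
    finally show ?thesis .
  qed
  have "(1 - \<theta>) * m \<le> \<epsilon>" if "\<epsilon> > 0" for \<epsilon>
  proof -
    have "\<theta> * \<epsilon> \<le> \<epsilon>" using mult_right_mono[of \<theta> 1 \<epsilon>] \<theta> that by simp
    moreover have "\<theta> * (m + 2 * (\<epsilon>/2)) = \<theta> * m + \<theta> * \<epsilon>" "(1 - \<theta>) * m = m - \<theta> * m"
      by (simp_all add: algebra_simps)
    ultimately show ?thesis using key[of "\<epsilon>/2"] that by linarith
  qed
  then have "(1 - \<theta>) * m \<le> 0" by (rule field_le_epsilon[of _ 0, simplified])
  then have m0: "m \<le> 0" using \<theta> by (simp add: mult_le_0_iff)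
  show ?thesis
    unfolding negligible_outer_le
  proof (intro allI impI)
    fix e :: real assume "e > 0"
    then obtain x where "x \<in> M" "x < e" using cInf_lessD[OF \<open>M \<noteq> {}\<close>, of e] m0 unfolding m_def by auto
    then show "\<exists>T. S \<subseteq> T \<and> T \<in> lmeasurable \<and> measure lebesgue T \<le> e" unfolding M_def by auto
  qed
qed

lemma negligible_of_low_density:
  fixes S :: "'a::euclidean_space set"
  assumes \<theta>: "0 \<le> \<theta>" "\<theta> < 1"
    and dens: "\<And>x r. x \<in> S \<Longrightarrow> 0 < r \<Longrightarrow> \<exists>a d U. 0 < d \<and> d < r \<and> x \<in> cball a d \<and> U \<in> lmeasurable \<and>
        S \<inter> cball a d \<subseteq> U \<and> measure lebesgue U \<le> \<theta> * measure lebesgue (cball a d)"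
  shows "negligible S"
proof -
  have "negligible (S \<inter> cball 0 (real n))" for n
  proof (rule negligible_of_low_density_bounded[OF _ \<theta>])
    fix x :: 'a and r :: real assume "x \<in> S \<inter> cball 0 (real n)" "0 < r"
    then show "\<exists>a d U. 0 < d \<and> d < r \<and> x \<in> cball a d \<and> U \<in> lmeasurable \<and>
        (S \<inter> cball 0 (real n)) \<inter> cball a d \<subseteq> U \<and> measure lebesgue U \<le> \<theta> * measure lebesgue (cball a d)"
      using dens[of x r] by blast
  qed (auto intro: bounded_subset[OF bounded_cball])
  then have "negligible (\<Union>n. S \<inter> cball 0 (real n))" by (intro negligible_countable_Union) auto
  moreover have "(\<Union>n. S \<inter> cball 0 (real n)) = S" using real_arch_simple by auto
  ultimately show ?thesis by simp
qed

text \<open>A hole of \<open>M\<close> around \<open>y\<close> of radius comparable to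
  \<open>dist y x\<close> occupies a fixed fraction of a ball centred at \<open>x\<close>. At a
  porous point such holes occur at every scale, so the density criterion applies.\<close>

lemma negligible_porous_points:
  fixes M :: "'a::euclidean_space set"
  assumes "\<kappa> > 0"
  shows "negligible {x \<in> M. \<not> (\<exists>r>0. \<forall>y. dist y x < r \<longrightarrow> (\<exists>y'\<in>M. dist y' y \<le> \<kappa> * dist y x))}" (is "negligible ?P")
proof -
  \<comment> \<open>With \<open>d = 2 * dist y x\<close>, the bound \<open>2 * k \<le> 1\<close>
    keeps the ball of radius \<open>k * d\<close> around \<open>y\<close> inside
    \<open>cball x d\<close>, and \<open>2 * k \<le> \<kappa>\<close> makes it miss
    \<open>M\<close>.\<close>
  define k where "k = min \<kappa> 1 / 2"
  have k: "0 < k" "k < 1" "2 * k \<le> \<kappa>" "2 * k \<le> 1" using assms by (auto simp: k_def)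
  define \<theta> where "\<theta> = 1 - k ^ DIM('a)"
  have \<theta>: "0 \<le> \<theta>" "\<theta> < 1" using k by (auto simp: \<theta>_def power_le_one)
  show ?thesis
  proof (rule negligible_of_low_density[OF \<theta>])
    fix x :: 'a and r :: real assume x: "x \<in> ?P" and r: "0 < r"
    then obtain y where y: "dist y x < r/3" "\<And>y'. y' \<in> M \<Longrightarrow> \<kappa> * dist y x < dist y' y"
      using x r by (force simp: not_le dest: spec[of _ "r/3"])
    have "x \<in> M" using x by auto
    have yx: "0 < dist y x" using y(2)[OF \<open>x \<in> M\<close>] assms
      by (metis mult_zero_right order_less_irrefl dist_commute zero_less_dist_iff dist_self)
    define d where "d = 2 * dist y x"
    have sub: "ball y (k * d) \<subseteq> cball x d"
    proof
      fix z assume "z \<in> ball y (k * d)"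
      then have "dist y z < k * d" by simp
      also have "k * d \<le> dist y x" using k mult_right_mono[of "2*k" 1 "dist y x"] by (auto simp: d_def algebra_simps)
      finally show "z \<in> cball x d" using dist_triangle[of x z y] by (auto simp: d_def dist_commute)
    qed
    have disj: "M \<inter> ball y (k * d) = {}"
    proof -
      have "k * d \<le> \<kappa> * dist y x" using k mult_right_mono[of "2*k" \<kappa> "dist y x"] by (auto simp: d_def algebra_simps)
      then show ?thesis using y(2) by (force simp: dist_commute)
    qed
    let ?U = "cball x d - ball y (k * d)"
    have "measure lebesgue (ball y (k * d)) = k ^ DIM('a) * measure lebesgue (cball x d)"
      using yx k by (simp add: content_ball content_cball d_def power_mult_distrib)
    then have "measure lebesgue ?U = \<theta> * measure lebesgue (cball x d)"
      by (subst measurable_measure_Diff) (use sub in \<open>auto simp: \<theta>_def algebra_simps\<close>)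
    moreover have "?P \<inter> cball x d \<subseteq> ?U" using disj by auto
    moreover have "?U \<in> lmeasurable" by (simp add: fmeasurable.Diff)
    moreover have "0 < d" "d < r" using yx y(1) r by (auto simp: d_def)
    moreover have "x \<in> cball x d" using \<open>0 < d\<close> by simp
    ultimately show "\<exists>a d U. 0 < d \<and> d < r \<and> x \<in> cball a d \<and> U \<in> lmeasurable \<and>
        ?P \<inter> cball a d \<subseteq> U \<and> measure lebesgue U \<le> \<theta> * measure lebesgue (cball a d)"
      by (intro exI[of _ x] exI[of _ d] exI[of _ ?U] conjI) auto
  qed
qed

text \<open>
  Both sides are Fubini for the preimage of \<open>N\<close> under \<open>(x, w) \<mapsto> x + P w\<close>; the redundant variables
  avoid any splitting of the space into a product along the range of \<open>P\<close>.
\<close>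

lemma null_sets_lborel_iff_AE_slices:
  fixes N :: "'a::euclidean_space set" and P :: "'b::euclidean_space \<Rightarrow> 'a"
  assumes N: "N \<in> sets borel" and P: "continuous_on UNIV P"
  shows "N \<in> null_sets lborel \<longleftrightarrow> (AE x in lborel. {w. x + P w \<in> N} \<in> null_sets lborel)"
proof -
  define Q where "Q = (\<lambda>z. fst z + P (snd z)) -` N"
  have meas: "(\<lambda>z::'a \<times> 'b. fst z + P (snd z)) \<in> borel_measurable borel"
    by (intro borel_measurable_continuous_onI continuous_intros continuous_on_compose2[OF P]) auto
  have Q: "Q \<in> sets (lborel \<Otimes>\<^sub>M lborel)"
    using measurable_sets[OF meas N] unfolding lborel_prod by (simp add: Q_def)
  have sl[measurable]: "{w. x + P w \<in> N} \<in> sets borel" for x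
  proof -
    have "(\<lambda>w. x + P w) \<in> borel_measurable borel"
      by (intro borel_measurable_continuous_onI continuous_intros P)
    from measurable_sets[OF this N] show ?thesis by (simp add: vimage_def)
  qed
  have 1: "emeasure (lborel \<Otimes>\<^sub>M lborel) Q = (\<integral>\<^sup>+x. emeasure lborel {w. x + P w \<in> N} \<partial>lborel)"
    using lborel.emeasure_pair_measure_alt[OF Q] by (simp add: Q_def vimage_def)
  have m: "(\<lambda>x. emeasure lborel {w. x + P w \<in> N}) \<in> borel_measurable lborel"
    using lborel.measurable_emeasure_Pair[OF Q] by (simp add: Q_def vimage_def)
  have "emeasure lborel {x. x + P w \<in> N} = emeasure lborel N" for w
  proof -
    have "emeasure lborel N = emeasure (distr lborel borel ((+) (P w))) N"
      by (simp add: lborel_distr_plus)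
    also have "\<dots> = emeasure lborel {x. x + P w \<in> N}"
      using N by (subst emeasure_distr) (auto simp: vimage_def add.commute)
    finally show ?thesis by simp
  qed
  \<comment> \<open>Every section at fixed \<open>w\<close> is a translate of \<open>N\<close>;
    integrating over the whole space of \<open>w\<close> gives measure zero or infinity according to
    whether \<open>N\<close> is null.\<close>
  then have 2: "emeasure (lborel \<Otimes>\<^sub>M lborel) Q = emeasure lborel N * \<infinity>"
    using lborel_pair.emeasure_pair_measure_alt2[OF Q] by (simp add: Q_def vimage_def)
  have "N \<in> null_sets lborel \<longleftrightarrow> (\<integral>\<^sup>+x. emeasure lborel {w. x + P w \<in> N} \<partial>lborel) = 0"
    using 1 2 N by (auto simp: null_sets_def)
  also have "\<dots> \<longleftrightarrow> (AE x in lborel. emeasure lborel {w. x + P w \<in> N} = 0)"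
    by (rule nn_integral_0_iff_AE[OF m])
  also have "\<dots> \<longleftrightarrow> (AE x in lborel. {w. x + P w \<in> N} \<in> null_sets lborel)"
    by (simp add: null_sets_def)
  finally show ?thesis .
qed

section \<open>Slopes of Lipschitz functions of one real variable\<close>

lemma lipschitz_on_realD:
  fixes u :: "real \<Rightarrow> real"
  assumes "L-lipschitz_on UNIV u" shows "\<bar>u x - u y\<bar> \<le> L * \<bar>x - y\<bar>"
  using lipschitz_onD[OF assms, of x y] by (simp add: dist_real_def)

text \<open>
  Inside an interval of slope at most \<open>a\<close>, the points of the set are covered by disjoint intervals of
  slope at least \<open>b\<close>, so the set has density at most \<open>(a + L') / (b + L') < 1\<close> there.
\<close>

lemma negligible_oscillating_slope:
  fixes u :: "real \<Rightarrow> real"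
  assumes u: "L-lipschitz_on UNIV u" and "a < b"
  shows "negligible {t. (\<forall>r>0. \<exists>c d. 0 < d \<and> d < r \<and> t \<in> cball c d \<and> u (c + d) - u (c - d) \<le> a * (2 * d)) \<and>
                        (\<forall>r>0. \<exists>c d. 0 < d \<and> d < r \<and> t \<in> cball c d \<and> b * (2 * d) \<le> u (c + d) - u (c - d))}"
    (is "negligible ?E")
proof -
  \<comment> \<open>Adding the linear term \<open>L' * t\<close> makes \<open>u\<close>
    nondecreasing, so that it has a Stieltjes measure, and makes both shifted slopes
    \<open>a + L'\<close> and \<open>b + L'\<close> positive.\<close>
  define L' where "L' = L + \<bar>a\<bar> + 1"
  have "L \<ge> 0" using u by (simp add: lipschitz_on_def)
  then have L': "0 < a + L'" "0 < b + L'" "L \<le> L'" using \<open>a < b\<close> by (auto simp: L'_def)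
  define w where "w t = u t + L' * t" for t
  have wmono: "w x \<le> w y" if "x \<le> y" for x y
  proof -
    have "\<bar>u x - u y\<bar> \<le> L' * (y - x)"
      using lipschitz_on_realD[OF u, of x y] mult_right_mono[OF L'(3), of "y - x"] that by (simp add: abs_minus_commute)
    then show ?thesis by (simp add: w_def algebra_simps)
  qed
  have wcont: "continuous_on UNIV w"
    unfolding w_def using lipschitz_on_continuous_on[OF u] by (intro continuous_intros)
  \<comment> \<open>This measure expresses that the increments of \<open>w\<close> over disjoint
    subintervals add up to at most the increment over the enclosing interval.\<close>
  let ?\<mu> = "interval_measure w"
  have \<mu>: "emeasure ?\<mu> (cball c d) = ennreal (w (c + d) - w (c - d))" if "0 < d" for c d
    using emeasure_interval_measure_Icc[of "c - d" "c + d" w] wmono wcont that by (simp add: cball_eq_atLeastAtMost)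
  define \<theta> where "\<theta> = (a + L') / (b + L')"
  have \<theta>: "0 \<le> \<theta>" "\<theta> < 1" using L' \<open>a < b\<close> by (auto simp: \<theta>_def)
  show ?thesis
  proof (rule negligible_of_low_density[OF \<theta>])
    fix t r :: real assume t: "t \<in> ?E" and r: "0 < r"
    then obtain c d where cd: "0 < d" "d < r" "t \<in> cball c d" "u (c + d) - u (c - d) \<le> a * (2 * d)" by blast
    \<comment> \<open>The open interval leaves room around each of its points for short intervals of
      steep slope. The two endpoints return below in the null set \<open>?N\<close>.\<close>
    define S where "S = ?E \<inter> ball c d"
    define K where "K = {(p, q). 0 < q \<and> cball p q \<subseteq> cball c d \<and> b * (2 * q) \<le> u (p + q) - u (p - q)}"
    have cover: "\<exists>i. i \<in> K \<and> x \<in> cball (fst i) (snd i) \<and> snd i < e" if x: "x \<in> S" "0 < e" for x e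
    proof -
      obtain h where h: "h > 0" "cball x h \<subseteq> ball c d" using x(1) open_contains_cball[of "ball c d"] unfolding S_def by blast
      have "\<forall>r>0. \<exists>c d. 0 < d \<and> d < r \<and> x \<in> cball c d \<and> b * (2 * d) \<le> u (c + d) - u (c - d)"
        using x(1) by (simp add: S_def)
      then obtain p q where pq: "0 < q" "q < min e (h/2)" "x \<in> cball p q" "b * (2 * q) \<le> u (p + q) - u (p - q)"
        using x(2) h(1) by (metis half_gt_zero min_less_iff_conj)
      have "cball p q \<subseteq> cball x h"
      proof
        fix y assume "y \<in> cball p q"
        then show "y \<in> cball x h" using pq(2,3) dist_triangle[of x y p] by (simp add: dist_commute)
      qed
      then have "(p, q) \<in> K" using pq h(2) ball_subset_cball unfolding K_def by blast
      with pq show ?thesis by force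
    qed
    have K0: "0 < snd i" if "i \<in> K" for i using that by (auto simp: K_def)
    obtain C where C: "countable C" "C \<subseteq> K"
     "pairwise (\<lambda>i j. disjnt (cball (fst i) (snd i)) (cball (fst j) (snd j))) C"
     "negligible (S - (\<Union>i \<in> C. cball (fst i) (snd i)))"
      by (rule Vitali_covering_theorem_cballs[of K snd S fst, OF K0 cover])
    let ?V = "\<Union>i\<in>C. cball (fst i) (snd i)"
    have fin: "measure lebesgue (\<Union>i\<in>I. cball (fst i) (snd i)) \<le> \<theta> * (2 * d)" if I: "I \<subseteq> C" "finite I" for I
    proof -
      have IK: "0 < snd i" "cball (fst i) (snd i) \<subseteq> cball c d"
          "b * (2 * snd i) \<le> u (fst i + snd i) - u (fst i - snd i)" if "i \<in> I" for i
        using subsetD[OF C(2) subsetD[OF I(1) that]] unfolding K_def by auto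
      have pw: "disjoint_family_on (\<lambda>i. cball (fst i) (snd i)) I"
        using C(3) I(1) unfolding pairwise_def disjoint_family_on_def disjnt_def by blast
      have "measure lebesgue (\<Union>i\<in>I. cball (fst i) (snd i)) = (\<Sum>i\<in>I. measure lebesgue (cball (fst i) (snd i)))"
        by (subst measure_UNION'[OF I(2)]) (use C(3) I in \<open>auto intro: pairwise_mono\<close>)
      also have "\<dots> = (\<Sum>i\<in>I. 2 * snd i)"
        by (rule sum.cong) (use IK(1) in \<open>auto simp: cball_eq_atLeastAtMost less_imp_le\<close>)
      finally have m: "measure lebesgue (\<Union>i\<in>I. cball (fst i) (snd i)) = (\<Sum>i\<in>I. 2 * snd i)" .
      have "(b + L') * (\<Sum>i\<in>I. 2 * snd i) \<le> (\<Sum>i\<in>I. w (fst i + snd i) - w (fst i - snd i))"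
        unfolding sum_distrib_left by (rule sum_mono) (use IK(3) in \<open>auto simp: w_def algebra_simps\<close>)
      also have "ennreal \<dots> = (\<Sum>i\<in>I. emeasure ?\<mu> (cball (fst i) (snd i)))"
        using IK(1) by (subst sum_ennreal[symmetric]) (auto simp: \<mu> less_imp_le intro!: wmono)
      also have "\<dots> = emeasure ?\<mu> (\<Union>i\<in>I. cball (fst i) (snd i))"
        by (rule sum_emeasure[OF _ pw I(2)]) auto
      also have "\<dots> \<le> emeasure ?\<mu> (cball c d)"
        by (rule emeasure_mono) (use IK(2) in auto)
      also have "\<dots> = ennreal (w (c + d) - w (c - d))" using \<mu> cd by simp
      finally have "(b + L') * (\<Sum>i\<in>I. 2 * snd i) \<le> w (c + d) - w (c - d)"
        using wmono[of "c - d" "c + d"] cd(1) by (simp add: ennreal_le_iff ennreal_leI)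
      also have "\<dots> \<le> (a + L') * (2 * d)" using cd(4) by (simp add: w_def algebra_simps)
      finally show ?thesis using m L' by (simp add: \<theta>_def field_simps)
    qed
    have V: "?V \<in> lmeasurable" "measure lebesgue ?V \<le> \<theta> * (2 * d)"
      by (rule fmeasurable_UN_bound[OF C(1) lmeasurable_cball fin] measure_UN_bound[OF C(1) lmeasurable_cball fin]; assumption)+
    let ?N = "(S - ?V) \<union> sphere c d"
    have N: "negligible ?N" using C(4) negligible_sphere by (simp add: negligible_Un)
    have "?E \<inter> cball c d \<subseteq> ?V \<union> ?N" unfolding S_def by (auto simp: sphere_def)
    moreover have "?V \<union> ?N \<in> lmeasurable"
      using V N by (simp only: fmeasurable.Un negligible_imp_measurable)
    moreover have "measure lebesgue (?V \<union> ?N) = measure lebesgue ?V"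
      using N V by (simp only: fmeasurableD measure_Un_null_set negligible_iff_null_sets)
    moreover have "measure lebesgue (cball c d) = 2 * d" using cd(1) by (simp add: cball_eq_atLeastAtMost)
    ultimately show "\<exists>c d U. 0 < d \<and> d < r \<and> t \<in> cball c d \<and> U \<in> lmeasurable \<and>
        ?E \<inter> cball c d \<subseteq> U \<and> measure lebesgue U \<le> \<theta> * measure lebesgue (cball c d)"
      using V(2) cd(1,2,3) by (intro exI[of _ c] exI[of _ d] exI[of _ "?V \<union> ?N"] conjI) simp_all
  qed
qed

text \<open>Off the oscillation sets of all rational pairs, slopes over short intervals containing
  \<open>t\<close> cannot keep returning both below \<open>a\<close> and above a larger
  \<open>\<alpha>\<close>. A slope that is rational and correct up to \<eta> is enough later, and
  rationality keeps the number of cases countable.\<close>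

lemma lipschitz_real_almost_slope:
  fixes u :: "real \<Rightarrow> real"
  assumes u: "L-lipschitz_on UNIV u" and "\<eta> > 0"
  shows "negligible {t. \<not> (\<exists>\<alpha>\<in>\<rat>. \<exists>n::nat. \<forall>s. \<bar>s\<bar> < 1 / Suc n \<longrightarrow> \<bar>u (t + s) - u t - s * \<alpha>\<bar> \<le> \<eta> * \<bar>s\<bar>)}"
    (is "negligible ?N")
proof -
  define E where "E a b = {t. (\<forall>r>0. \<exists>c d. 0 < d \<and> d < r \<and> t \<in> cball c d \<and> u (c + d) - u (c - d) \<le> a * (2 * d)) \<and>
                        (\<forall>r>0. \<exists>c d. 0 < d \<and> d < r \<and> t \<in> cball c d \<and> b * (2 * d) \<le> u (c + d) - u (c - d))}" for a b
  have neg: "negligible (\<Union>(a, b)\<in>{(a, b). a \<in> \<rat> \<and> b \<in> \<rat> \<and> a < b}. E a b)"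
  proof (rule negligible_countable_Union)
    have "countable {(a::real, b::real). a \<in> \<rat> \<and> b \<in> \<rat> \<and> a < b}"
      by (rule countable_subset[of _ "\<rat> \<times> \<rat>"]) (auto intro!: countable_SIGMA countable_rat)
    then show "countable ((\<lambda>(a, b). E a b) ` {(a, b). a \<in> \<rat> \<and> b \<in> \<rat> \<and> a < b})" by (rule countable_image)
  next
    fix t assume "t \<in> (\<lambda>(a, b). E a b) ` {(a, b). a \<in> \<rat> \<and> b \<in> \<rat> \<and> a < b}"
    then show "negligible t" using negligible_oscillating_slope[OF u] by (auto simp: E_def)
  qed
  have "L \<ge> 0" using u by (simp add: lipschitz_on_def)
  have "t \<in> (\<Union>(a, b)\<in>{(a, b). a \<in> \<rat> \<and> b \<in> \<rat> \<and> a < b}. E a b)" if t: "t \<in> ?N" for t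
  proof (rule ccontr)
    assume notE: "t \<notin> (\<Union>(a, b)\<in>{(a, b). a \<in> \<rat> \<and> b \<in> \<rat> \<and> a < b}. E a b)"
    define slo where "slo b r \<longleftrightarrow> (\<forall>c d. 0 < d \<and> d < r \<and> t \<in> cball c d \<longrightarrow> u (c + d) - u (c - d) < b * (2 * d))" for b r
    define B where "B = {b. \<exists>r>0. slo b r}"
    have bnd: "\<bar>u (c + d) - u (c - d)\<bar> \<le> L * (2 * d)" if "0 < d" for c d
      using lipschitz_on_realD[OF u, of "c + d" "c - d"] that by simp
    have "L + 1 \<in> B"
      unfolding B_def slo_def
    proof (intro CollectI exI[of _ 1] conjI allI impI)
      fix c d :: real assume "0 < d \<and> d < 1 \<and> t \<in> cball c d"
      then have "u (c + d) - u (c - d) \<le> L * (2 * d)" "0 < 2 * d" using bnd[of d c] by auto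
      then show "u (c + d) - u (c - d) < (L + 1) * (2 * d)" by (simp add: distrib_right)
    qed simp
    have lowB: "- L \<le> b" if "b \<in> B" for b
    proof -
      obtain r where r: "r > 0" "slo b r" using \<open>b \<in> B\<close> by (auto simp: B_def)
      then have "u (t + r/2) - u (t - r/2) < b * r" unfolding slo_def by (metis (no_types) centre_in_cball field_sum_of_halves half_gt_zero_iff less_imp_le mult_2 less_add_same_cancel1)
      moreover have "- (L * r) \<le> u (t + r/2) - u (t - r/2)" using bnd[of "r/2" t] r(1) by simp
      ultimately have "(- L) * r \<le> b * r" by simp
      then show ?thesis using r(1) by (simp only: mult_le_cancel_right_pos)
    qed
    have bddB: "bdd_below B" using lowB by (rule bdd_belowI)
    define \<beta> where "\<beta> = Inf B"
    \<comment> \<open>Being below the infimum \<beta> of the eventual upper bounds, \<alpha> is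
      reached by slopes at every scale. As \<open>t\<close> does not oscillate between
      \<open>a\<close> and \<alpha>, slopes at most \<open>a\<close> must stop occurring; being
      close to \<beta>, \<alpha> also has an eventual upper bound
      \<open>b < \<alpha> + \<eta>\<close>.\<close>
    obtain \<alpha> where \<alpha>: "\<alpha> \<in> \<rat>" "\<beta> - \<eta>/4 < \<alpha>" "\<alpha> < \<beta>" using Rats_dense_in_real[of "\<beta> - \<eta>/4" \<beta>] \<open>\<eta> > 0\<close> by auto
    obtain a where a: "a \<in> \<rat>" "\<alpha> - \<eta> < a" "a < \<alpha>" using Rats_dense_in_real[of "\<alpha> - \<eta>" \<alpha>] \<open>\<eta> > 0\<close> by auto
    have "\<alpha> \<notin> B" using \<alpha>(3) cInf_lower[OF _ bddB] unfolding \<beta>_def by fastforce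
    then have up: "\<forall>r>0. \<exists>c d. 0 < d \<and> d < r \<and> t \<in> cball c d \<and> \<alpha> * (2 * d) \<le> u (c + d) - u (c - d)"
      unfolding B_def slo_def by (force simp: not_less)
    have "t \<notin> E a \<alpha>" using notE a \<alpha> by auto
    then obtain r1 where r1: "r1 > 0" "\<And>c d. 0 < d \<Longrightarrow> d < r1 \<Longrightarrow> t \<in> cball c d \<Longrightarrow> a * (2 * d) < u (c + d) - u (c - d)"
      using up unfolding E_def by (force simp: not_le)
    obtain b where b: "b \<in> B" "b < \<alpha> + \<eta>"
      using cInf_lessD[of B "\<alpha> + \<eta>"] \<alpha>(2) \<open>\<eta> > 0\<close> \<open>L + 1 \<in> B\<close> unfolding \<beta>_def by auto
    then obtain r2 where r2: "r2 > 0" "slo b r2" by (auto simp: B_def)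
    obtain n :: nat where n: "1 / Suc n < min r1 r2" using r1(1) r2(1) by (metis min_less_iff_conj nat_approx_posE)
    have "\<bar>u (t + s) - u t - s * \<alpha>\<bar> \<le> \<eta> * \<bar>s\<bar>" if s: "\<bar>s\<bar> < 1 / Suc n" for s
    proof -
      \<comment> \<open>The closed interval between \<open>t\<close> and \<open>t + s\<close>; thus
        \<open>t\<close> is one of its endpoints, on a side that depends on the sign of
        \<open>s\<close>.\<close>
      define c d where "c = t + s/2" and "d = \<bar>s\<bar>/2"
      show ?thesis
      proof (cases "s = 0")
        case False
        have d: "0 < d" "d < r1" "d < r2" using False s n by (auto simp: d_def)
        have tc: "t \<in> cball c d" by (simp add: c_def d_def dist_real_def)
        have 1: "a * (2 * d) < u (c + d) - u (c - d)" using r1(2)[OF d(1,2) tc] .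
        have 2: "u (c + d) - u (c - d) < b * (2 * d)" using r2(2) d tc by (auto simp: slo_def)
        have 3: "(\<alpha> - \<eta>) * (2 * d) \<le> a * (2 * d)" using a d by (intro mult_right_mono) auto
        have 4: "b * (2 * d) \<le> (\<alpha> + \<eta>) * (2 * d)" using b d by (intro mult_right_mono) auto
        show ?thesis
        proof (cases "s > 0")
          case True
          then have "c + d = t + s" "c - d = t" "2 * d = s" by (auto simp: c_def d_def)
          then show ?thesis using 1 2 3 4 True by (simp add: abs_le_iff algebra_simps)
        next
          case neg: False
          then have "c + d = t" "c - d = t + s" "2 * d = - s" using False by (auto simp: c_def d_def)
          then show ?thesis using 1 2 3 4 neg False by (simp add: abs_le_iff algebra_simps)
        qed
      qed simp
    qed
    then have "t \<notin> ?N" using \<alpha>(1) by blast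
    then show False using t by blast
  qed
  then show ?thesis using negligible_subset[OF neg] by blast
qed

section \<open>Almost everywhere affine approximation of Lipschitz functions\<close>

lemma negligible_iff_null_sets_lborel:
  "S \<in> sets borel \<Longrightarrow> negligible S \<longleftrightarrow> S \<in> null_sets lborel"
  by (simp add: negligible_iff_null_sets null_sets_def)

lemma closed_slope_set:
  fixes u :: "'a::real_inner \<Rightarrow> real"
  assumes "continuous_on UNIV u"
  shows "closed {x. \<forall>s. \<bar>s\<bar> < r \<longrightarrow> \<bar>u (x + s *\<^sub>R i) - u x - s * \<alpha>\<bar> \<le> \<epsilon> * \<bar>s\<bar>}"
proof -
  have "{x. \<forall>s. \<bar>s\<bar> < r \<longrightarrow> \<bar>u (x + s *\<^sub>R i) - u x - s * \<alpha>\<bar> \<le> \<epsilon> * \<bar>s\<bar>} =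
      (\<Inter>s\<in>{s. \<bar>s\<bar> < r}. {x. \<bar>u (x + s *\<^sub>R i) - u x - s * \<alpha>\<bar> \<le> \<epsilon> * \<bar>s\<bar>})" by auto
  also have "closed \<dots>"
    by (intro closed_INT ballI closed_Collect_le continuous_intros continuous_on_compose2[OF assms]) auto
  finally show ?thesis .
qed

text \<open>Rational slopes and scales \<open>1 / Suc n\<close> exhibit the complement as a
  countable union of closed sets. Hence the exceptional set is Borel, and it suffices that each line
  parallel to \<open>i\<close> meets it in a null set.\<close>

lemma negligible_no_directional_slope:
  fixes u :: "'a::euclidean_space \<Rightarrow> real"
  assumes u: "L-lipschitz_on UNIV u" and "\<epsilon> > 0" and i: "norm i = 1"
  shows "negligible {x. \<not> (\<exists>\<alpha>\<in>\<rat>. \<exists>n::nat. \<forall>s. \<bar>s\<bar> < 1 / Suc n \<longrightarrow> \<bar>u (x + s *\<^sub>R i) - u x - s * \<alpha>\<bar> \<le> \<epsilon> * \<bar>s\<bar>)}"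
    (is "negligible ?N")
proof -
  have cont: "continuous_on UNIV u" using u by (rule lipschitz_on_continuous_on)
  have "?N = - (\<Union>\<alpha>\<in>\<rat>. \<Union>n::nat. {x. \<forall>s. \<bar>s\<bar> < 1 / Suc n \<longrightarrow> \<bar>u (x + s *\<^sub>R i) - u x - s * \<alpha>\<bar> \<le> \<epsilon> * \<bar>s\<bar>})"
    by blast
  also have "\<dots> \<in> sets borel"
    by (intro borel_comp sets.countable_UN'' countable_rat borel_closed closed_slope_set[OF cont] countableI_type)
  finally have N: "?N \<in> sets borel" .
  have "{w. x + w *\<^sub>R i \<in> ?N} \<in> null_sets lborel" for x
  proof -
    let ?w = "\<lambda>t. u (x + t *\<^sub>R i)"
    have "L-lipschitz_on UNIV ?w"
    proof (rule lipschitz_onI)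
      fix s t :: real
      have "dist (x + s *\<^sub>R i) (x + t *\<^sub>R i) = dist s t"
        by (simp add: dist_norm i flip: scaleR_left_diff_distrib)
      then show "dist (?w s) (?w t) \<le> L * dist s t"
        using lipschitz_onD[OF u, of "x + s *\<^sub>R i" "x + t *\<^sub>R i"] by simp
    qed (use u in \<open>simp add: lipschitz_on_def\<close>)
    from lipschitz_real_almost_slope[OF this \<open>\<epsilon> > 0\<close>]
    have "negligible {w. x + w *\<^sub>R i \<in> ?N}" by (simp add: algebra_simps)
    moreover have "{w. x + w *\<^sub>R i \<in> ?N} \<in> sets borel"
    proof -
      have "(\<lambda>w. x + w *\<^sub>R i) \<in> borel_measurable borel"
        by (intro borel_measurable_continuous_onI continuous_intros)
      from measurable_sets[OF this N] show ?thesis by (simp add: vimage_def)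
    qed
    ultimately show ?thesis by (simp add: negligible_iff_null_sets_lborel)
  qed
  then have "?N \<in> null_sets lborel"
    using null_sets_lborel_iff_AE_slices[OF N, of "\<lambda>w::real. w *\<^sub>R i"] by (simp add: continuous_intros)
  then show ?thesis using N by (simp only: negligible_iff_null_sets_lborel)
qed

definition rational_vectors :: "'a::euclidean_space set" where
  "rational_vectors = {a. \<forall>i\<in>Basis. a \<bullet> i \<in> \<rat>}"

lemma countable_rational_vectors: "countable (rational_vectors :: 'a::euclidean_space set)"
proof -
  have "(rational_vectors :: 'a set) \<subseteq> (\<lambda>f. \<Sum>i\<in>Basis. f i *\<^sub>R i) ` (Basis \<rightarrow>\<^sub>E (\<rat> :: real set))" (is "_ \<subseteq> ?g ` _")
  proof
    fix a :: 'a assume "a \<in> rational_vectors"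
    then have "restrict (\<lambda>i. a \<bullet> i) Basis \<in> Basis \<rightarrow>\<^sub>E \<rat>" by (auto simp: rational_vectors_def)
    moreover have "a = ?g (restrict (\<lambda>i. a \<bullet> i) Basis)" by (simp add: euclidean_representation)
    ultimately show "a \<in> ?g ` (Basis \<rightarrow>\<^sub>E \<rat>)" by blast
  qed
  moreover have "countable (Basis \<rightarrow>\<^sub>E (\<rat> :: real set) :: ('a \<Rightarrow> real) set)"
    by (intro countable_PiE finite_Basis countable_rat)
  ultimately show ?thesis by (rule countable_subset[OF _ countable_image])
qed

text \<open>
  Walk from \<open>x\<close> to \<open>x + h\<close> parallel to the axes, replacing each corner by a nearby point of \<open>M\<close>, where
  the slopes along the axes are controlled. This replaces the integration by parts of the usual proof
  of Rademacher's theorem.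
\<close>

lemma slope_at_nonporous_point:
  fixes u :: "'a::euclidean_space \<Rightarrow> real" and L \<epsilon> \<kappa> :: real
  assumes u: "L-lipschitz_on UNIV u" and pos: "\<epsilon> > 0" "\<kappa> > 0"
    and M: "\<And>x i s. x \<in> M \<Longrightarrow> i \<in> Basis \<Longrightarrow> \<bar>s\<bar> < r \<Longrightarrow> \<bar>u (x + s *\<^sub>R i) - u x - s * (a \<bullet> i)\<bar> \<le> \<epsilon> * \<bar>s\<bar>"
    and x: "x \<in> M"
    and near: "\<And>y. dist y x < r \<Longrightarrow> \<exists>y'\<in>M. dist y' y \<le> \<kappa> * dist y x"
    and h: "DIM('a) * norm h < r"
  shows "\<bar>u (x + h) - u x - a \<bullet> h\<bar> \<le> DIM('a) * (\<epsilon> + 2 * L * \<kappa> * DIM('a)) * norm h"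
proof -
  have L: "L \<ge> 0" using u by (simp add: lipschitz_on_def)
  define z where "z F = x + (\<Sum>i\<in>F. (h \<bullet> i) *\<^sub>R i)" for F
  have zx: "dist (z F) x \<le> DIM('a) * norm h" if "F \<subseteq> Basis" for F
  proof -
    have "norm ((h \<bullet> i) *\<^sub>R i) \<le> norm h" if "i \<in> F" for i
      using that \<open>F \<subseteq> Basis\<close> Basis_le_norm[of i h] by (auto simp: subset_iff)
    then have "norm (\<Sum>i\<in>F. (h \<bullet> i) *\<^sub>R i) \<le> (\<Sum>i\<in>F. norm h)"
      by (rule sum_norm_le)
    also have "\<dots> \<le> DIM('a) * norm h"
      using card_mono[OF finite_Basis that] by (simp add: mult_right_mono)
    finally show ?thesis by (simp add: z_def dist_norm)
  qed
  have "\<bar>u (z F) - u x - (\<Sum>i\<in>F. (h \<bullet> i) * (a \<bullet> i))\<bar> \<le> card F * (\<epsilon> + 2 * L * \<kappa> * DIM('a)) * norm h"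
    if "finite F" "F \<subseteq> Basis" for F
    using that
  proof (induction F rule: finite_induct)
    case empty
    then show ?case by (simp add: z_def)
  next
    case (insert i F)
    have i: "i \<in> Basis" "F \<subseteq> Basis" using insert by auto
    have zins: "z (insert i F) = z F + (h \<bullet> i) *\<^sub>R i" using insert by (simp add: z_def)
    have hi: "\<bar>h \<bullet> i\<bar> \<le> norm h" using i Basis_le_norm by blast
    have "norm h \<le> DIM('a) * norm h" using DIM_positive[where 'a='a] by (simp add: mult_le_cancel_right1)
    then have hr: "\<bar>h \<bullet> i\<bar> < r" using hi h by linarith
    obtain y' where y': "y' \<in> M" "dist y' (z F) \<le> \<kappa> * dist (z F) x"
      using near[of "z F"] zx[OF i(2)] h by auto
    have d: "dist y' (z F) \<le> \<kappa> * (DIM('a) * norm h)"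
      using y'(2) mult_left_mono[OF zx[OF i(2)], of \<kappa>] pos by linarith
    have 1: "\<bar>u (y' + (h \<bullet> i) *\<^sub>R i) - u y' - (h \<bullet> i) * (a \<bullet> i)\<bar> \<le> \<epsilon> * norm h"
      using M[OF y'(1) i(1) hr] mult_left_mono[OF hi, of \<epsilon>] pos by linarith
    have 2: "\<bar>u (y' + (h \<bullet> i) *\<^sub>R i) - u (z F + (h \<bullet> i) *\<^sub>R i)\<bar> \<le> L * (\<kappa> * (DIM('a) * norm h))"
      using lipschitz_onD[OF u, of "y' + (h \<bullet> i) *\<^sub>R i" "z F + (h \<bullet> i) *\<^sub>R i"] mult_left_mono[OF d L]
      by (simp add: dist_real_def)
    have 3: "\<bar>u y' - u (z F)\<bar> \<le> L * (\<kappa> * (DIM('a) * norm h))"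
      using lipschitz_onD[OF u, of y' "z F"] mult_left_mono[OF d L] by (simp add: dist_real_def)
    have IH: "\<bar>u (z F) - u x - (\<Sum>i\<in>F. (h \<bullet> i) * (a \<bullet> i))\<bar> \<le> card F * (\<epsilon> + 2 * L * \<kappa> * DIM('a)) * norm h"
      using insert by auto
    \<comment> \<open>Each further axis costs one slope error \<open>\<epsilon> * norm h\<close> and
      two replacement errors, for the corner and for its translate along the axis.\<close>
    have "card (insert i F) * (\<epsilon> + 2 * L * \<kappa> * DIM('a)) * norm h =
        card F * (\<epsilon> + 2 * L * \<kappa> * DIM('a)) * norm h + \<epsilon> * norm h + 2 * (L * (\<kappa> * (DIM('a) * norm h)))"
      using insert by (simp add: algebra_simps)
    moreover have "(\<Sum>i\<in>insert i F. (h \<bullet> i) * (a \<bullet> i)) = (h \<bullet> i) * (a \<bullet> i) + (\<Sum>i\<in>F. (h \<bullet> i) * (a \<bullet> i))"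
      using insert by simp
    ultimately show ?case using 1 2 3 IH unfolding zins by linarith
  qed
  from this[of Basis] show ?thesis
    by (simp add: z_def euclidean_representation euclidean_inner[of a h] mult.commute)
qed

text \<open>A form of Rademacher's theorem with tolerance. Almost every point has approximate slopes
  along all axes, hence lies in some set \<open>M a n\<close> with rational \<open>a\<close>; almost
  no point of such a set is porous for it, and at the others the axis slopes combine to an affine
  approximation.\<close>

lemma negligible_no_affine_approximation:
  fixes u :: "'a::euclidean_space \<Rightarrow> real"
  assumes u: "L-lipschitz_on UNIV u" and "\<eta> > 0"
  shows "negligible {x. \<not> (\<exists>a\<in>rational_vectors. \<exists>n::nat. \<forall>y. dist y x < 1 / Suc n \<longrightarrow>
            \<bar>u y - u x - a \<bullet> (y - x)\<bar> \<le> \<eta> * dist y x)}" (is "negligible ?N")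
proof -
  have L: "L \<ge> 0" using u by (simp add: lipschitz_on_def)
  let ?D = "real DIM('a)"
  have D: "?D > 0" by simp
  \<comment> \<open>The error of the walk along the axes is \<open>?D * \<epsilon>\<close> plus
    \<open>2 * L * \<kappa> * ?D * ?D\<close>. The constants give each summand at most half of
    \<eta>; \<open>L + 1\<close> replaces \<open>L\<close> to keep the denominator positive.\<close>
  define \<epsilon> where "\<epsilon> = \<eta> / (2 * ?D)"
  define X where "X = (L + 1) * ?D * ?D"
  have X: "X > 0" using L D by (simp add: X_def)
  define \<kappa> where "\<kappa> = \<eta> / (4 * X)"
  have pos: "\<epsilon> > 0" "\<kappa> > 0" using X \<open>\<eta> > 0\<close> by (auto simp: \<epsilon>_def \<kappa>_def)
  have small: "?D * (\<epsilon> + 2 * L * \<kappa> * ?D) \<le> \<eta>"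
  proof -
    have "?D * (2 * L * \<kappa> * ?D) = \<kappa> * X * (2 * (L / (L + 1)))" using L by (simp add: X_def)
    also have "\<kappa> * X = \<eta>/4" unfolding \<kappa>_def using D L X by simp
    also have "\<eta>/4 * (2 * (L / (L + 1))) = \<eta>/2 * (L / (L + 1))" by simp
    also have "\<dots> \<le> \<eta>/2 * 1" using L \<open>\<eta> > 0\<close> by (intro mult_left_mono) (auto simp: field_simps)
    finally have "?D * (2 * L * \<kappa> * ?D) \<le> \<eta>/2" by simp
    moreover have "?D * \<epsilon> = \<eta>/2" using D by (simp add: \<epsilon>_def)
    ultimately show ?thesis by (simp add: distrib_left)
  qed
  define M where "M a n = {x. \<forall>i\<in>Basis. \<forall>s. \<bar>s\<bar> < 1 / Suc n \<longrightarrow> \<bar>u (x + s *\<^sub>R i) - u x - s * (a \<bullet> i)\<bar> \<le> \<epsilon> * \<bar>s\<bar>}"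
    for a and n :: nat
  define Nd where "Nd i = {x. \<not> (\<exists>\<alpha>\<in>\<rat>. \<exists>n::nat. \<forall>s. \<bar>s\<bar> < 1 / Suc n \<longrightarrow> \<bar>u (x + s *\<^sub>R i) - u x - s * \<alpha>\<bar> \<le> \<epsilon> * \<bar>s\<bar>)}" for i
  define Np where "Np a n = {x \<in> M a n. \<not> (\<exists>r>0. \<forall>y. dist y x < r \<longrightarrow> (\<exists>y'\<in>M a n. dist y' y \<le> \<kappa> * dist y x))}" for a n
  have "negligible (Nd i)" if "i \<in> Basis" for i
    unfolding Nd_def using negligible_no_directional_slope[OF u pos(1)] that by simp
  then have "negligible (\<Union>i\<in>Basis. Nd i)" by (intro negligible_Union) auto
  moreover have "negligible (\<Union>(a, n)\<in>rational_vectors \<times> UNIV. Np a n)"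
  proof (rule negligible_countable_Union)
    show "countable ((\<lambda>(a, n). Np a n) ` (rational_vectors \<times> UNIV))"
      by (intro countable_image countable_SIGMA countable_rational_vectors countableI_type)
    show "negligible S" if "S \<in> (\<lambda>(a, n). Np a n) ` (rational_vectors \<times> UNIV)" for S
      using that negligible_porous_points[OF pos(2)] by (auto simp: Np_def)
  qed
  ultimately have neg: "negligible ((\<Union>i\<in>Basis. Nd i) \<union> (\<Union>(a, n)\<in>rational_vectors \<times> UNIV. Np a n))"
    by (rule negligible_Un)
  have "?N \<subseteq> (\<Union>i\<in>Basis. Nd i) \<union> (\<Union>(a, n)\<in>rational_vectors \<times> UNIV. Np a n)"
  proof (rule subsetI, rule ccontr)
    fix x assume x: "x \<in> ?N" and notin: "x \<notin> (\<Union>i\<in>Basis. Nd i) \<union> (\<Union>(a, n)\<in>rational_vectors \<times> UNIV. Np a n)"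
    have "\<forall>i\<in>Basis. \<exists>\<alpha> n. \<alpha> \<in> \<rat> \<and> (\<forall>s. \<bar>s\<bar> < 1 / Suc n \<longrightarrow> \<bar>u (x + s *\<^sub>R i) - u x - s * \<alpha>\<bar> \<le> \<epsilon> * \<bar>s\<bar>)"
      using notin unfolding Nd_def by blast
    then obtain \<alpha> n where an: "\<And>i. i \<in> Basis \<Longrightarrow> \<alpha> i \<in> \<rat>"
      "\<And>i s. i \<in> Basis \<Longrightarrow> \<bar>s\<bar> < 1 / Suc (n i) \<Longrightarrow> \<bar>u (x + s *\<^sub>R i) - u x - s * \<alpha> i\<bar> \<le> \<epsilon> * \<bar>s\<bar>"
      by metis
    define a where "a = (\<Sum>i\<in>Basis. \<alpha> i *\<^sub>R i)"
    define m where "m = Max (n ` Basis)"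
    have ai: "a \<bullet> i = \<alpha> i" if "i \<in> Basis" for i using that by (simp add: a_def)
    have a: "a \<in> rational_vectors" using an(1) ai by (simp add: rational_vectors_def)
    have xM: "x \<in> M a m"
      unfolding M_def
    proof (intro CollectI ballI allI impI)
      fix i :: 'a and s :: real assume i: "i \<in> Basis" and s: "\<bar>s\<bar> < 1 / Suc m"
      have "n i \<le> m" using i by (simp add: m_def)
      then have "1 / real (Suc m) \<le> 1 / Suc (n i)" by (simp add: frac_le)
      then show "\<bar>u (x + s *\<^sub>R i) - u x - s * (a \<bullet> i)\<bar> \<le> \<epsilon> * \<bar>s\<bar>" using an(2)[OF i] s ai[OF i] by simp
    qed
    moreover have "x \<notin> Np a m" using notin a by auto
    ultimately obtain r where r: "r > 0" "\<And>y. dist y x < r \<Longrightarrow> \<exists>y'\<in>M a m. dist y' y \<le> \<kappa> * dist y x"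
      unfolding Np_def by blast
    define r' where "r' = min r (1 / Suc m)"
    have Mslope: "\<bar>u (z + s *\<^sub>R i) - u z - s * (a \<bullet> i)\<bar> \<le> \<epsilon> * \<bar>s\<bar>"
      if "z \<in> M a m" "i \<in> Basis" "\<bar>s\<bar> < r'" for z i s
      using that by (simp add: M_def r'_def)
    \<comment> \<open>Intermediate corners lie at distance up to \<open>?D * norm h\<close> from
      \<open>x\<close>, so the radius has to be divided by the dimension.\<close>
    have "r' / ?D > 0" using r(1) D by (simp add: r'_def)
    then obtain k :: nat where k: "1 / Suc k < r' / ?D" using nat_approx_posE by blast
    have "\<bar>u y - u x - a \<bullet> (y - x)\<bar> \<le> \<eta> * dist y x" if y: "dist y x < 1 / Suc k" for y
    proof -
      have "?D * norm (y - x) < r'" using less_trans[OF y k] D by (simp add: dist_norm field_simps)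
      then have "\<bar>u (x + (y - x)) - u x - a \<bullet> (y - x)\<bar> \<le> ?D * (\<epsilon> + 2 * L * \<kappa> * ?D) * norm (y - x)"
        by (intro slope_at_nonporous_point[OF u pos _ xM, where r = r'] Mslope r(2)) (auto simp: r'_def)
      also have "\<dots> \<le> \<eta> * norm (y - x)" using small by (rule mult_right_mono) simp
      finally show ?thesis by (simp add: dist_norm)
    qed
    with a x show False by blast
  qed
  then show ?thesis by (rule negligible_subset[OF neg])
qed

section \<open>Mollification\<close>

text \<open>Squaring the truncated paraboloid makes it continuously differentiable across the unit
  sphere, which is all the smoothness the mollifier has to supply.\<close>

definition bump :: "'a::euclidean_space \<Rightarrow> real" where
  "bump z = (max 0 (1 - z \<bullet> z))\<^sup>2"

lemma has_real_derivative_max_0_square: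
  "((\<lambda>s. (max 0 s)\<^sup>2) has_real_derivative 2 * max 0 s) (at s)"
proof -
  consider "s > 0" | "s < 0" | "s = 0" by linarith
  then show ?thesis
  proof cases
    case 1
    have "((\<lambda>s. s\<^sup>2) has_real_derivative 2 * s) (at s)" by (auto intro!: derivative_eq_intros)
    then have "((\<lambda>s. (max 0 s)\<^sup>2) has_real_derivative 2 * s) (at s)"
      by (rule DERIV_cong_ev[THEN iffD1, rotated -1])
         (use 1 in \<open>auto simp: eventually_nhds intro!: exI[of _ "{0<..}"]\<close>)
    then show ?thesis using 1 by simp
  next
    case 2
    have "((\<lambda>s. 0) has_real_derivative 0) (at s)" by simp
    then have "((\<lambda>s. (max 0 s)\<^sup>2) has_real_derivative 0) (at s)"
      by (rule DERIV_cong_ev[THEN iffD1, rotated -1])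
         (use 2 in \<open>auto simp: eventually_nhds intro!: exI[of _ "{..<0}"]\<close>)
    then show ?thesis using 2 by simp
  next
    case 3
    have "((\<lambda>h::real. (max 0 h)\<^sup>2 / h) \<longlongrightarrow> 0) (at 0)"
    proof (rule Lim_null_comparison)
      show "\<forall>\<^sub>F h in at 0. norm ((max 0 h)\<^sup>2 / h) \<le> \<bar>h\<bar>"
        by (rule always_eventually) (auto simp: max_def power2_eq_square)
      show "((\<lambda>h::real. \<bar>h\<bar>) \<longlongrightarrow> 0) (at 0)" by (rule tendsto_eq_intros | simp)+
    qed
    then show ?thesis using 3 by (simp add: DERIV_def)
  qed
qed

lemma has_derivative_bump:
  "(bump has_derivative (\<lambda>h. - 4 * max 0 (1 - z \<bullet> z) * (z \<bullet> h))) (at z)"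
proof -
  have 1: "((\<lambda>z. 1 - z \<bullet> z) has_derivative (\<lambda>h. - 2 * (z \<bullet> h))) (at z)"
    by (auto intro!: derivative_eq_intros simp: inner_commute)
  have 2: "((\<lambda>s. (max 0 s)\<^sup>2) has_derivative (\<lambda>h. 2 * max 0 (1 - z \<bullet> z) * h)) (at (1 - z \<bullet> z))"
    using has_real_derivative_max_0_square[of "1 - z \<bullet> z"] by (simp add: has_field_derivative_def)
  show ?thesis
    unfolding bump_def[abs_def]
    by (rule has_derivative_eq_rhs[OF has_derivative_compose[OF 1 2]]) auto
qed

lemma continuous_on_bump [continuous_intros]:
  assumes "continuous_on S f" shows "continuous_on S (\<lambda>x. bump (f x))"
  unfolding bump_def by (intro continuous_intros assms)

lemma bump_nonneg: "0 \<le> bump z" by (simp add: bump_def)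

lemma bump_eq_0: "1 \<le> norm z \<Longrightarrow> bump z = 0"
  by (simp add: bump_def dot_square_norm)

lemma bump_lipschitz: "4-lipschitz_on UNIV (bump :: 'a::euclidean_space \<Rightarrow> real)"
proof (rule lipschitz_onI)
  fix x y :: 'a
  have "norm (bump x - bump y) \<le> 4 * norm (x - y)"
  proof (rule differentiable_bound[of UNIV])
    fix z :: 'a
    show "(bump has_derivative (\<lambda>h. - 4 * max 0 (1 - z \<bullet> z) * (z \<bullet> h))) (at z within UNIV)"
      using has_derivative_bump by simp
    show "onorm (\<lambda>h. - 4 * max 0 (1 - z \<bullet> z) * (z \<bullet> h)) \<le> 4"
    proof (rule onorm_le)
      fix h
      have "max 0 (1 - z \<bullet> z) * norm z \<le> 1"
      proof (cases "norm z \<le> 1")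
        case True
        then have "max 0 (1 - z \<bullet> z) * norm z \<le> 1 * 1" by (intro mult_mono) auto
        then show ?thesis by simp
      next
        case False
        then show ?thesis by (simp add: dot_square_norm)
      qed
      have "norm (- 4 * max 0 (1 - z \<bullet> z) * (z \<bullet> h)) = 4 * (max 0 (1 - z \<bullet> z) * \<bar>z \<bullet> h\<bar>)"
        by (simp add: abs_mult)
      also have "\<dots> \<le> 4 * (max 0 (1 - z \<bullet> z) * (norm z * norm h))"
        by (intro mult_left_mono Cauchy_Schwarz_ineq2) auto
      also have "\<dots> = 4 * ((max 0 (1 - z \<bullet> z) * norm z) * norm h)" by simp
      also have "\<dots> \<le> 4 * (1 * norm h)"
        by (intro mult_left_mono mult_right_mono \<open>max 0 (1 - z \<bullet> z) * norm z \<le> 1\<close>) auto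
      finally show "norm (- 4 * max 0 (1 - z \<bullet> z) * (z \<bullet> h)) \<le> 4 * norm h" by simp
    qed
  qed auto
  then show "dist (bump x) (bump y) \<le> 4 * dist x y" by (simp add: dist_norm)
qed simp

lemma integrable_continuous_compact_support:
  fixes f :: "'a::euclidean_space \<Rightarrow> real"
  assumes "continuous_on UNIV f" and "\<And>x. x \<notin> cball c R \<Longrightarrow> f x = 0"
  shows "integrable lborel f"
proof -
  have "(\<lambda>x. indicator (cball c R) x *\<^sub>R f x) = f"
    using assms(2) by (auto simp: indicator_def fun_eq_iff)
  then show ?thesis
    using borel_integrable_compact[of "cball c R" f] continuous_on_subset[OF assms(1)] by auto
qed

lemma integrable_times_bump:
  fixes u :: "'a::euclidean_space \<Rightarrow> real"
  assumes "continuous_on UNIV u" shows "integrable lborel (\<lambda>z. u z * bump (z - w))"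
  by (rule integrable_continuous_compact_support[of _ w 1])
     (auto intro!: continuous_intros assms bump_eq_0 simp: dist_norm norm_minus_commute)

lemma integrable_bump: "integrable lborel (bump :: 'a::euclidean_space \<Rightarrow> real)"
  using integrable_times_bump[of "\<lambda>_. 1" 0] by simp

definition bump_mass :: "'a::euclidean_space itself \<Rightarrow> real" where
  "bump_mass _ = (\<integral>z. bump (z::'a) \<partial>lborel)"

lemma bump_mass_pos: "0 < bump_mass TYPE('a::euclidean_space)"
proof -
  let ?B = "cball (0::'a) (1/2)"
  have "0 < 9/16 * measure lborel ?B" by simp
  also have "\<dots> = (\<integral>z. 9/16 * indicator ?B z \<partial>lborel)"
    using emeasure_lborel_cball_finite[of "0::'a" "1/2"] by (simp add: less_top)
  also have "\<dots> \<le> (\<integral>z. bump (z::'a) \<partial>lborel)"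
  proof (rule integral_mono)
    show "integrable lborel (\<lambda>z. 9/16 * indicator ?B z :: real)"
      using emeasure_lborel_cball_finite[of "0::'a" "1/2"] by (intro integrable_mult_right integrable_real_indicator) auto
    show "integrable lborel (bump :: 'a \<Rightarrow> real)" by (rule integrable_bump)
    fix z :: 'a
    show "9/16 * indicator ?B z \<le> bump z"
    proof (cases "z \<in> ?B")
      case True
      then have "norm z ^ 2 \<le> (1/2)^2" by (intro power_mono) auto
      then have "3/4 \<le> max 0 (1 - z \<bullet> z)" by (simp add: dot_square_norm power2_eq_square)
      then have "(3/4)^2 \<le> bump z" unfolding bump_def by (rule power_mono) simp
      then show ?thesis using True by (simp add: power2_eq_square)
    qed (simp add: bump_nonneg)
  qed
  finally show ?thesis by (simp add: bump_mass_def)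
qed

text \<open>With the shift in the argument of \<open>u\<close>, Lipschitz bounds pass to the average
  at once. For differentiation a change of variables moves \<open>x\<close> into the kernel.\<close>

definition mollify :: "real \<Rightarrow> ('a::euclidean_space \<Rightarrow> real) \<Rightarrow> 'a \<Rightarrow> real" where
  "mollify \<epsilon> u x = (\<integral>z. u (x + \<epsilon> *\<^sub>R z) * bump z \<partial>lborel) / bump_mass TYPE('a)"

lemma integrable_mollify:
  fixes u :: "'a::euclidean_space \<Rightarrow> real"
  assumes "continuous_on UNIV u" shows "integrable lborel (\<lambda>z. u (x + \<epsilon> *\<^sub>R z) * bump z)"
  using integrable_times_bump[of "\<lambda>z. u (x + \<epsilon> *\<^sub>R z)" 0]
  by (simp add: continuous_on_compose2[OF assms] continuous_intros)

lemma abs_average_bump_le: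
  fixes g :: "'a::euclidean_space \<Rightarrow> real"
  assumes g: "continuous_on UNIV g" and b: "\<And>z. norm z < 1 \<Longrightarrow> \<bar>g z\<bar> \<le> b"
  shows "\<bar>(\<integral>z. g z * bump z \<partial>lborel) / bump_mass TYPE('a)\<bar> \<le> b"
proof -
  have b0: "b \<ge> 0" using b[of 0] by auto
  have int: "integrable lborel (\<lambda>z. g z * bump z)" using integrable_times_bump[OF g, of 0] by simp
  have "\<bar>\<integral>z. g z * bump z \<partial>lborel\<bar> \<le> (\<integral>z. \<bar>g z * bump z\<bar> \<partial>lborel)"
    using integral_norm_bound[of lborel "\<lambda>z. g z * bump z"] by simp
  also have "\<dots> \<le> (\<integral>z. b * bump (z::'a) \<partial>lborel)"
  proof (rule integral_mono)
    fix z :: 'a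
    show "\<bar>g z * bump z\<bar> \<le> b * bump z"
      using b[of z] bump_eq_0[of z] bump_nonneg[of z] by (cases "norm z < 1") (auto simp: abs_mult mult_right_mono)
  qed (use int integrable_bump[where 'a='a] in auto)
  also have "\<dots> = b * bump_mass TYPE('a)" using integrable_bump[where 'a='a] by (simp add: bump_mass_def)
  finally show ?thesis using bump_mass_pos[where 'a='a] by (simp add: abs_divide divide_le_eq)
qed

lemma mollify_diff:
  fixes u :: "'a::euclidean_space \<Rightarrow> real"
  assumes "continuous_on UNIV u"
  shows "mollify \<epsilon> u y - mollify \<epsilon> u x - c =
    (\<integral>z. (u (y + \<epsilon> *\<^sub>R z) - u (x + \<epsilon> *\<^sub>R z) - c) * bump z \<partial>lborel) / bump_mass TYPE('a)"
proof -
  have "(\<integral>z. (u (y + \<epsilon> *\<^sub>R z) - u (x + \<epsilon> *\<^sub>R z) - c) * bump z \<partial>lborel) =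
     (\<integral>z. u (y + \<epsilon> *\<^sub>R z) * bump z - u (x + \<epsilon> *\<^sub>R z) * bump z - c * bump z \<partial>lborel)"
    by (simp add: algebra_simps)
  also have "\<dots> = (\<integral>z. u (y + \<epsilon> *\<^sub>R z) * bump z \<partial>lborel) - (\<integral>z. u (x + \<epsilon> *\<^sub>R z) * bump z \<partial>lborel) - c * bump_mass TYPE('a)"
    using integrable_bump[where 'a='a] by (simp add: integrable_mollify[OF assms] bump_mass_def)
  finally show ?thesis using bump_mass_pos[where 'a='a] by (simp add: mollify_def diff_divide_distrib)
qed

lemma mollify_lipschitz:
  fixes u :: "'a::euclidean_space \<Rightarrow> real"
  assumes u: "L-lipschitz_on UNIV u" shows "L-lipschitz_on UNIV (mollify \<epsilon> u)"
proof (rule lipschitz_onI)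
  fix x y :: 'a
  have cont: "continuous_on UNIV u" using u by (rule lipschitz_on_continuous_on)
  have "\<bar>mollify \<epsilon> u x - mollify \<epsilon> u y - 0\<bar> \<le> L * dist x y"
    unfolding mollify_diff[OF cont]
  proof (rule abs_average_bump_le)
    show "continuous_on UNIV (\<lambda>z. u (x + \<epsilon> *\<^sub>R z) - u (y + \<epsilon> *\<^sub>R z) - 0)"
      by (intro continuous_intros continuous_on_compose2[OF cont]) auto
    show "\<bar>u (x + \<epsilon> *\<^sub>R z) - u (y + \<epsilon> *\<^sub>R z) - 0\<bar> \<le> L * dist x y" for z
      using lipschitz_onD[OF u, of "x + \<epsilon> *\<^sub>R z" "y + \<epsilon> *\<^sub>R z"] by (simp add: dist_real_def)
  qed
  then show "dist (mollify \<epsilon> u x) (mollify \<epsilon> u y) \<le> L * dist x y" by (simp add: dist_real_def)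
qed (use u in \<open>simp add: lipschitz_on_def\<close>)

lemma mollify_close:
  fixes u :: "'a::euclidean_space \<Rightarrow> real"
  assumes u: "L-lipschitz_on UNIV u" and "\<epsilon> \<ge> 0"
  shows "\<bar>mollify \<epsilon> u x - u x\<bar> \<le> L * \<epsilon>"
proof -
  have cont: "continuous_on UNIV u" using u by (rule lipschitz_on_continuous_on)
  have L: "L \<ge> 0" using u by (simp add: lipschitz_on_def)
  have "(\<integral>z. (u (x + \<epsilon> *\<^sub>R z) - u x) * bump z \<partial>lborel) = (\<integral>z. u (x + \<epsilon> *\<^sub>R z) * bump z \<partial>lborel) - u x * bump_mass TYPE('a)"
    using integrable_bump[where 'a='a] by (simp add: left_diff_distrib integrable_mollify[OF cont] bump_mass_def)
  then have "mollify \<epsilon> u x - u x = (\<integral>z. (u (x + \<epsilon> *\<^sub>R z) - u x) * bump z \<partial>lborel) / bump_mass TYPE('a)"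
    using bump_mass_pos[where 'a='a] by (simp add: mollify_def diff_divide_distrib)
  also have "\<bar>\<dots>\<bar> \<le> L * \<epsilon>"
  proof (rule abs_average_bump_le)
    show "continuous_on UNIV (\<lambda>z. u (x + \<epsilon> *\<^sub>R z) - u x)"
      by (intro continuous_intros continuous_on_compose2[OF cont]) auto
    show "\<bar>u (x + \<epsilon> *\<^sub>R z) - u x\<bar> \<le> L * \<epsilon>" if "norm z < 1" for z
    proof -
      have "\<bar>u (x + \<epsilon> *\<^sub>R z) - u x\<bar> \<le> L * (\<epsilon> * norm z)"
        using lipschitz_onD[OF u, of "x + \<epsilon> *\<^sub>R z" x] \<open>\<epsilon> \<ge> 0\<close> by (simp add: dist_norm)
      also have "\<dots> \<le> L * (\<epsilon> * 1)" using that L \<open>\<epsilon> \<ge> 0\<close> by (intro mult_left_mono) auto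
      finally show ?thesis by simp
    qed
  qed
  finally show ?thesis .
qed

lemma mollify_support:
  fixes u :: "'a::euclidean_space \<Rightarrow> real"
  assumes "\<And>x. x \<notin> cball 0 R \<Longrightarrow> u x = 0" and "0 \<le> \<epsilon>" and x: "x \<notin> cball 0 (R + \<epsilon>)"
  shows "mollify \<epsilon> u x = 0"
proof -
  have "u (x + \<epsilon> *\<^sub>R z) * bump z = 0" for z
  proof (cases "norm z < 1")
    case True
    have "norm x \<le> norm (x + \<epsilon> *\<^sub>R z) + \<epsilon> * norm z"
      using norm_triangle_ineq4[of "x + \<epsilon> *\<^sub>R z" "\<epsilon> *\<^sub>R z"] \<open>0 \<le> \<epsilon>\<close> by simp
    also have "\<epsilon> * norm z \<le> \<epsilon> * 1" using True \<open>0 \<le> \<epsilon>\<close> by (intro mult_left_mono) auto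
    finally have "x + \<epsilon> *\<^sub>R z \<notin> cball 0 R" using x by simp
    then show ?thesis using assms(1) by simp
  qed (simp add: bump_eq_0)
  then have "(\<lambda>z. u (x + \<epsilon> *\<^sub>R z) * bump z) = (\<lambda>_. 0)" by (rule ext)
  then show ?thesis unfolding mollify_def by simp
qed

lemma lborel_integral_translate:
  fixes f :: "'a::euclidean_space \<Rightarrow> real"
  assumes "f \<in> borel_measurable borel"
  shows "(\<integral>z. f (c + z) \<partial>lborel) = (\<integral>z. f z \<partial>lborel)"
proof -
  have "(\<integral>z. f z \<partial>lborel) = (\<integral>z. f z \<partial>(distr lborel borel ((+) c)))" by (simp add: lborel_distr_plus)
  also have "\<dots> = (\<integral>z. f (c + z) \<partial>lborel)" using assms by (intro integral_distr) auto
  finally show ?thesis by simp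
qed

text \<open>After subtraction of the affine function, the translation from \<open>x\<close> to
  \<open>y\<close> is moved from the remainder, which is only known to be bounded by
  \<open>s\<close>, to the kernel, which is Lipschitz. The factor 8 is the Lipschitz constant 4 of
  \<open>bump\<close> times the two unit balls that carry \<open>bump\<close> and its
  translate.\<close>

lemma mollify_affine_error:
  fixes u :: "'a::euclidean_space \<Rightarrow> real"
  assumes cont: "continuous_on UNIV u" and \<epsilon>: "\<epsilon> > 0"
    and e: "\<And>z. dist z x < dist y x + \<epsilon> \<Longrightarrow> \<bar>u z - b - a \<bullet> z\<bar> \<le> s"
  shows "\<bar>mollify \<epsilon> u y - mollify \<epsilon> u x - a \<bullet> (y - x)\<bar> \<le>
    8 * measure lborel (cball (0::'a) 1) / bump_mass TYPE('a) * (s / \<epsilon>) * dist y x"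
proof -
  define E where "E z = u z - b - a \<bullet> z" for z
  have contE: "continuous_on UNIV E" unfolding E_def by (intro continuous_intros cont)
  have s: "s \<ge> 0" using e[of x] \<epsilon> by (smt (verit) dist_self zero_le_dist)
  \<comment> \<open>The displacement \<open>y - x\<close> in the rescaled variable of the
    kernel.\<close>
  define w where "w = (1/\<epsilon>) *\<^sub>R (y - x)"
  define g where "g z = E (x + \<epsilon> *\<^sub>R z)" for z
  have contg: "continuous_on UNIV g" unfolding g_def by (intro continuous_on_compose2[OF contE] continuous_intros) auto
  let ?V = "measure lborel (cball (0::'a) 1)"
  have ints: "integrable lborel (\<lambda>z. g z * bump (z - w))" "integrable lborel (\<lambda>z. g z * bump z)"
    using integrable_times_bump[OF contg, of w] integrable_times_bump[OF contg, of 0] by auto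
  have tr: "(\<integral>z. g (w + z) * bump z \<partial>lborel) = (\<integral>z. g z * bump (z - w) \<partial>lborel)"
  proof -
    have "(\<lambda>z. g z * bump (z - w)) \<in> borel_measurable borel"
      by (intro borel_measurable_continuous_onI continuous_intros contg)
    from lborel_integral_translate[OF this, of w] show ?thesis by simp
  qed
  have int': "integrable lborel (\<lambda>z. g (w + z) * bump z)"
    using integrable_times_bump[of "\<lambda>z. g (w + z)" 0] by (simp add: continuous_on_compose2[OF contg] continuous_intros)
  have "u (y + \<epsilon> *\<^sub>R z) - u (x + \<epsilon> *\<^sub>R z) - a \<bullet> (y - x) = g (w + z) - g z" for z
    using \<epsilon> by (simp add: g_def w_def E_def algebra_simps)
  then have "(mollify \<epsilon> u y - mollify \<epsilon> u x - a \<bullet> (y - x)) * bump_mass TYPE('a) =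
     (\<integral>z. (g (w + z) - g z) * bump z \<partial>lborel)"
    unfolding mollify_diff[OF cont] using bump_mass_pos[where 'a='a] by simp
  also have "\<dots> = (\<integral>z. g (w + z) * bump z \<partial>lborel) - (\<integral>z. g z * bump z \<partial>lborel)"
    using int' ints by (simp add: left_diff_distrib)
  also have "\<dots> = (\<integral>z. g z * (bump (z - w) - bump z) \<partial>lborel)"
    unfolding tr using ints by (simp add: right_diff_distrib)
  finally have eq: "(mollify \<epsilon> u y - mollify \<epsilon> u x - a \<bullet> (y - x)) * bump_mass TYPE('a) = (\<integral>z. g z * (bump (z - w) - bump z) \<partial>lborel)" .
  have intI: "integrable lborel (indicator (cball c 1) :: 'a \<Rightarrow> real)" for c :: 'a
    using emeasure_lborel_cball_finite[of c 1] by (intro integrable_real_indicator) auto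
  have "\<bar>\<integral>z. g z * (bump (z - w) - bump z) \<partial>lborel\<bar> \<le> (\<integral>z. \<bar>g z * (bump (z - w) - bump z)\<bar> \<partial>lborel)"
    using integral_norm_bound[of lborel "\<lambda>z. g z * (bump (z - w) - bump z)"] by simp
  also have "\<dots> \<le> (\<integral>z. s * (4 * norm w) * (indicator (cball 0 1) z + indicator (cball w 1) z) \<partial>lborel)"
  proof (rule integral_mono)
    fix z :: 'a
    have lip: "\<bar>bump (z - w) - bump z\<bar> \<le> 4 * norm w"
      using lipschitz_onD[OF bump_lipschitz, of "z - w" z] by (simp add: dist_norm)
    show "\<bar>g z * (bump (z - w) - bump z)\<bar> \<le> s * (4 * norm w) * (indicator (cball 0 1) z + indicator (cball w 1) z)"
    proof (cases "norm z < 1 \<or> norm (z - w) < 1")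
      case False
      then show ?thesis using s by (simp add: bump_eq_0)
    next
      case True
      have "\<epsilon> * norm w = dist y x" using \<epsilon> by (simp add: w_def dist_norm)
      have "norm z < norm w + 1" using True norm_triangle_ineq[of "z - w" w] norm_ge_zero[of w] by (auto simp del: norm_ge_zero)
      then have "\<epsilon> * norm z < \<epsilon> * (norm w + 1)" using \<epsilon> by (rule mult_strict_left_mono)
      then have "dist (x + \<epsilon> *\<^sub>R z) x < dist y x + \<epsilon>"
        using \<epsilon> \<open>\<epsilon> * norm w = dist y x\<close> by (simp add: dist_norm distrib_left)
      then have "\<bar>g z\<bar> \<le> s" using e by (simp add: g_def E_def)
      then have "\<bar>g z\<bar> * \<bar>bump (z - w) - bump z\<bar> \<le> s * (4 * norm w)" using lip s by (intro mult_mono) auto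
      moreover have "1 \<le> (indicator (cball 0 1) z + indicator (cball w 1) z :: real)"
        using True by (auto simp: indicator_def dist_norm norm_minus_commute)
      then have "s * (4 * norm w) * 1 \<le> s * (4 * norm w) * (indicator (cball 0 1) z + indicator (cball w 1) z)"
        using s by (intro mult_left_mono) auto
      ultimately show ?thesis by (simp add: abs_mult)
    qed
  qed (use ints intI in \<open>auto simp: right_diff_distrib\<close>)
  also have "\<dots> = s * (4 * norm w) * (?V + ?V)"
    using intI content_cball[of 1 w] content_cball[of 1 "0::'a"] by simp
  also have "norm w = dist y x / \<epsilon>" using \<epsilon> by (simp add: w_def dist_norm)
  finally have "\<bar>mollify \<epsilon> u y - mollify \<epsilon> u x - a \<bullet> (y - x)\<bar> * bump_mass TYPE('a) \<le> 8 * ?V * (s / \<epsilon>) * dist y x"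
    using bump_mass_pos[where 'a='a] unfolding eq[symmetric] by (simp add: abs_mult mult_ac)
  then have "\<bar>mollify \<epsilon> u y - mollify \<epsilon> u x - a \<bullet> (y - x)\<bar> \<le> (8 * ?V * (s / \<epsilon>) * dist y x) / bump_mass TYPE('a)"
    by (simp only: pos_le_divide_eq[OF bump_mass_pos])
  then show ?thesis by (simp add: mult_ac)
qed

text \<open>In the variable \<open>t = (1/\<epsilon>) *\<^sub>R x + z\<close> only the kernel
  depends on \<open>x\<close>, and the compact support of \<open>u\<close> confines the integral to
  one box for all \<open>x\<close>. Differentiation under the integral sign then applies.\<close>

lemma mollify_C1:
  fixes u :: "'a::euclidean_space \<Rightarrow> real"
  assumes cont: "continuous_on UNIV u" and supp: "\<And>x. x \<notin> cball 0 R \<Longrightarrow> u x = 0" and \<epsilon>: "\<epsilon> > 0"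
  shows "C1_map (mollify \<epsilon> u)"
proof -
  obtain c d :: 'a where cd: "cball 0 (R / \<epsilon>) \<subseteq> cbox c d"
    using bounded_subset_cbox_symmetric[OF bounded_cball] by blast
  define w where "w t = u (\<epsilon> *\<^sub>R t) / bump_mass TYPE('a)" for t
  have contw: "continuous_on UNIV w"
    unfolding w_def using bump_mass_pos[where 'a='a]
    by (intro continuous_intros continuous_on_compose2[OF cont]) auto
  have w0: "w t = 0" if "t \<notin> cbox c d" for t
  proof -
    have "t \<notin> cball 0 (R / \<epsilon>)" using cd that by blast
    then have "\<epsilon> *\<^sub>R t \<notin> cball 0 R" using \<epsilon> by (simp add: field_simps)
    then show ?thesis using supp by (simp add: w_def)
  qed
  define F where "F x t = w t * bump (t - (1/\<epsilon>) *\<^sub>R x)" for x t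
  define fx where "fx x t = (w t * (4 / \<epsilon>) * max 0 (1 - (t - (1/\<epsilon>) *\<^sub>R x) \<bullet> (t - (1/\<epsilon>) *\<^sub>R x))) *\<^sub>R
      blinfun_inner_left (t - (1/\<epsilon>) *\<^sub>R x)" for x t
  have contF: "continuous_on UNIV (F x)" for x
    unfolding F_def by (intro continuous_intros contw)
  have "mollify \<epsilon> u x = integral (cbox c d) (F x)" for x
  proof -
    have "mollify \<epsilon> u x = (\<integral>z. w ((1/\<epsilon>) *\<^sub>R x + z) * bump z \<partial>lborel)"
      using \<epsilon> by (simp add: mollify_def w_def scaleR_add_right)
    also have "\<dots> = (\<integral>z. F x ((1/\<epsilon>) *\<^sub>R x + z) \<partial>lborel)" by (simp add: F_def)
    also have "\<dots> = (\<integral>z. F x z \<partial>lborel)"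
      by (intro lborel_integral_translate borel_measurable_continuous_onI contF)
    also have "\<dots> = integral UNIV (F x)"
      unfolding F_def by (rule integral_lborel[symmetric] integrable_times_bump contw)+
    also have "\<dots> = integral (cbox c d) (F x)"
      by (rule integral_spike_set[symmetric, unfolded negligible_def[symmetric]])
         (auto simp: F_def w0 intro: negligible_subset[of "{}"])
    finally show ?thesis .
  qed
  then have eq: "mollify \<epsilon> u = (\<lambda>x. integral (cbox c d) (F x))" by auto
  have contfx: "continuous_on (UNIV \<times> cbox c d) (\<lambda>(x, t). fx x t)"
    unfolding fx_def split_beta
    by (intro continuous_intros continuous_on_compose2[OF contw] bounded_linear.continuous_on[OF bounded_linear_blinfun_inner_left]) auto
  have der: "((\<lambda>x. F x t) has_derivative blinfun_apply (fx x t)) (at x within UNIV)" for x t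
  proof -
    have "((\<lambda>x. t - (1/\<epsilon>) *\<^sub>R x) has_derivative (\<lambda>h. - (1/\<epsilon>) *\<^sub>R h)) (at x)"
      by (auto intro!: derivative_eq_intros)
    from has_derivative_compose[OF this has_derivative_bump]
    have "((\<lambda>x. w t * bump (t - (1/\<epsilon>) *\<^sub>R x)) has_derivative
       (\<lambda>h. w t * (- 4 * max 0 (1 - (t - (1/\<epsilon>) *\<^sub>R x) \<bullet> (t - (1/\<epsilon>) *\<^sub>R x)) * ((t - (1/\<epsilon>) *\<^sub>R x) \<bullet> (- (1/\<epsilon>) *\<^sub>R h))))) (at x)"
      by (rule has_derivative_mult_right)
    then show ?thesis unfolding F_def
      by (rule has_derivative_eq_rhs) (simp add: fx_def fun_eq_iff scaleR_blinfun.rep_eq inner_commute)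
  qed
  have "((\<lambda>x. integral (cbox c d) (F x)) has_derivative blinfun_apply (integral (cbox c d) (fx x))) (at x within UNIV)" for x
    by (rule leibniz_rule[OF der _ contfx]) (auto intro!: integrable_continuous continuous_on_subset[OF contF])
  moreover have "continuous_on UNIV (\<lambda>x. integral (cbox c d) (fx x))"
    by (rule integral_continuous_on_param[OF contfx])
  ultimately show ?thesis unfolding C1_map_def eq
    by (intro exI[of _ "\<lambda>x. integral (cbox c d) (fx x)"]) auto
qed

section \<open>Lusin approximation by continuously differentiable functions\<close>

text \<open>McShane's extension: the lower envelope of the cones with slope \<open>L\<close> based
  on the graph of \<open>u\<close>. The Lipschitz condition on \<open>S\<close> says that these
  cones stay above the graph.\<close>

lemma lipschitz_on_real_extension:
  fixes u :: "'a::metric_space \<Rightarrow> real"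
  assumes u: "L-lipschitz_on S u"
  obtains w where "L-lipschitz_on UNIV w" "\<And>x. x \<in> S \<Longrightarrow> w x = u x"
proof (cases "S = {}")
  case True
  show ?thesis
  proof (rule that[of "\<lambda>_. 0"])
    show "L-lipschitz_on UNIV (\<lambda>_::'a. 0::real)" using u by (auto simp: lipschitz_on_def)
  qed (use True in auto)
next
  case False
  then obtain p where p: "p \<in> S" by blast
  have L: "L \<ge> 0" using u by (simp add: lipschitz_on_def)
  define w where "w x = (INF y\<in>S. u y + L * dist x y)" for x
  have ub: "u p \<le> u y + L * dist p y" if "y \<in> S" "p \<in> S" for y p
    using lipschitz_onD[OF u that(2,1)] by (simp add: dist_real_def)
  have lower: "u p - L * dist x p \<le> u y + L * dist x y" if "y \<in> S" "p \<in> S" for x y p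
    using ub[OF that] mult_left_mono[OF dist_triangle3[of p y x] L] by (simp add: algebra_simps dist_commute)
  have bdd: "bdd_below ((\<lambda>y. u y + L * dist x y) ` S)" for x
    by (rule bdd_belowI2[of _ "u p - L * dist x p"]) (use lower p in auto)
  have 1: "w x \<le> w x' + L * dist x x'" for x x'
  proof -
    have "w x - L * dist x x' \<le> w x'"
      unfolding w_def[of x']
    proof (rule cINF_greatest[OF False])
      fix y assume y: "y \<in> S"
      have "w x \<le> u y + L * dist x y" unfolding w_def by (rule cINF_lower[OF bdd y])
      also have "\<dots> \<le> u y + L * (dist x x' + dist x' y)" using L by (intro add_left_mono mult_left_mono dist_triangle)
      finally show "w x - L * dist x x' \<le> u y + L * dist x' y" by (simp add: algebra_simps)
    qed
    then show ?thesis by simp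
  qed
  show ?thesis
  proof (rule that)
    show "L-lipschitz_on UNIV w"
    proof (rule lipschitz_onI[OF _ L])
      fix x y show "dist (w x) (w y) \<le> L * dist x y"
        using 1[of x y] 1[of y x] by (simp add: dist_real_def dist_commute abs_le_iff)
    qed
    fix x assume x: "x \<in> S"
    show "w x = u x"
    proof (rule antisym)
      show "w x \<le> u x" using cINF_lower[OF bdd x, of x] by (simp add: w_def)
      show "u x \<le> w x" unfolding w_def by (rule cINF_greatest[OF False]) (use ub x in auto)
    qed
  qed
qed

lemma lipschitz_derivative_bound:
  fixes g :: "'a::real_normed_vector \<Rightarrow> 'b::real_normed_vector"
  assumes g: "L-lipschitz_on UNIV g" and d: "(g has_derivative g') (at x)"
  shows "norm (g' h) \<le> L * norm h"
proof -
  interpret g': bounded_linear g' using d by (rule has_derivative_bounded_linear)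
  have L: "L \<ge> 0" using g by (simp add: lipschitz_on_def)
  show ?thesis
  proof (rule field_le_epsilon)
    fix e :: real assume e: "e > 0"
    show "norm (g' h) \<le> L * norm h + e"
    proof (cases "h = 0")
      case True
      then show ?thesis using e by (simp add: g'.zero)
    next
      case False
      then have "e / norm h > 0" using e by simp
      then obtain r where r: "r > 0" "\<And>y. norm (y - x) < r \<Longrightarrow> norm (g y - g x - g' (y - x)) \<le> e / norm h * norm (y - x)"
        using d unfolding has_derivative_at_alt by blast
      define t where "t = r / (2 * norm h)"
      have t: "t > 0" using r False by (simp add: t_def)
      have "norm (t *\<^sub>R h) < r" using r False by (simp add: t_def)
      then have "norm (g (x + t *\<^sub>R h) - g x - g' (t *\<^sub>R h)) \<le> e / norm h * norm (t *\<^sub>R h)"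
        using r(2)[of "x + t *\<^sub>R h"] by simp
      moreover have "norm (g (x + t *\<^sub>R h) - g x) \<le> L * norm (t *\<^sub>R h)"
        using lipschitz_onD[OF g, of "x + t *\<^sub>R h" x] by (simp add: dist_norm)
      ultimately have "norm (g' (t *\<^sub>R h)) \<le> L * norm (t *\<^sub>R h) + e / norm h * norm (t *\<^sub>R h)"
        using norm_triangle_sub[of "g' (t *\<^sub>R h)" "g (x + t *\<^sub>R h) - g x"] by (simp add: norm_minus_commute)
      then have "t * norm (g' h) \<le> t * (L * norm h + e)"
        using t False by (simp add: g'.scaleR algebra_simps)
      then show ?thesis using t by simp
    qed
  qed
qed

lemma negligible_decseq_small:
  fixes T :: "nat \<Rightarrow> 'a::euclidean_space set"
  assumes "\<And>n. T n \<in> lmeasurable" "decseq T" "negligible (\<Inter>n. T n)" "\<tau> > 0"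
  obtains n where "measure lebesgue (T n) < \<tau>"
proof -
  have "(\<lambda>n. measure lebesgue (T n)) \<longlonglongrightarrow> measure lebesgue (\<Inter>n. T n)"
    by (rule Lim_measure_decseq)
       (use assms(1,2) fmeasurableD2[OF assms(1)] in \<open>auto simp: fmeasurableD simp del: emeasure_completion\<close>)
  also have "measure lebesgue (\<Inter>n. T n) = 0" using assms(3) by (rule negligible_imp_measure0)
  finally have "\<forall>\<^sub>F n in sequentially. measure lebesgue (T n) < \<tau>" using assms(4) by (rule order_tendstoD(2))
  then show ?thesis using that eventually_happens by fastforce
qed

text \<open>
  The constant \<open>\<eta>\<close> must not depend on the scale \<open>r\<close>: for \<open>y\<close> further from \<open>x\<close> than \<open>N \<epsilon>\<close> the uniform bound
  \<open>\<bar>u - mollify \<epsilon> u\<bar> \<le> L \<epsilon>\<close> suffices, and for closer \<open>y\<close> the affine approximation is used at scale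
  \<open>(N + 1) \<epsilon>\<close>.
\<close>

lemma mollify_error_lipschitz:
  fixes u :: "'a::euclidean_space \<Rightarrow> real"
  assumes u: "L-lipschitz_on UNIV u" and "L > 0" and \<delta>: "\<delta> > 0"
  obtains \<eta> :: real where "\<eta> > 0"
    "\<And>r. r > 0 \<Longrightarrow> \<exists>\<epsilon>. 0 < \<epsilon> \<and> \<epsilon> \<le> 1 \<and> (\<forall>x a y. (\<forall>y. dist y x < r \<longrightarrow> \<bar>u y - u x - a \<bullet> (y - x)\<bar> \<le> \<eta> * dist y x) \<longrightarrow>
        \<bar>(u y - mollify \<epsilon> u y) - (u x - mollify \<epsilon> u x)\<bar> \<le> \<delta> * dist y x)"
proof -
  define C where "C = 8 * measure lborel (cball (0::'a) 1) / bump_mass TYPE('a)"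
  have C: "C > 0" using bump_mass_pos[where 'a='a] by (simp add: C_def)
  have cont: "continuous_on UNIV u" using u by (rule lipschitz_on_continuous_on)
  \<comment> \<open>At distance \<open>N * \<epsilon>\<close> the two uniform errors
    \<open>L * \<epsilon>\<close> together equal \<open>\<delta>\<close> times the distance.\<close>
  define N where "N = 2 * L / \<delta>"
  have N: "N > 0" using \<open>L > 0\<close> \<delta> by (simp add: N_def)
  \<comment> \<open>At short distances the mollified function contributes
    \<open>C * \<eta> * (N + 1)\<close> and \<open>u\<close> itself contributes \<eta>; their sum is
    exactly \<delta>.\<close>
  define \<eta> where "\<eta> = \<delta> / (C * (N + 1) + 1)"
  have den: "C * (N + 1) + 1 > 0" using C N by (simp add: add_pos_pos)
  have \<eta>: "\<eta> > 0" using \<delta> den by (simp add: \<eta>_def)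
  have \<eta>C: "\<eta> * (C * (N + 1) + 1) = \<delta>" using den by (simp add: \<eta>_def)
  show ?thesis
  proof (rule that[OF \<eta>])
    fix r :: real assume r: "r > 0"
    \<comment> \<open>Small enough for the approximation at scale
      \<open>(N + 1) * \<epsilon>\<close> to lie within \<open>r\<close>, and at most 1 so that
      mollifying enlarges the support by at most 1.\<close>
    define \<epsilon> where "\<epsilon> = min 1 (r / (2 * (N + 1)))"
    have \<epsilon>: "\<epsilon> > 0" "\<epsilon> \<le> 1" using r N by (auto simp: \<epsilon>_def)
    have "\<epsilon> * (2 * (N + 1)) \<le> r"
      using N by (subst pos_le_divide_eq[symmetric]) (auto simp: \<epsilon>_def)
    moreover have "\<epsilon> * (2 * (N + 1)) = (N + 1) * \<epsilon> + (N + 1) * \<epsilon>" by (simp add: algebra_simps)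
    moreover have "0 < (N + 1) * \<epsilon>" using N \<epsilon> by (intro mult_pos_pos) auto
    ultimately have \<epsilon>r: "(N + 1) * \<epsilon> < r" by linarith
    show "\<exists>\<epsilon>. 0 < \<epsilon> \<and> \<epsilon> \<le> 1 \<and> (\<forall>x a y. (\<forall>y. dist y x < r \<longrightarrow> \<bar>u y - u x - a \<bullet> (y - x)\<bar> \<le> \<eta> * dist y x) \<longrightarrow>
        \<bar>(u y - mollify \<epsilon> u y) - (u x - mollify \<epsilon> u x)\<bar> \<le> \<delta> * dist y x)"
    proof (intro exI[of _ \<epsilon>] conjI \<epsilon> allI impI)
      fix x a y assume aff: "\<forall>y. dist y x < r \<longrightarrow> \<bar>u y - u x - a \<bullet> (y - x)\<bar> \<le> \<eta> * dist y x"
      show "\<bar>(u y - mollify \<epsilon> u y) - (u x - mollify \<epsilon> u x)\<bar> \<le> \<delta> * dist y x"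
      proof (cases "dist y x \<le> N * \<epsilon>")
        case False
        have "\<bar>mollify \<epsilon> u y - u y\<bar> \<le> L * \<epsilon>" "\<bar>mollify \<epsilon> u x - u x\<bar> \<le> L * \<epsilon>"
          using mollify_close[OF u] \<epsilon> by auto
        moreover have "\<delta> * (N * \<epsilon>) \<le> \<delta> * dist y x" using False \<delta> by (intro mult_left_mono) auto
        moreover have "\<delta> * (N * \<epsilon>) = 2 * (L * \<epsilon>)" using \<delta> by (simp add: N_def)
        ultimately show ?thesis by linarith
      next
        case True
        define s where "s = \<eta> * ((N + 1) * \<epsilon>)"
        have "\<bar>u z - (u x - a \<bullet> x) - a \<bullet> z\<bar> \<le> s" if "dist z x < dist y x + \<epsilon>" for z
        proof -
          have d: "dist z x \<le> (N + 1) * \<epsilon>" using that True by (simp add: algebra_simps)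
          then have "\<bar>u z - u x - a \<bullet> (z - x)\<bar> \<le> \<eta> * dist z x" using aff \<epsilon>r by force
          also have "\<dots> \<le> s" unfolding s_def using d \<eta> by (intro mult_left_mono) auto
          finally show ?thesis by (simp add: inner_diff_right algebra_simps)
        qed
        from mollify_affine_error[OF cont \<epsilon>(1) this]
        have "\<bar>mollify \<epsilon> u y - mollify \<epsilon> u x - a \<bullet> (y - x)\<bar> \<le> C * (s / \<epsilon>) * dist y x" by (simp add: C_def)
        also have "s / \<epsilon> = \<eta> * (N + 1)" using \<epsilon> by (simp add: s_def)
        finally have 1: "\<bar>mollify \<epsilon> u y - mollify \<epsilon> u x - a \<bullet> (y - x)\<bar> \<le> C * (\<eta> * (N + 1)) * dist y x" .
        have "dist y x < r" using True \<epsilon>r \<epsilon> by (simp add: algebra_simps)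
        then have 2: "\<bar>u y - u x - a \<bullet> (y - x)\<bar> \<le> \<eta> * dist y x" using aff by blast
        have "\<delta> * dist y x = C * (\<eta> * (N + 1)) * dist y x + \<eta> * dist y x"
          unfolding \<eta>C[symmetric] by (simp add: algebra_simps)
        then show ?thesis using 1 2 by linarith
      qed
    qed
  qed
qed

text \<open>Here \<open>v\<close> is a mollification of \<open>u\<close>. On the points with good
  affine approximation the remainder \<open>u - v\<close> has the small constant \<delta>, and
  \<open>w\<close> extends it from there; \<open>T\<close> collects the bad points, a set made small
  by refining the scale of approximation.\<close>

lemma lipschitz_C1_approximation_step:
  fixes u :: "'a::euclidean_space \<Rightarrow> real"
  assumes u: "L-lipschitz_on UNIV u" and "L > 0" and supp: "\<And>x. x \<notin> cball 0 R \<Longrightarrow> u x = 0"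
    and \<delta>: "\<delta> > 0" and \<tau>: "\<tau> > 0"
  obtains v w T where "C1_map v" "L-lipschitz_on UNIV v" "\<delta>-lipschitz_on UNIV w"
    "\<And>x. x \<notin> cball 0 (R + 1) \<Longrightarrow> w x = 0"
    "T \<in> lmeasurable" "measure lebesgue T < \<tau>" "\<And>x. x \<notin> T \<Longrightarrow> u x = v x + w x"
proof -
  obtain \<eta> where \<eta>: "\<eta> > 0" and H:
    "\<And>r. r > 0 \<Longrightarrow> \<exists>\<epsilon>. 0 < \<epsilon> \<and> \<epsilon> \<le> 1 \<and> (\<forall>x a y. (\<forall>y. dist y x < r \<longrightarrow> \<bar>u y - u x - a \<bullet> (y - x)\<bar> \<le> \<eta> * dist y x) \<longrightarrow>
        \<bar>(u y - mollify \<epsilon> u y) - (u x - mollify \<epsilon> u x)\<bar> \<le> \<delta> * dist y x)"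
    using mollify_error_lipschitz[OF u \<open>L > 0\<close> \<delta>] by blast
  have cont: "continuous_on UNIV u" using u by (rule lipschitz_on_continuous_on)
  \<comment> \<open>For each rational \<open>a\<close> the condition is closed in \<open>x\<close>,
    so the countable union is Borel. The sets increase with \<open>n\<close> and exhaust almost
    everything.\<close>
  define A where "A n = (\<Union>a\<in>rational_vectors. {x. \<forall>y. dist y x < 1 / Suc n \<longrightarrow> \<bar>u y - u x - a \<bullet> (y - x)\<bar> \<le> \<eta> * dist y x})" for n
  have Acl: "closed {x. \<forall>y. dist y x < q \<longrightarrow> \<bar>u y - u x - a \<bullet> (y - x)\<bar> \<le> \<eta> * dist y x}" for a q
  proof -
    have "closed {x. \<forall>z. norm z < q \<longrightarrow> \<bar>u (x + z) - u x - a \<bullet> z\<bar> \<le> \<eta> * norm z}"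
      by (intro closed_Collect_all closed_Collect_imp open_Collect_const closed_Collect_le continuous_intros continuous_on_compose2[OF cont]) auto
    also have "{x. \<forall>z. norm z < q \<longrightarrow> \<bar>u (x + z) - u x - a \<bullet> z\<bar> \<le> \<eta> * norm z} =
       {x. \<forall>y. dist y x < q \<longrightarrow> \<bar>u y - u x - a \<bullet> (y - x)\<bar> \<le> \<eta> * dist y x}"
    proof (intro Collect_cong iffI allI impI)
      fix x y :: 'a assume "\<forall>z. norm z < q \<longrightarrow> \<bar>u (x + z) - u x - a \<bullet> z\<bar> \<le> \<eta> * norm z" "dist y x < q"
      then show "\<bar>u y - u x - a \<bullet> (y - x)\<bar> \<le> \<eta> * dist y x" by (auto simp: dist_norm dest: spec[of _ "y - x"])
    next
      fix x z :: 'a assume "\<forall>y. dist y x < q \<longrightarrow> \<bar>u y - u x - a \<bullet> (y - x)\<bar> \<le> \<eta> * dist y x" "norm z < q"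
      then show "\<bar>u (x + z) - u x - a \<bullet> z\<bar> \<le> \<eta> * norm z" by (auto simp: dist_norm dest: spec[of _ "x + z"])
    qed
    finally show ?thesis .
  qed
  have Ab: "A n \<in> sets borel" for n
    unfolding A_def by (intro sets.countable_UN'' countable_rational_vectors borel_closed Acl)
  define T where "T n = cball 0 (R + 1) - A n" for n
  have "A m \<subseteq> A n" if "m \<le> n" for m n
  proof -
    have "1 / real (Suc n) \<le> 1 / Suc m" using that by (simp add: frac_le)
    then show ?thesis unfolding A_def using order_less_le_trans by blast
  qed
  then have "decseq T" by (auto simp: T_def antimono_def)
  moreover have "T n \<in> lmeasurable" for n
    unfolding T_def using Ab by (intro fmeasurable_Diff) auto
  moreover have "negligible (\<Inter>n. T n)"
    by (rule negligible_subset[OF negligible_no_affine_approximation[OF u \<eta>]]) (auto simp: T_def A_def)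
  ultimately obtain n where n: "measure lebesgue (T n) < \<tau>" and Tn: "T n \<in> lmeasurable"
    using negligible_decseq_small[of T \<tau>] \<tau> by metis
  obtain \<epsilon> where \<epsilon>: "0 < \<epsilon>" "\<epsilon> \<le> 1" and Hx: "\<And>x a y. (\<forall>y. dist y x < 1 / Suc n \<longrightarrow> \<bar>u y - u x - a \<bullet> (y - x)\<bar> \<le> \<eta> * dist y x) \<Longrightarrow>
        \<bar>(u y - mollify \<epsilon> u y) - (u x - mollify \<epsilon> u x)\<bar> \<le> \<delta> * dist y x"
    using H[of "1 / Suc n"] by auto
  have v0: "mollify \<epsilon> u x = 0" if "x \<notin> cball 0 (R + 1)" for x
    by (rule mollify_support[OF supp]) (use that \<epsilon> in auto)
  have u0: "u x = 0" if "x \<notin> cball 0 (R + 1)" for x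
    by (rule supp) (use that in auto)
  have "\<delta>-lipschitz_on (- T n) (\<lambda>x. u x - mollify \<epsilon> u x)"
  proof (rule lipschitz_onI)
    fix x y assume xy: "x \<in> - T n" "y \<in> - T n"
    \<comment> \<open>One good point among the two suffices, because the mollification estimate is
      anchored at \<open>x\<close> and allows every \<open>y\<close>. If neither is good, both lie
      where \<open>u\<close> and its mollification vanish.\<close>
    consider "x \<in> A n" | "y \<in> A n" | "x \<notin> cball 0 (R + 1)" "y \<notin> cball 0 (R + 1)"
      using xy by (auto simp: T_def)
    then show "dist (u x - mollify \<epsilon> u x) (u y - mollify \<epsilon> u y) \<le> \<delta> * dist x y"
    proof cases
      case 1
      then show ?thesis using Hx[of x _ y] by (auto simp: A_def dist_real_def dist_commute abs_minus_commute)
    next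
      case 2
      then show ?thesis using Hx[of y _ x] by (auto simp: A_def dist_real_def)
    next
      case 3
      then show ?thesis using u0 v0 \<delta> by simp
    qed
  qed (use \<delta> in simp)
  then obtain w where w: "\<delta>-lipschitz_on UNIV w" "\<And>x. x \<in> - T n \<Longrightarrow> w x = u x - mollify \<epsilon> u x"
    by (rule lipschitz_on_real_extension) blast
  show ?thesis
  proof (rule that[of "mollify \<epsilon> u" w "T n"])
    show "C1_map (mollify \<epsilon> u)" by (rule mollify_C1[OF cont supp \<epsilon>(1)])
    show "L-lipschitz_on UNIV (mollify \<epsilon> u)" by (rule mollify_lipschitz[OF u])
    show "w x = 0" if "x \<notin> cball 0 (R + 1)" for x
    proof -
      have "x \<in> - T n" using that by (simp add: T_def)
      then show ?thesis using w(2) v0[OF that] u0[OF that] by simp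
    qed
    show "u x = mollify \<epsilon> u x + w x" if "x \<notin> T n" for x using w(2) that by simp
  qed (use w n Tn in auto)
qed

text \<open>The Lipschitz constants bound the derivatives, so the derived series converges uniformly
  by the Weierstrass test. Together with convergence at one point this gives convergence everywhere
  and termwise differentiation.\<close>

lemma C1_series:
  fixes v :: "nat \<Rightarrow> 'a::real_normed_vector \<Rightarrow> 'b::banach"
  assumes C1: "\<And>n. C1_map (v n)" and lip: "\<And>n. (L / 2 ^ n)-lipschitz_on UNIV (v n)"
    and sums: "(\<lambda>n. v n x0) sums l"
  obtains g where "C1_map g" "(2 * L)-lipschitz_on UNIV g" "\<And>x. (\<lambda>n. v n x) sums g x"
proof -
  obtain v' where v': "\<And>n x. (v n has_derivative blinfun_apply (v' n x)) (at x)" "\<And>n. continuous_on UNIV (v' n)"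
    using C1 unfolding C1_map_def by metis
  have L: "L \<ge> 0" using lip[of 0] by (simp add: lipschitz_on_def)
  have nv: "norm (v' n x) \<le> L / 2 ^ n" for n x
    by (rule norm_blinfun_bound) (use L lipschitz_derivative_bound[OF lip v'(1)] in auto)
  have geo: "(\<lambda>n. L / 2 ^ n) sums (2 * L)"
    using sums_mult[OF geometric_sums[of "1/2::real"], of L] by (simp add: power_divide field_simps)
  have unif: "uniform_limit UNIV (\<lambda>n x. \<Sum>i<n. v' i x) (\<lambda>x. \<Sum>i. v' i x) sequentially"
    by (rule Weierstrass_m_test[OF nv]) (use geo sums_summable in blast)
  define G where "G x = (\<Sum>i. v' i x)" for x
  have contG: "continuous_on UNIV G"
    unfolding G_def by (rule uniform_limit_theorem[OF _ unif]) (auto intro!: always_eventually continuous_intros v'(2))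
  have "\<exists>g. \<forall>x\<in>UNIV. (\<lambda>n. v n x) sums g x \<and> (g has_derivative (\<lambda>x. blinfun_apply (G x)) x) (at x within UNIV)"
  proof (rule has_derivative_series[of UNIV v "\<lambda>n x. blinfun_apply (v' n x)" "\<lambda>x. blinfun_apply (G x)" x0 l])
    show "\<forall>\<^sub>F n in sequentially. \<forall>x\<in>UNIV. \<forall>h. norm ((\<Sum>i<n. blinfun_apply (v' i x) h) - blinfun_apply (G x) h) \<le> e * norm h"
      if "e > 0" for e
    proof -
      have "\<forall>\<^sub>F n in sequentially. \<forall>x\<in>UNIV. dist (\<Sum>i<n. v' i x) (G x) < e"
        using uniform_limitD[OF unif that] by (simp add: G_def)
      then show ?thesis
      proof (rule eventually_mono, intro ballI allI)
        fix n x h assume "\<forall>x\<in>UNIV. dist (\<Sum>i<n. v' i x) (G x) < e"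
        then have "norm ((\<Sum>i<n. v' i x) - G x) \<le> e" by (auto simp: dist_norm less_imp_le)
        then have "norm (blinfun_apply ((\<Sum>i<n. v' i x) - G x) h) \<le> e * norm h"
          using norm_blinfun[of "(\<Sum>i<n. v' i x) - G x" h] mult_right_mono[of "norm ((\<Sum>i<n. v' i x) - G x)" e "norm h"] by simp
        then show "norm ((\<Sum>i<n. blinfun_apply (v' i x) h) - blinfun_apply (G x) h) \<le> e * norm h"
          by (simp add: blinfun.diff_left blinfun.sum_left)
      qed
    qed
  qed (use v' sums in auto)
  then obtain g where g: "\<And>x. (\<lambda>n. v n x) sums g x" "\<And>x. (g has_derivative blinfun_apply (G x)) (at x)" by auto
  have "C1_map g" unfolding C1_map_def using g(2) contG by blast
  moreover have "(2 * L)-lipschitz_on UNIV g"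
  proof (rule lipschitz_onI)
    fix x y
    have "norm (v n x - v n y) \<le> L / 2 ^ n * dist x y" for n
      using lipschitz_onD[OF lip, of x y n] by (simp add: dist_norm)
    moreover have "(\<lambda>n. L / 2 ^ n * dist x y) sums (2 * L * dist x y)" by (rule sums_mult2[OF geo])
    ultimately have "norm (\<Sum>n. v n x - v n y) \<le> 2 * L * dist x y"
      using norm_suminf_le[of "\<lambda>n. v n x - v n y" "\<lambda>n. L / 2 ^ n * dist x y"] by (simp add: sums_iff)
    moreover have "(\<Sum>n. v n x - v n y) = g x - g y"
      using sums_diff[OF g(1)[of x] g(1)[of y]] by (simp add: sums_iff)
    ultimately show "dist (g x) (g y) \<le> 2 * L * dist x y" by (simp add: dist_norm)
  qed (use L in simp)
  ultimately show ?thesis using that g(1) by blast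
qed

text \<open>The exponent \<open>k + 2\<close> makes the total \<open>\<tau> / 2\<close>, which
  leaves a strict inequality against \<tau>.\<close>

lemma measure_UN_geometric_le:
  fixes T :: "nat \<Rightarrow> 'a::euclidean_space set"
  assumes T: "\<And>k. T k \<in> lmeasurable" "\<And>k. measure lebesgue (T k) < \<tau> / 2 ^ (k + 2)" and \<tau>: "\<tau> > 0"
  shows "(\<Union>k. T k) \<in> lmeasurable \<and> measure lebesgue (\<Union>k. T k) \<le> \<tau> / 2"
proof -
  have bound: "measure lebesgue (\<Union>k\<in>I. T k) \<le> \<tau> / 2" if I: "I \<subseteq> UNIV" "finite I" for I
  proof -
    have geo: "(\<lambda>k. \<tau> / 2 ^ (k + 2)) sums (\<tau> / 2)"
      using sums_mult[OF geometric_sums[of "1/2::real"], of "\<tau>/4"] by (simp add: power_divide field_simps)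
    have "measure lebesgue (\<Union>k\<in>I. T k) \<le> (\<Sum>k\<in>I. measure lebesgue (T k))"
      by (rule measure_UNION_le) (use I T in auto)
    also have "\<dots> \<le> (\<Sum>k\<in>I. \<tau> / 2 ^ (k + 2))" by (rule sum_mono) (use T(2) less_imp_le in blast)
    also have "\<dots> \<le> (\<Sum>k. \<tau> / 2 ^ (k + 2))"
      by (rule sum_le_suminf) (use geo sums_summable I \<tau> in auto)
    also have "\<dots> = \<tau> / 2" using geo by (rule sums_unique[symmetric])
    finally show ?thesis .
  qed
  show ?thesis
    by (intro conjI fmeasurable_UN_bound[OF _ T(1) bound] measure_UN_bound[OF _ T(1) bound]) auto
qed

text \<open>
  Off a small set, \<open>u\<close> is a smooth function plus a remainder with half the Lipschitz constant, which
  extends to the whole space. Iterating gives a \<open>C\<^sup>1\<close> series, without Whitney's extension theorem.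
\<close>

theorem lipschitz_C1_lusin_compact_support:
  fixes u :: "'a::euclidean_space \<Rightarrow> real"
  assumes u: "L-lipschitz_on UNIV u" and L: "L > 0" and supp: "\<And>x. x \<notin> cball 0 R \<Longrightarrow> u x = 0"
    and R: "R \<ge> 0" and \<tau>: "\<tau> > 0"
  obtains g T where "C1_map g" "(2 * L)-lipschitz_on UNIV g" "T \<in> lmeasurable" "measure lebesgue T < \<tau>"
    "\<And>x. x \<notin> T \<Longrightarrow> u x = g x"
proof -
  \<comment> \<open>The remainder after \<open>k\<close> steps: its Lipschitz constant has been
    halved \<open>k\<close> times while its support has grown by \<open>k\<close>.\<close>
  define P where "P k w \<longleftrightarrow> (L / 2 ^ k)-lipschitz_on UNIV w \<and> (\<forall>x. x \<notin> cball 0 (R + real k) \<longrightarrow> w x = 0) \<and> (k = 0 \<longrightarrow> w = u)"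
    for k :: nat and w :: "'a \<Rightarrow> real"
  define Q where "Q k w w' \<longleftrightarrow> (\<exists>v T. C1_map v \<and> (L / 2 ^ k)-lipschitz_on UNIV v \<and>
    T \<in> lmeasurable \<and> measure lebesgue T < \<tau> / 2 ^ (k + 2) \<and> (\<forall>x. x \<notin> T \<longrightarrow> w x = v x + w' x))"
    for k :: nat and w w' :: "'a \<Rightarrow> real"
  have "\<exists>f. \<forall>n. P n (f n) \<and> Q n (f n) (f (Suc n))"
  proof (rule dependent_nat_choice)
    show "\<exists>w. P 0 w" using u supp by (auto simp: P_def)
    fix w k assume "P k w"
    then have w: "(L / 2 ^ k)-lipschitz_on UNIV w" "\<And>x. x \<notin> cball 0 (R + real k) \<Longrightarrow> w x = 0" by (auto simp: P_def)
    obtain v w' T where "C1_map v" "(L / 2 ^ k)-lipschitz_on UNIV v" "(L / 2 ^ Suc k)-lipschitz_on UNIV w'"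
      "\<And>x. x \<notin> cball 0 ((R + real k) + 1) \<Longrightarrow> w' x = 0"
      "T \<in> lmeasurable" "measure lebesgue T < \<tau> / 2 ^ (k + 2)" "\<And>x. x \<notin> T \<Longrightarrow> w x = v x + w' x"
      by (rule lipschitz_C1_approximation_step[OF w(1) _ w(2), where \<delta> = "L / 2 ^ Suc k" and \<tau> = "\<tau> / 2 ^ (k + 2)"]) (use L \<tau> in auto)
    then have "P (Suc k) w'" "Q k w w'" by (auto simp: P_def Q_def algebra_simps)
    then show "\<exists>w'. P (Suc k) w' \<and> Q k w w'" by blast
  qed
  then obtain f where fP: "\<And>n. P n (f n)" and fQ: "\<And>n. Q n (f n) (f (Suc n))" by blast
  obtain v T where v: "\<And>k. C1_map (v k)" "\<And>k. (L / 2 ^ k)-lipschitz_on UNIV (v k)"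
    and T: "\<And>k. T k \<in> lmeasurable" "\<And>k. measure lebesgue (T k) < \<tau> / 2 ^ (k + 2)"
    and fs: "\<And>k x. x \<notin> T k \<Longrightarrow> f k x = v k x + f (Suc k) x"
    using fQ unfolding Q_def by metis
  let ?T = "\<Union>k. T k"
  have T': "?T \<in> lmeasurable" "measure lebesgue ?T \<le> \<tau> / 2"
    using measure_UN_geometric_le[OF T] \<tau> by auto
  have sums: "(\<lambda>n. v n x) sums u x" if x: "x \<notin> ?T" for x
  proof -
    have part: "u x = (\<Sum>i<n. v i x) + f n x" for n
    proof (induction n)
      case 0
      then show ?case using fP[of 0] by (simp add: P_def)
    next
      case (Suc n)
      then show ?case using fs[of x n] x by simp
    qed
    have "(\<lambda>n. f n x) \<longlonglongrightarrow> 0"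
    proof (rule Lim_null_comparison)
      show "(\<lambda>n. L / 2 ^ n * (norm x + R + real n + 1)) \<longlonglongrightarrow> 0" by real_asymp
      show "\<forall>\<^sub>F n in sequentially. norm (f n x) \<le> L / 2 ^ n * (norm x + R + real n + 1)"
      proof (rule always_eventually, rule allI)
        fix n
        \<comment> \<open>A point just outside the support of \<open>f n\<close>. Comparison with it
          bounds \<open>f n x\<close> by the Lipschitz constant times a distance growing linearly in
          \<open>n\<close>, and the factor \<open>1 / 2 ^ n\<close> wins.\<close>
        obtain b :: 'a where b: "b \<in> Basis" using nonempty_Basis by blast
        define z where "z = (R + real n + 1) *\<^sub>R b"
        have nz: "norm z = R + real n + 1" using b R by (simp add: z_def)
        then have "f n z = 0" using fP[of n] by (simp add: P_def)
        then have "norm (f n x) \<le> L / 2 ^ n * dist x z"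
          using lipschitz_onD[of "L / 2 ^ n" UNIV "f n" x z] fP[of n] by (simp add: P_def dist_norm)
        also have "dist x z \<le> norm x + R + real n + 1"
          using norm_triangle_ineq4[of x z] nz by (simp add: dist_norm)
        finally show "norm (f n x) \<le> L / 2 ^ n * (norm x + R + real n + 1)"
          using L by (simp add: mult_left_mono divide_right_mono)
      qed
    qed
    then have "(\<lambda>n. u x - f n x) \<longlonglongrightarrow> u x - 0" by (intro tendsto_intros)
    moreover have "(\<lambda>n. u x - f n x) = (\<lambda>n. \<Sum>i<n. v i x)" using part by (auto simp: algebra_simps)
    ultimately show ?thesis by (simp add: sums_def)
  qed
  \<comment> \<open>The termwise differentiation needs one point where the series is known to
    converge; finiteness of the measure of \<open>?T\<close> provides it.\<close>
  have "?T \<noteq> UNIV"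
  proof
    assume "?T = UNIV"
    then have "emeasure lebesgue (UNIV :: 'a set) < \<infinity>" using T'(1) by (simp add: fmeasurable_def)
    then show False by simp
  qed
  then obtain x0 where x0: "x0 \<notin> ?T" by blast
  obtain g where g: "C1_map g" "(2 * L)-lipschitz_on UNIV g" "\<And>x. (\<lambda>n. v n x) sums g x"
    using C1_series[OF v sums[OF x0]] by blast
  show ?thesis
  proof (rule that[OF g(1,2) T'(1)])
    show "measure lebesgue ?T < \<tau>" using T'(2) \<tau> by simp
    show "u x = g x" if "x \<notin> ?T" for x using sums[OF that] g(3) by (rule sums_unique2)
  qed
qed

text \<open>Reduction to compact support: after subtraction of a constant, \<open>u\<close> vanishes
  at a point of \<open>S\<close>, and prescribing the value zero far from \<open>S\<close> preserves
  the Lipschitz constant. The constant is added back at the end.\<close>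

theorem lipschitz_C1_lusin:
  fixes u :: "'a::euclidean_space \<Rightarrow> real"
  assumes u: "L-lipschitz_on S u" and L: "L > 0" and S: "bounded S" and \<tau>: "\<tau> > 0"
  obtains g T where "C1_map g" "(2 * L)-lipschitz_on UNIV g" "T \<in> lmeasurable" "measure lebesgue T < \<tau>"
    "\<And>x. x \<in> S - T \<Longrightarrow> u x = g x"
proof -
  obtain R where R: "R > 0" "S \<subseteq> ball 0 R" using bounded_subset_ballD[OF S, of 0] by blast
  define p where "p = (SOME p. p \<in> S)"
  have p: "p \<in> S" if "x \<in> S" for x using someI[of "\<lambda>p. p \<in> S" x] that by (simp add: p_def)
  define w where "w x = (if x \<in> S then u x - u p else 0)" for x
  \<comment> \<open>The radius \<open>3 * R\<close> makes every outside point at least as far from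
    \<open>x\<close> as \<open>p\<close> is, since points of \<open>S\<close> are less than
    \<open>2 * R\<close> apart.\<close>
  have key: "dist (w x) (w y) \<le> L * dist x y" if "x \<in> S" "y \<in> - cball 0 (3 * R)" for x y
  proof -
    have "norm x < R" "norm p < R" "3 * R < norm y" using that R p[OF that(1)] by auto
    then have "dist x p \<le> dist x y"
      using norm_triangle_ineq4[of x p] norm_triangle_ineq2[of y x] by (simp add: dist_norm norm_minus_commute)
    then have "L * dist x p \<le> L * dist x y" using L by simp
    moreover have "y \<notin> S" using that R by auto
    ultimately show ?thesis using lipschitz_onD[OF u that(1) p[OF that(1)]] that by (simp add: w_def dist_real_def)
  qed
  have "L-lipschitz_on (S \<union> - cball 0 (3 * R)) w"
  proof (rule lipschitz_onI)
    fix x y assume xy: "x \<in> S \<union> - cball 0 (3 * R)" "y \<in> S \<union> - cball 0 (3 * R)"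
    consider "x \<in> S" "y \<in> S" | "x \<in> S" "y \<in> - cball 0 (3 * R)" | "y \<in> S" "x \<in> - cball 0 (3 * R)"
      | "x \<notin> S" "y \<notin> S" using xy by blast
    then show "dist (w x) (w y) \<le> L * dist x y"
    proof cases
      case 1
      then show ?thesis using lipschitz_onD[OF u 1] by (simp add: w_def dist_real_def)
    next
      case 3
      then show ?thesis using key[of y x] by (simp add: dist_commute)
    qed (use key L in \<open>auto simp: w_def\<close>)
  qed (use L in simp)
  then obtain w' where w': "L-lipschitz_on UNIV w'" "\<And>x. x \<in> S \<union> - cball 0 (3 * R) \<Longrightarrow> w' x = w x"
    by (rule lipschitz_on_real_extension) blast
  have supp: "w' x = 0" if "x \<notin> cball 0 (3 * R)" for x
  proof -
    have "x \<notin> S" using that R by auto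
    then show ?thesis using w'(2)[of x] that by (simp add: w_def)
  qed
  obtain g T where g: "C1_map g" "(2 * L)-lipschitz_on UNIV g" "T \<in> lmeasurable" "measure lebesgue T < \<tau>"
    "\<And>x. x \<notin> T \<Longrightarrow> w' x = g x"
    by (rule lipschitz_C1_lusin_compact_support[OF w'(1) L supp _ \<tau>]) (use R in auto)
  have "C1_map (\<lambda>x. g x + u p)"
    using g(1) unfolding C1_map_def by (auto intro!: has_derivative_add_const)
  moreover have "(2 * L)-lipschitz_on UNIV (\<lambda>x. g x + u p)"
    using g(2) by (simp add: lipschitz_on_def)
  ultimately show ?thesis
  proof (rule that[OF _ _ g(3,4)])
    fix x assume "x \<in> S - T"
    then show "u x = g x + u p" using g(5)[of x] w'(2)[of x] by (simp add: w_def)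
  qed
qed

section \<open>Approximate metric derivatives\<close>

lemma is_seminormD:
  assumes "is_seminorm \<sigma>"
  shows "0 \<le> \<sigma> v" "\<sigma> (c *\<^sub>R v) = \<bar>c\<bar> * \<sigma> v" "\<sigma> (v + w) \<le> \<sigma> v + \<sigma> w"
  using assms unfolding is_seminorm_def by blast+

lemma is_seminorm_0: "is_seminorm \<sigma> \<Longrightarrow> \<sigma> 0 = 0"
  using is_seminormD(2)[of \<sigma> 0 0] by simp

lemma is_seminorm_diff:
  assumes "is_seminorm \<sigma>" shows "\<bar>\<sigma> v - \<sigma> w\<bar> \<le> \<sigma> (v - w)"
proof -
  have "\<sigma> (w - v) = \<sigma> (v - w)" using is_seminormD(2)[OF assms, of "-1" "v - w"] by simp
  then show ?thesis
    using is_seminormD(3)[OF assms, of "v - w" w] is_seminormD(3)[OF assms, of "w - v" v] by (simp add: abs_le_iff)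
qed

lemma is_seminorm_bounded:
  fixes \<sigma> :: "'a::euclidean_space \<Rightarrow> real"
  assumes "is_seminorm \<sigma>" obtains C where "C > 0" "\<And>v. \<sigma> v \<le> C * norm v"
proof -
  have sum: "\<sigma> (\<Sum>i\<in>F. w i) \<le> (\<Sum>i\<in>F. \<sigma> (w i))" if "finite F" for F and w :: "'a \<Rightarrow> 'a"
    using that by (induction F) (auto simp: is_seminorm_0[OF assms] intro: order_trans[OF is_seminormD(3)[OF assms]])
  have "\<sigma> v \<le> (1 + (\<Sum>i\<in>Basis. \<sigma> i)) * norm v" for v
  proof -
    have "\<sigma> v = \<sigma> (\<Sum>i\<in>Basis. (v \<bullet> i) *\<^sub>R i)" by (simp add: euclidean_representation)
    also have "\<dots> \<le> (\<Sum>i\<in>Basis. \<sigma> ((v \<bullet> i) *\<^sub>R i))" by (rule sum) simp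
    also have "\<dots> \<le> (\<Sum>i\<in>Basis. norm v * \<sigma> i)"
      by (rule sum_mono) (simp add: is_seminormD[OF assms] Basis_le_norm mult_right_mono)
    also have "\<dots> \<le> (1 + (\<Sum>i\<in>Basis. \<sigma> i)) * norm v" by (simp add: sum_distrib_left[symmetric] algebra_simps)
    finally show ?thesis .
  qed
  moreover have "1 + (\<Sum>i\<in>Basis. \<sigma> (i::'a)) > 0" by (simp add: add_pos_nonneg sum_nonneg is_seminormD[OF assms])
  ultimately show ?thesis using that by blast
qed

text \<open>By inclusion and exclusion inside a ball, the relative density of the intersection is at
  least the sum of the two densities minus 1.\<close>

lemma lebesgue_density_point_Int:
  fixes x :: "'a::euclidean_space"
  assumes S: "S \<in> sets lebesgue" "T \<in> sets lebesgue"
    and d: "lebesgue_density_point x S" "lebesgue_density_point x T"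
  shows "lebesgue_density_point x (S \<inter> T)"
proof -
  let ?q = "\<lambda>S r. measure lebesgue (S \<inter> ball x r) / measure lebesgue (ball x r)"
  have "((\<lambda>r. ?q S r + ?q T r - 1) \<longlongrightarrow> 1 + 1 - 1) (at_right 0)"
    by (intro tendsto_intros d[unfolded lebesgue_density_point_def])
  then have lim: "((\<lambda>r. ?q S r + ?q T r - 1) \<longlongrightarrow> 1) (at_right 0)" by simp
  show ?thesis
    unfolding lebesgue_density_point_def
  proof (rule tendsto_sandwich[OF _ _ lim tendsto_const])
    show "\<forall>\<^sub>F r in at_right 0. ?q (S \<inter> T) r \<le> 1"
    proof (rule always_eventually, rule allI)
      fix r
      have "measure lebesgue (S \<inter> T \<inter> ball x r) \<le> measure lebesgue (ball x r)"
        by (rule measure_mono_fmeasurable) (use S in auto)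
      then show "?q (S \<inter> T) r \<le> 1" by (simp add: divide_le_eq)
    qed
    show "\<forall>\<^sub>F r in at_right 0. ?q S r + ?q T r - 1 \<le> ?q (S \<inter> T) r"
      unfolding eventually_at_right_field
    proof (intro exI[of _ 1] conjI allI impI)
      fix r :: real assume r: "0 < r" "r < 1"
      have m: "S \<inter> ball x r \<in> lmeasurable" "T \<inter> ball x r \<in> lmeasurable" "S \<inter> T \<inter> ball x r \<in> lmeasurable"
        using S fmeasurable_Int_fmeasurable[of "ball x r" lebesgue] by (auto simp: Int_commute[of _ "ball x r"])
      have "measure lebesgue ((S \<inter> ball x r) \<union> (T \<inter> ball x r)) =
          measure lebesgue (S \<inter> ball x r) + measure lebesgue (T \<inter> ball x r) - measure lebesgue ((S \<inter> ball x r) \<inter> (T \<inter> ball x r))"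
        by (rule measure_Un3[OF m(1,2)])
      moreover have "(S \<inter> ball x r) \<inter> (T \<inter> ball x r) = S \<inter> T \<inter> ball x r" by blast
      moreover have "measure lebesgue ((S \<inter> ball x r) \<union> (T \<inter> ball x r)) \<le> measure lebesgue (ball x r)"
        by (rule measure_mono_fmeasurable) (use m in auto)
      ultimately have "measure lebesgue (S \<inter> ball x r) + measure lebesgue (T \<inter> ball x r) - measure lebesgue (ball x r) \<le>
          measure lebesgue (S \<inter> T \<inter> ball x r)" by simp
      then have "(measure lebesgue (S \<inter> ball x r) + measure lebesgue (T \<inter> ball x r) - measure lebesgue (ball x r)) / measure lebesgue (ball x r)
          \<le> ?q (S \<inter> T) r" by (rule divide_right_mono) simp
      moreover have "measure lebesgue (ball x r) / measure lebesgue (ball x r) = 1" using r by simp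
      ultimately show "?q S r + ?q T r - 1 \<le> ?q (S \<inter> T) r" by (simp only: diff_divide_distrib add_divide_distrib)
    qed simp
  qed
qed

text \<open>A ball of radius proportional to \<open>t\<close> around
  \<open>x + t *\<^sub>R v\<close> fills a fixed fraction of a ball around \<open>x\<close>, and a
  set with density point \<open>x\<close> cannot miss such a fraction at small scales.\<close>

lemma lebesgue_density_point_direction:
  fixes x :: "'a::euclidean_space"
  assumes S: "S \<in> sets lebesgue" and d: "lebesgue_density_point x S" and v: "v \<noteq> 0" and \<kappa>: "\<kappa> > 0"
  obtains r where "r > 0" "\<And>t. 0 < t \<Longrightarrow> t < r \<Longrightarrow> \<exists>y\<in>S. y \<noteq> x \<and> dist y (x + t *\<^sub>R v) \<le> \<kappa> * t"
proof -
  \<comment> \<open>The bound by \<open>norm v\<close> keeps the small open ball away from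
    \<open>x\<close> and inside the ball of radius \<open>2 * (t * norm v)\<close> around
    \<open>x\<close>.\<close>
  define k where "k = min \<kappa> (norm v)"
  have k: "0 < k" "k \<le> \<kappa>" "k \<le> norm v" using \<kappa> v by (auto simp: k_def)
  define \<theta> where "\<theta> = (k / (2 * norm v)) ^ DIM('a)"
  have \<theta>: "\<theta> > 0" using k v by (simp add: \<theta>_def)
  have "\<forall>\<^sub>F r in at_right 0. 1 - \<theta> < measure lebesgue (S \<inter> ball x r) / measure lebesgue (ball x r)"
    using d[unfolded lebesgue_density_point_def] \<theta> by (intro order_tendstoD(1)) auto
  then obtain b where b: "b > 0" "\<And>r. 0 < r \<Longrightarrow> r < b \<Longrightarrow> 1 - \<theta> < measure lebesgue (S \<inter> ball x r) / measure lebesgue (ball x r)"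
    unfolding eventually_at_right_field by auto
  show ?thesis
  proof (rule that[of "b / (2 * norm v)"])
    show "b / (2 * norm v) > 0" using b v by simp
    fix t assume t: "0 < t" "t < b / (2 * norm v)"
    define y where "y = x + t *\<^sub>R v"
    define r where "r = 2 * (t * norm v)"
    have r: "0 < r" "r < b" using t v by (simp_all add: r_def field_simps)
    have "t * k \<le> t * norm v" using k t by simp
    show "\<exists>z\<in>S. z \<noteq> x \<and> dist z (x + t *\<^sub>R v) \<le> \<kappa> * t"
    proof (rule ccontr)
      assume neg: "\<not> ?thesis"
      have disj: "S \<inter> ball y (t * k) = {}"
      proof (rule ccontr)
        assume "S \<inter> ball y (t * k) \<noteq> {}"
        then obtain z where z: "z \<in> S" "dist z y < t * k" by (auto simp: dist_commute)
        have "z \<noteq> x"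
          using z(2) \<open>t * k \<le> t * norm v\<close> t by (auto simp: y_def dist_norm)
        moreover have "dist z y \<le> \<kappa> * t" using z(2) t mult_right_mono[OF k(2), of t] mult.commute[of t k] by linarith
        ultimately show False using neg z(1) by (auto simp: y_def)
      qed
      have sub: "ball y (t * k) \<subseteq> ball x r"
      proof
        fix z assume "z \<in> ball y (t * k)"
        moreover have "dist x y = t * norm v" using t by (simp add: y_def dist_norm)
        ultimately show "z \<in> ball x r"
          using dist_triangle[of x z y] \<open>t * k \<le> t * norm v\<close> unfolding r_def mem_ball by linarith
      qed
      have "measure lebesgue (S \<inter> ball x r) \<le> measure lebesgue (ball x r - ball y (t * k))"
        by (rule measure_mono_fmeasurable) (use disj S in \<open>auto intro!: fmeasurable.Diff\<close>)
      also have "\<dots> = measure lebesgue (ball x r) - measure lebesgue (ball y (t * k))"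
        by (rule measurable_measure_Diff) (use sub in auto)
      also have "measure lebesgue (ball y (t * k)) = \<theta> * measure lebesgue (ball x r)"
        using r t k v by (simp add: content_ball \<theta>_def r_def power_divide power_mult_distrib)
      finally have "measure lebesgue (S \<inter> ball x r) \<le> (1 - \<theta>) * measure lebesgue (ball x r)" by (simp add: algebra_simps)
      moreover have "0 < measure lebesgue (ball x r)" using r by simp
      ultimately show False using b(2)[OF r] by (simp add: pos_less_divide_eq)
    qed
  qed
qed

text \<open>The ray itself may miss \<open>S\<close>, so the limit is rewritten as an estimate in a
  thin cone around it. Half of \<open>e\<close> pays for the limit, the other half for replacing
  \<open>y - x\<close> by \<open>t *\<^sub>R v\<close> in the seminorm, which is bounded by a
  multiple of the norm.\<close>

lemma has_approx_metric_derivative_direction: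
  fixes f :: "'a::euclidean_space \<Rightarrow> 'b::metric_space"
  assumes lim: "((\<lambda>y. (dist (f y) (f x) - \<sigma> (y - x)) / norm (y - x)) \<longlongrightarrow> 0) (at x within S)"
    and \<sigma>: "is_seminorm \<sigma>" and e: "e > 0"
  obtains r \<kappa> where "r > 0" "\<kappa> > 0"
    "\<And>t y. 0 < t \<Longrightarrow> t < r \<Longrightarrow> y \<in> S \<Longrightarrow> y \<noteq> x \<Longrightarrow> dist y (x + t *\<^sub>R v) \<le> \<kappa> * t \<Longrightarrow> \<bar>dist (f y) (f x) - t * \<sigma> v\<bar> \<le> e * t"
proof -
  obtain C where C: "C > 0" "\<And>v. \<sigma> v \<le> C * norm v" using is_seminorm_bounded[OF \<sigma>] by blast
  define M where "M = norm v + 1"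
  have M: "M > 0" by (simp add: M_def add_nonneg_pos)
  define \<kappa> where "\<kappa> = min 1 (e / (2 * C))"
  have \<kappa>: "\<kappa> > 0" "\<kappa> \<le> 1" "C * \<kappa> \<le> e / 2"
  proof -
    have "C * \<kappa> \<le> C * (e / (2 * C))" using C by (intro mult_left_mono) (auto simp: \<kappa>_def)
    then show "C * \<kappa> \<le> e / 2" using C by simp
  qed (use e C in \<open>auto simp: \<kappa>_def\<close>)
  have "e / (2 * M) > 0" using e M by simp
  then have "\<forall>\<^sub>F y in at x within S. \<bar>(dist (f y) (f x) - \<sigma> (y - x)) / norm (y - x)\<bar> < e / (2 * M)"
    using tendstoD[OF lim] by (simp add: dist_real_def)
  then obtain r where r: "r > 0" "\<And>y. y \<in> S \<Longrightarrow> y \<noteq> x \<Longrightarrow> dist y x < r \<Longrightarrow>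
      \<bar>(dist (f y) (f x) - \<sigma> (y - x)) / norm (y - x)\<bar> < e / (2 * M)"
    unfolding eventually_at by auto
  show ?thesis
  proof (rule that[of "r / M" \<kappa>])
    show "r / M > 0" using r M by simp
    fix t y assume t: "0 < t" "t < r / M" and y: "y \<in> S" "y \<noteq> x" "dist y (x + t *\<^sub>R v) \<le> \<kappa> * t"
    have "norm (y - x) \<le> norm (y - x - t *\<^sub>R v) + norm (t *\<^sub>R v)"
      using norm_triangle_ineq[of "y - x - t *\<^sub>R v" "t *\<^sub>R v"] by simp
    also have "norm (y - x - t *\<^sub>R v) \<le> \<kappa> * t" using y(3) by (simp add: dist_norm diff_diff_eq)
    also have "\<kappa> * t \<le> 1 * t" using \<kappa> t by (intro mult_right_mono) auto
    finally have ny: "norm (y - x) \<le> M * t" using t by (simp add: M_def algebra_simps)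
    also have "\<dots> < r" using t M by (simp add: field_simps)
    finally have "\<bar>(dist (f y) (f x) - \<sigma> (y - x)) / norm (y - x)\<bar> < e / (2 * M)"
      using r(2)[OF y(1,2)] by (simp add: dist_norm)
    then have "\<bar>dist (f y) (f x) - \<sigma> (y - x)\<bar> \<le> e / (2 * M) * norm (y - x)"
      using y(2) by (simp add: abs_divide pos_divide_less_eq less_imp_le)
    also have "\<dots> \<le> e / (2 * M) * (M * t)" using e M ny by (intro mult_left_mono) auto
    also have "\<dots> = e / 2 * t" using M by simp
    finally have 1: "\<bar>dist (f y) (f x) - \<sigma> (y - x)\<bar> \<le> e / 2 * t" .
    have "\<bar>\<sigma> (y - x) - \<sigma> (t *\<^sub>R v)\<bar> \<le> C * norm (y - x - t *\<^sub>R v)"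
      using is_seminorm_diff[OF \<sigma>] C(2) order_trans by blast
    also have "\<dots> \<le> C * (\<kappa> * t)" using y(3) C by (intro mult_left_mono) (auto simp: dist_norm diff_diff_eq)
    also have "\<dots> = (C * \<kappa>) * t" by simp
    also have "\<dots> \<le> e / 2 * t" using \<kappa> t by (intro mult_right_mono) auto
    finally have 2: "\<bar>\<sigma> (y - x) - t * \<sigma> v\<bar> \<le> e / 2 * t" using is_seminormD(2)[OF \<sigma>, of t v] t by simp
    have "e * t = e / 2 * t + e / 2 * t" by simp
    then show "\<bar>dist (f y) (f x) - t * \<sigma> v\<bar> \<le> e * t" using 1 2 by linarith
  qed (use \<kappa> in auto)
qed

text \<open>The intersection of the two density sets still contains points close to each ray, and
  there both seminorms are compared with the same distance. This justifies the description operator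
  in \<open>md_a\<close>.\<close>

lemma has_approx_metric_derivative_unique:
  fixes f :: "'a::euclidean_space \<Rightarrow> 'b::metric_space"
  assumes "has_approx_metric_derivative f A x \<sigma>1" "has_approx_metric_derivative f A x \<sigma>2"
  shows "\<sigma>1 = \<sigma>2"
proof (rule ext)
  fix v
  from assms(1) obtain S1 where sn1: "is_seminorm \<sigma>1" and S1: "S1 \<in> sets lebesgue" "lebesgue_density_point x S1"
    and l1: "((\<lambda>y. (dist (f y) (f x) - \<sigma>1 (y - x)) / norm (y - x)) \<longlongrightarrow> 0) (at x within S1)"
    unfolding has_approx_metric_derivative_def by blast
  from assms(2) obtain S2 where sn2: "is_seminorm \<sigma>2" and S2: "S2 \<in> sets lebesgue" "lebesgue_density_point x S2"
    and l2: "((\<lambda>y. (dist (f y) (f x) - \<sigma>2 (y - x)) / norm (y - x)) \<longlongrightarrow> 0) (at x within S2)"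
    unfolding has_approx_metric_derivative_def by blast
  have S: "S1 \<inter> S2 \<in> sets lebesgue" "lebesgue_density_point x (S1 \<inter> S2)"
    using S1 S2 lebesgue_density_point_Int by auto
  show "\<sigma>1 v = \<sigma>2 v"
  proof (cases "v = 0")
    case True
    then show ?thesis using sn1 sn2 by (simp add: is_seminorm_0)
  next
    case v: False
    have "\<bar>\<sigma>1 v - \<sigma>2 v\<bar> \<le> 0 + e" if e: "e > 0" for e
    proof -
      have e2: "e / 2 > 0" using e by simp
      obtain r1 \<kappa>1 where 1: "r1 > 0" "\<kappa>1 > 0" "\<And>t y. 0 < t \<Longrightarrow> t < r1 \<Longrightarrow> y \<in> S1 \<Longrightarrow> y \<noteq> x \<Longrightarrow> dist y (x + t *\<^sub>R v) \<le> \<kappa>1 * t \<Longrightarrow> \<bar>dist (f y) (f x) - t * \<sigma>1 v\<bar> \<le> e / 2 * t"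
        using has_approx_metric_derivative_direction[OF l1 sn1 e2, where v = v] by blast
      obtain r2 \<kappa>2 where 2: "r2 > 0" "\<kappa>2 > 0" "\<And>t y. 0 < t \<Longrightarrow> t < r2 \<Longrightarrow> y \<in> S2 \<Longrightarrow> y \<noteq> x \<Longrightarrow> dist y (x + t *\<^sub>R v) \<le> \<kappa>2 * t \<Longrightarrow> \<bar>dist (f y) (f x) - t * \<sigma>2 v\<bar> \<le> e / 2 * t"
        using has_approx_metric_derivative_direction[OF l2 sn2 e2, where v = v] by blast
      have "min \<kappa>1 \<kappa>2 > 0" using 1 2 by simp
      then obtain r where r: "r > 0" "\<And>t. 0 < t \<Longrightarrow> t < r \<Longrightarrow> \<exists>y\<in>S1 \<inter> S2. y \<noteq> x \<and> dist y (x + t *\<^sub>R v) \<le> min \<kappa>1 \<kappa>2 * t"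
        using lebesgue_density_point_direction[OF S v] by blast
      define t where "t = min r (min r1 r2) / 2"
      have t: "0 < t" "t < r" "t < r1" "t < r2" using r 1 2 by (auto simp: t_def)
      obtain y where y: "y \<in> S1" "y \<in> S2" "y \<noteq> x" "dist y (x + t *\<^sub>R v) \<le> min \<kappa>1 \<kappa>2 * t" using r(2)[OF t(1,2)] by blast
      have "min \<kappa>1 \<kappa>2 * t \<le> \<kappa>1 * t" "min \<kappa>1 \<kappa>2 * t \<le> \<kappa>2 * t" using t by (auto intro!: mult_right_mono)
      then have "\<bar>dist (f y) (f x) - t * \<sigma>1 v\<bar> \<le> e / 2 * t" "\<bar>dist (f y) (f x) - t * \<sigma>2 v\<bar> \<le> e / 2 * t"
        using 1(3)[OF t(1,3) y(1,3)] 2(3)[OF t(1,4) y(2,3)] y(4) by linarith+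
      moreover have "e * t = e / 2 * t + e / 2 * t" by simp
      ultimately have "\<bar>t * \<sigma>1 v - t * \<sigma>2 v\<bar> \<le> e * t" by linarith
      then have "t * \<bar>\<sigma>1 v - \<sigma>2 v\<bar> \<le> t * e" using t by (simp add: abs_mult mult.commute flip: right_diff_distrib)
      then show ?thesis using t by simp
    qed
    then show ?thesis using field_le_epsilon[of "\<bar>\<sigma>1 v - \<sigma>2 v\<bar>" 0] by fastforce
  qed
qed

lemma has_approx_metric_derivative_md_a:
  assumes "approx_metric_differentiable f A x" shows "has_approx_metric_derivative f A x (md_a f A x)"
  using assms has_approx_metric_derivative_unique unfolding approx_metric_differentiable_def md_a_def
  by (metis theI)

text \<open>A point of \<open>A\<close> in the cone is within \<open>2 * \<kappa> * t\<close> of a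
  point of the density set, so Lipschitz continuity of \<open>f\<close> transfers the bound. The
  density set, which varies with \<open>x\<close>, thereby disappears from the conclusion.\<close>

lemma has_approx_metric_derivative_cone_lower_bound:
  fixes f :: "'a::euclidean_space \<Rightarrow> 'b::metric_space"
  assumes md: "has_approx_metric_derivative f A x \<sigma>" and f: "L-lipschitz_on A f" and x: "x \<in> A"
    and c: "0 \<le> c" "c < \<sigma> v"
  obtains r \<kappa> where "r > 0" "\<kappa> > 0"
    "\<And>t y. 0 < t \<Longrightarrow> t < r \<Longrightarrow> y \<in> A \<Longrightarrow> dist y (x + t *\<^sub>R v) \<le> \<kappa> * t \<Longrightarrow> c * t \<le> dist (f y) (f x)"
proof -
  from md obtain S where sn: "is_seminorm \<sigma>" and S: "S \<in> sets lebesgue" "S \<subseteq> A" "lebesgue_density_point x S"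
    and l: "((\<lambda>y. (dist (f y) (f x) - \<sigma> (y - x)) / norm (y - x)) \<longlongrightarrow> 0) (at x within S)"
    unfolding has_approx_metric_derivative_def by blast
  have L: "L \<ge> 0" using f by (simp add: lipschitz_on_def)
  have v: "v \<noteq> 0" using c is_seminorm_0[OF sn] by auto
  \<comment> \<open>One share of the gap is spent on the metric derivative at \<open>z\<close>, the
    other on passing from \<open>z\<close> to \<open>y\<close>.\<close>
  define e where "e = (\<sigma> v - c) / 2"
  have e: "e > 0" using c by (simp add: e_def)
  obtain r1 \<kappa>1 where 1: "r1 > 0" "\<kappa>1 > 0" "\<And>t y. 0 < t \<Longrightarrow> t < r1 \<Longrightarrow> y \<in> S \<Longrightarrow> y \<noteq> x \<Longrightarrow> dist y (x + t *\<^sub>R v) \<le> \<kappa>1 * t \<Longrightarrow> \<bar>dist (f y) (f x) - t * \<sigma> v\<bar> \<le> e * t"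
    using has_approx_metric_derivative_direction[OF l sn e, where v = v] by blast
  define \<kappa> where "\<kappa> = min \<kappa>1 (e / (2 * (L + 1)))"
  have \<kappa>: "\<kappa> > 0" "\<kappa> \<le> \<kappa>1" using 1 e L by (auto simp: \<kappa>_def)
  have "\<kappa> * (2 * (L + 1)) \<le> e" using L by (subst pos_le_divide_eq[symmetric]) (auto simp: \<kappa>_def)
  then have L\<kappa>: "L * (2 * \<kappa>) \<le> e" using \<kappa> by (simp add: algebra_simps)
  obtain r where r: "r > 0" "\<And>t. 0 < t \<Longrightarrow> t < r \<Longrightarrow> \<exists>y\<in>S. y \<noteq> x \<and> dist y (x + t *\<^sub>R v) \<le> \<kappa> * t"
    using lebesgue_density_point_direction[OF S(1,3) v \<kappa>(1)] by blast
  show ?thesis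
  proof (rule that[of "min r r1" \<kappa>])
    fix t y assume t: "0 < t" "t < min r r1" and y: "y \<in> A" "dist y (x + t *\<^sub>R v) \<le> \<kappa> * t"
    obtain z where z: "z \<in> S" "z \<noteq> x" "dist z (x + t *\<^sub>R v) \<le> \<kappa> * t" using r(2)[of t] t by auto
    have "\<kappa> * t \<le> \<kappa>1 * t" using \<kappa> t by (intro mult_right_mono) auto
    then have "dist z (x + t *\<^sub>R v) \<le> \<kappa>1 * t" using z(3) by linarith
    then have "\<bar>dist (f z) (f x) - t * \<sigma> v\<bar> \<le> e * t" using 1(3)[of t z] t z by auto
    moreover have "dist (f z) (f y) \<le> e * t"
    proof -
      have "dist (f z) (f y) \<le> L * dist z y" using lipschitz_onD[OF f, of z y] z(1) S(2) y(1) by auto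
      also have "dist z y \<le> \<kappa> * t + \<kappa> * t" using dist_triangle2[of z y "x + t *\<^sub>R v"] y(2) z(3) by linarith
      also have "L * (\<kappa> * t + \<kappa> * t) = L * (2 * \<kappa>) * t" by (simp add: algebra_simps)
      also have "\<dots> \<le> e * t" using L\<kappa> t by (intro mult_right_mono) auto
      finally show ?thesis using L by (simp add: mult_left_mono)
    qed
    moreover have "c * t = t * \<sigma> v - e * t - e * t" by (simp add: e_def field_simps)
    ultimately show "c * t \<le> dist (f y) (f x)" using dist_triangle[of "f z" "f x" "f y"] by linarith
  qed (use r 1 \<kappa> in auto)
qed

section \<open>Slopes of distance functions\<close>

lemma lebesgue_inner_compact_nonnegligible:
  fixes S :: "'a::euclidean_space set"
  assumes S: "S \<in> sets lebesgue" "\<not> negligible S"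
  obtains K where "compact K" "K \<subseteq> S" "\<not> negligible K"
proof -
  have "\<exists>n. \<not> negligible (S \<inter> cball 0 (real n))"
  proof (rule ccontr)
    assume "\<not> ?thesis"
    then have "negligible (\<Union>n. S \<inter> cball 0 (real n))" by (intro negligible_countable_Union) auto
    moreover have "(\<Union>n. S \<inter> cball 0 (real n)) = S" using real_arch_simple by auto
    ultimately show False using S by simp
  qed
  then obtain n where n: "\<not> negligible (S \<inter> cball 0 (real n))" by blast
  let ?S = "S \<inter> cball 0 (real n)"
  have Sm: "?S \<in> lmeasurable" by (rule bounded_set_imp_lmeasurable) (use S(1) in \<open>auto intro: bounded_subset[OF bounded_cball]\<close>)
  have "measure lebesgue ?S > 0"
    using n Sm by (simp add: negligible_iff_measure0 zero_less_measure_iff)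
  then have "measure lebesgue ?S / 2 > 0" by simp
  then obtain T where T: "closed T" "T \<subseteq> ?S" "?S - T \<in> lmeasurable" "emeasure lebesgue (?S - T) < ennreal (measure lebesgue ?S / 2)"
    using sets_lebesgue_inner_closed[OF fmeasurableD[OF Sm]] by blast
  have "\<not> negligible T"
  proof
    assume T0: "negligible T"
    have "emeasure lebesgue (?S - T) = emeasure lebesgue ?S"
      using T0 fmeasurableD[OF Sm] by (intro emeasure_Diff_null_set) (auto simp: negligible_iff_null_sets)
    then have "ennreal (measure lebesgue ?S) < ennreal (measure lebesgue ?S / 2)"
      using T(4) emeasure_eq_measure2[OF Sm] by simp
    then show False using \<open>measure lebesgue ?S > 0\<close> by (simp add: ennreal_less_iff)
  qed
  moreover have "compact T" using T(1,2) by (meson bounded_cball bounded_subset compact_eq_bounded_closed inf.boundedE)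
  ultimately show ?thesis using that T(2) by blast
qed

text \<open>If every short interval with both ends in \<open>T\<close> lost a proportion \<eta> of
  its length, then \<open>T\<close> would have density at most \<open>1 - \<eta>\<close> near each
  of its points and be null.\<close>

lemma nonnegligible_dense_interval:
  fixes T :: "real set"
  assumes T: "closed T" "\<not> negligible T" and "\<eta> > 0" "r > 0"
  obtains \<alpha> \<beta> where "\<alpha> \<in> T" "\<beta> \<in> T" "\<alpha> < \<beta>" "\<beta> - \<alpha> < r" "measure lebesgue ({\<alpha>..\<beta>} - T) \<le> \<eta> * (\<beta> - \<alpha>)"
proof (rule ccontr)
  assume neg: "\<not> thesis"
  have H: "\<eta> * (\<beta> - \<alpha>) < measure lebesgue ({\<alpha>..\<beta>} - T)" if "\<alpha> \<in> T" "\<beta> \<in> T" "\<alpha> < \<beta>" "\<beta> - \<alpha> < r" for \<alpha> \<beta>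
    using neg \<open>\<And>\<alpha> \<beta>. \<alpha> \<in> T \<Longrightarrow> \<beta> \<in> T \<Longrightarrow> \<alpha> < \<beta> \<Longrightarrow> \<beta> - \<alpha> < r \<Longrightarrow> measure lebesgue ({\<alpha>..\<beta>} - T) \<le> \<eta> * (\<beta> - \<alpha>) \<Longrightarrow> thesis\<close> that
    by (meson not_le)
  define \<theta> where "\<theta> = max 0 (1 - \<eta>)"
  have "negligible T"
  proof (rule negligible_of_low_density[of \<theta>])
    fix t r' :: real assume t: "t \<in> T" and r': "0 < r'"
    define d where "d = min r' r / 4"
    have d: "0 < d" "d < r'" "2 * d < r" using r' \<open>r > 0\<close> by (auto simp: d_def)
    define I where "I = T \<inter> cball t d"
    have I: "compact I" "t \<in> I" using T(1) t d by (auto simp: I_def intro: closed_Int_compact)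
    \<comment> \<open>The interval is shrunk to the extreme points of \<open>T\<close> in it,
      because \<open>H\<close> speaks only of intervals with both ends in \<open>T\<close>.\<close>
    obtain \<alpha> where \<alpha>: "\<alpha> \<in> I" "\<And>s. s \<in> I \<Longrightarrow> \<alpha> \<le> s" using compact_attains_inf[OF I(1)] I(2) by blast
    obtain \<beta> where \<beta>: "\<beta> \<in> I" "\<And>s. s \<in> I \<Longrightarrow> s \<le> \<beta>" using compact_attains_sup[OF I(1)] I(2) by blast
    have ab: "\<alpha> \<le> \<beta>" "\<beta> - \<alpha> \<le> 2 * d" using \<alpha> \<beta> by (auto simp: I_def dist_real_def)
    have "I \<in> lmeasurable" using I(1) by (rule lmeasurable_compact)
    moreover have "measure lebesgue I \<le> \<theta> * (\<beta> - \<alpha>)"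
    proof (cases "\<alpha> = \<beta>")
      case True
      then have "I \<subseteq> {\<alpha>}" using \<alpha> \<beta> by force
      then have "negligible I" by (rule negligible_subset[OF negligible_sing])
      then show ?thesis using True by (simp add: negligible_imp_measure0)
    next
      case False
      then have lt: "\<alpha> < \<beta>" using ab by simp
      have TI: "T \<inter> {\<alpha>..\<beta>} \<in> lmeasurable"
        using T(1) by (intro lmeasurable_compact closed_Int_compact) auto
      have "I \<subseteq> T \<inter> {\<alpha>..\<beta>}" using \<alpha>(2) \<beta>(2) by (auto simp: I_def)
      then have "measure lebesgue I \<le> measure lebesgue (T \<inter> {\<alpha>..\<beta>})"
        using \<open>I \<in> lmeasurable\<close> TI by (intro measure_mono_fmeasurable) auto
      also have "\<dots> = measure lebesgue {\<alpha>..\<beta>} - measure lebesgue ({\<alpha>..\<beta>} - T \<inter> {\<alpha>..\<beta>})"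
        using TI by (subst measurable_measure_Diff) auto
      also have "{\<alpha>..\<beta>} - T \<inter> {\<alpha>..\<beta>} = {\<alpha>..\<beta>} - T" by blast
      also have "measure lebesgue {\<alpha>..\<beta>} - measure lebesgue ({\<alpha>..\<beta>} - T) \<le> (1 - \<eta>) * (\<beta> - \<alpha>)"
        using H[of \<alpha> \<beta>] \<alpha>(1) \<beta>(1) lt ab(2) d(3) by (simp add: I_def algebra_simps)
      also have "\<dots> \<le> \<theta> * (\<beta> - \<alpha>)" using ab by (intro mult_right_mono) (auto simp: \<theta>_def)
      finally show ?thesis .
    qed
    moreover have "\<theta> * (\<beta> - \<alpha>) \<le> \<theta> * measure lebesgue (cball t d)"
      using ab d by (intro mult_left_mono) (auto simp: cball_eq_atLeastAtMost \<theta>_def)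
    ultimately show "\<exists>a d U. 0 < d \<and> d < r' \<and> t \<in> cball a d \<and> U \<in> lmeasurable \<and>
        T \<inter> cball a d \<subseteq> U \<and> measure lebesgue U \<le> \<theta> * measure lebesgue (cball a d)"
      using d I_def by (intro exI[of _ t] exI[of _ d] exI[of _ I] conjI) auto
  qed (use \<open>\<eta> > 0\<close> in \<open>auto simp: \<theta>_def\<close>)
  then show False using T(2) by blast
qed

text \<open>
  Continuous induction: at an accumulation point of \<open>T\<close> the next step is taken inside \<open>T\<close>, where
  \<open>\<phi>\<close> and \<open>\<gamma>\<close> agree, and elsewhere inside the complement of \<open>T\<close>.
\<close>

lemma lipschitz_increment_le:
  fixes \<phi> \<gamma> :: "real \<Rightarrow> real"
  assumes \<phi>: "L-lipschitz_on UNIV \<phi>" and T: "closed T" and c: "0 \<le> c" "c' < c"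
    and eq: "\<And>t. t \<in> T \<Longrightarrow> \<gamma> t = \<phi> t"
    and der: "\<And>t. t \<in> T \<Longrightarrow> \<exists>d\<le>c'. (\<gamma> has_real_derivative d) (at t)"
    and ab: "a \<le> b"
  shows "\<phi> b - \<phi> a \<le> c * (b - a) + L * measure lebesgue ({a..b} - T)"
proof -
  have L: "L \<ge> 0" using \<phi> by (simp add: lipschitz_on_def)
  define m where "m t = measure lebesgue ({a..t} - T)" for t
  \<comment> \<open>Subtracting the growth allowed on \<open>T\<close> and the growth allowed off
    \<open>T\<close> turns the claim into \<open>\<Phi> b \<le> \<Phi> a\<close>.\<close>
  define \<Phi> where "\<Phi> t = \<phi> t - c * (t - a) - L * m t" for t
  have meas: "{s..t} - T \<in> lmeasurable" "{s<..t} - T \<in> lmeasurable" for s t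
  proof -
    show 1: "{s..t} - T \<in> lmeasurable" using T by (auto intro!: fmeasurable_Diff)
    have "{s<..t} - T = ({s..t} - T) - {s}" by auto
    then show "{s<..t} - T \<in> lmeasurable" using 1 by (simp only:) (rule fmeasurable_Diff, auto)
  qed
  have m_add: "m t = m s + measure lebesgue ({s<..t} - T)" if "a \<le> s" "s \<le> t" for s t
  proof -
    have "{a..t} - T = ({a..s} - T) \<union> ({s<..t} - T)" using that by auto
    moreover have "({s<..t} - T) - ({a..s} - T) = {s<..t} - T" by auto
    ultimately show ?thesis unfolding m_def using measure_Un2[OF meas(1)[of a s] meas(2)[of s t]] by (simp only:)
  qed
  have m_le: "measure lebesgue ({s<..t} - T) \<le> t - s" if "s \<le> t" for s t
  proof -
    have "measure lebesgue ({s<..t} - T) \<le> measure lebesgue {s..t}"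
      by (rule measure_mono_fmeasurable) (use meas in auto)
    then show ?thesis using that by simp
  qed
  have \<Phi>_lip: "\<bar>\<Phi> t - \<Phi> s\<bar> \<le> (2 * L + c) * (t - s)" if "a \<le> s" "s \<le> t" for s t
  proof -
    have "\<bar>\<phi> t - \<phi> s\<bar> \<le> L * (t - s)" using lipschitz_on_realD[OF \<phi>, of t s] that by simp
    moreover have "0 \<le> L * measure lebesgue ({s<..t} - T)" "L * measure lebesgue ({s<..t} - T) \<le> L * (t - s)"
      using L m_le[OF that(2)] by (auto intro: mult_left_mono)
    moreover have "\<Phi> t - \<Phi> s = (\<phi> t - \<phi> s) - c * (t - s) - L * measure lebesgue ({s<..t} - T)"
      using m_add[OF that] by (simp add: \<Phi>_def algebra_simps)
    moreover have "0 \<le> c * (t - s)" using c that by simp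
    moreover have "(2 * L + c) * (t - s) = L * (t - s) + L * (t - s) + c * (t - s)" by (simp add: algebra_simps)
    ultimately show ?thesis by linarith
  qed
  have step: "\<exists>t>s. t \<le> b \<and> \<Phi> t \<le> \<Phi> s" if s: "a \<le> s" "s < b" for s
  proof (cases "\<exists>e>0. {s<..s + e} \<inter> T = {}")
    case True
    then obtain e where e: "e > 0" "{s<..s + e} \<inter> T = {}" by blast
    define t where "t = min b (s + e)"
    have t: "s < t" "t \<le> b" "t \<le> s + e" using s e by (auto simp: t_def)
    have "{s<..t} - T = {s<..t}" using e(2) t(3) by (auto simp: disjoint_iff)
    then have m_eq: "m t = m s + (t - s)" using m_add[of s t] s t by simp
    moreover have "\<bar>\<phi> t - \<phi> s\<bar> \<le> L * (t - s)" using lipschitz_on_realD[OF \<phi>, of t s] t by simp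
    moreover have "0 \<le> c * (t - s)" using c t by simp
    moreover have "\<Phi> t - \<Phi> s = (\<phi> t - \<phi> s) - c * (t - s) - L * (t - s)"
      unfolding \<Phi>_def m_eq by (simp add: algebra_simps)
    ultimately have "\<Phi> t \<le> \<Phi> s" by linarith
    then show ?thesis using t by blast
  next
    case False
    have sT: "s \<in> T"
    proof -
      have "s \<in> closure T"
        unfolding closure_approachable
      proof (intro allI impI)
        fix e :: real assume "e > 0"
        then obtain t where "t \<in> T" "s < t" "t \<le> s + e/2" using False by (auto dest!: spec[of _ "e/2"])
        then show "\<exists>y\<in>T. dist y s < e" using \<open>e > 0\<close> by (auto intro!: bexI[of _ t] simp: dist_real_def)
      qed
      then show ?thesis using T by simp
    qed
    obtain d where d: "d \<le> c'" "(\<gamma> has_real_derivative d) (at s)" using der[OF sT] by blast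
    have "\<forall>\<^sub>F t in at s. (\<gamma> t - \<gamma> s) / (t - s) < c"
      using order_tendstoD(2)[of "\<lambda>t. (\<gamma> t - \<gamma> s) / (t - s)" d] d c by (auto simp: has_field_derivative_iff)
    then obtain e where e: "e > 0" "\<And>t. t \<noteq> s \<Longrightarrow> dist t s < e \<Longrightarrow> (\<gamma> t - \<gamma> s) / (t - s) < c"
      unfolding eventually_at by auto
    define e' where "e' = min (e/2) (b - s)"
    have e': "e' > 0" "e' < e" "e' \<le> b - s" using e s by (auto simp: e'_def)
    have "{s<..s + e'} \<inter> T \<noteq> {}" using False e'(1) by blast
    then obtain t where t: "t \<in> T" "s < t" "t \<le> s + e'" by auto
    have "(\<gamma> t - \<gamma> s) / (t - s) < c" using e(2)[of t] t e' by (auto simp: dist_real_def)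
    then have "\<gamma> t - \<gamma> s \<le> c * (t - s)" using t by (simp add: pos_divide_less_eq less_imp_le)
    then have "\<phi> t - \<phi> s \<le> c * (t - s)" using eq t sT by simp
    moreover have "0 \<le> L * measure lebesgue ({s<..t} - T)" using L by simp
    ultimately have "\<Phi> t \<le> \<Phi> s" using m_add[of s t] s t by (simp add: \<Phi>_def algebra_simps)
    then show ?thesis using t e' by (intro exI[of _ t]) auto
  qed
  \<comment> \<open>Continuity of \<Phi> puts the supremum of this set into the set, and
    \<open>step\<close> then forbids it to be smaller than \<open>b\<close>.\<close>
  define S where "S = {t \<in> {a..b}. \<Phi> t \<le> \<Phi> a}"
  have aS: "a \<in> S" using ab by (simp add: S_def)
  have bdd: "bdd_above S" by (rule bdd_aboveI[of _ b]) (simp add: S_def)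
  define s where "s = Sup S"
  have "a \<le> s" unfolding s_def by (rule cSup_upper[OF aS bdd])
  moreover have "s \<le> b" unfolding s_def using aS by (intro cSup_least) (auto simp: S_def)
  ultimately have s: "a \<le> s" "s \<le> b" .
  have "\<Phi> s \<le> \<Phi> a"
  proof (rule field_le_epsilon)
    fix e :: real assume e: "e > 0"
    define K where "K = 2 * L + c + 1"
    have K: "K > 0" using L c by (simp add: K_def add_nonneg_pos)
    have "s - e / K < s" using e K by simp
    then obtain t where t: "t \<in> S" "s - e / K < t" using less_cSup_iff[of S] aS bdd unfolding s_def by blast
    have ts: "t \<le> s" using cSup_upper[OF t(1) bdd] by (simp add: s_def)
    have "\<Phi> s - \<Phi> t \<le> (2 * L + c) * (s - t)" using \<Phi>_lip[of t s] ts t(1) by (auto simp: S_def)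
    also have "\<dots> \<le> K * (s - t)" using ts by (intro mult_right_mono) (auto simp: K_def)
    also have "\<dots> \<le> K * (e / K)" using t(2) K by (intro mult_left_mono) auto
    also have "\<dots> = e" using K by simp
    finally show "\<Phi> s \<le> \<Phi> a + e" using t(1) by (simp add: S_def)
  qed
  have "s = b"
  proof (rule ccontr)
    assume "s \<noteq> b"
    then obtain t where "t > s" "t \<le> b" "\<Phi> t \<le> \<Phi> s" using step[of s] s by auto
    then have "t \<in> S" using s \<open>\<Phi> s \<le> \<Phi> a\<close> by (auto simp: S_def)
    then show False using cSup_upper[OF _ bdd, of t] \<open>t > s\<close> by (simp add: s_def)
  qed
  then have "\<Phi> b \<le> \<Phi> a" using \<open>\<Phi> s \<le> \<Phi> a\<close> by simp
  moreover have "m a = 0"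
  proof -
    have "negligible ({a..a} - T)" by (rule negligible_subset[of "{a}"]) auto
    then show ?thesis unfolding m_def by (rule negligible_imp_measure0)
  qed
  ultimately show ?thesis by (simp add: \<Phi>_def m_def)
qed

text \<open>On a segment lying mostly in \<open>B\<close>, every distance function grows at a rate
  below \<open>c\<close>. The distance to a centre \<open>X j\<close> very close to
  \<open>f p\<close>, however, grows almost as much as the distance from \<open>f p\<close>, which
  is at least \<open>c\<close> times the length.\<close>

lemma negligible_small_distance_slopes:
  fixes f :: "'a::euclidean_space \<Rightarrow> 'x::metric_space" and u g :: "'j \<Rightarrow> 'a \<Rightarrow> real"
  assumes B: "compact B" and c: "c > 0" and r: "r > 0"
    and u: "\<And>j. j \<in> J \<Longrightarrow> L-lipschitz_on UNIV (u j)"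
    and uX: "\<And>j p. j \<in> J \<Longrightarrow> p \<in> B \<Longrightarrow> u j p = dist (f p) (X j)"
    and dense: "\<And>p \<tau>. p \<in> B \<Longrightarrow> \<tau> > 0 \<Longrightarrow> \<exists>j\<in>J. dist (f p) (X j) < \<tau>"
    and gu: "\<And>j p. j \<in> J \<Longrightarrow> p \<in> B \<Longrightarrow> g j p = u j p"
    and dg: "\<And>j p. j \<in> J \<Longrightarrow> p \<in> B \<Longrightarrow> (g j has_derivative g' j p) (at p)"
    and small: "\<And>j p. j \<in> J \<Longrightarrow> p \<in> B \<Longrightarrow> g' j p v \<le> c / 2"
    and large: "\<And>p t. p \<in> B \<Longrightarrow> 0 < t \<Longrightarrow> t < r \<Longrightarrow> p + t *\<^sub>R v \<in> B \<Longrightarrow> c * t \<le> dist (f (p + t *\<^sub>R v)) (f p)"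
  shows "negligible B"
proof (rule ccontr)
  assume nB: "\<not> negligible B"
  have Bb: "B \<in> sets borel" using B by (simp add: borel_compact)
  have cont: "continuous_on UNIV (\<lambda>w. x + w *\<^sub>R v)" for x :: 'a by (intro continuous_intros)
  have Tcl: "closed {w. x + w *\<^sub>R v \<in> B}" for x
    using continuous_closed_vimage[OF compact_imp_closed[OF B], of "\<lambda>w. x + w *\<^sub>R v"] cont[of x]
    by (simp add: vimage_def continuous_on_eq_continuous_at)
  have "\<exists>x. \<not> negligible {w. x + w *\<^sub>R v \<in> B}"
  proof (rule ccontr)
    assume "\<not> ?thesis"
    then have "AE x in lborel. {w. x + w *\<^sub>R v \<in> B} \<in> null_sets lborel"
      using Tcl by (intro always_eventually allI) (auto simp: negligible_iff_null_sets_lborel)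
    then have "B \<in> null_sets lborel"
      using null_sets_lborel_iff_AE_slices[OF Bb, of "\<lambda>w. w *\<^sub>R v"] by (simp add: continuous_intros)
    then show False using nB Bb by (simp add: negligible_iff_null_sets_lborel)
  qed
  then obtain x where x: "\<not> negligible {w. x + w *\<^sub>R v \<in> B}" by blast
  let ?T = "{w. x + w *\<^sub>R v \<in> B}"
  have "B \<noteq> {}" using nB by auto
  then obtain j0 where j0: "j0 \<in> J" using dense[of _ 1] by auto
  have L: "L \<ge> 0" using u[OF j0] by (simp add: lipschitz_on_def)
  define M where "M = L * norm v"
  have M: "M \<ge> 0" using L by (simp add: M_def)
  \<comment> \<open>Chosen so that the part of the segment outside \<open>B\<close> contributes at
    most \<open>c / 8\<close> per unit length, whatever the centre.\<close>
  define \<eta> where "\<eta> = c / (8 * (M + 1))"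
  have \<eta>: "\<eta> > 0" using c M by (simp add: \<eta>_def)
  have "\<eta> * (8 * (M + 1)) = c" using M by (simp add: \<eta>_def)
  then have M\<eta>: "M * \<eta> \<le> c / 8" using \<eta> by (simp add: algebra_simps)
  obtain \<alpha> \<beta> where ab: "\<alpha> \<in> ?T" "\<beta> \<in> ?T" "\<alpha> < \<beta>" "\<beta> - \<alpha> < r" "measure lebesgue ({\<alpha>..\<beta>} - ?T) \<le> \<eta> * (\<beta> - \<alpha>)"
    using nonnegligible_dense_interval[OF Tcl x \<eta> r] by blast
  define p where "p = x + \<alpha> *\<^sub>R v"
  have p: "p \<in> B" "p + (\<beta> - \<alpha>) *\<^sub>R v = x + \<beta> *\<^sub>R v" using ab by (auto simp: p_def algebra_simps)
  have lo: "c * (\<beta> - \<alpha>) \<le> dist (f (x + \<beta> *\<^sub>R v)) (f p)" using large[of p "\<beta> - \<alpha>"] ab p by simp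
  \<comment> \<open>The tolerance enters twice through the triangle inequality. With
    \<open>3/4\<close> and \<open>1/8\<close> from the growth estimate the total is
    \<open>7/8 + 1/16\<close>, still below 1.\<close>
  have "c * (\<beta> - \<alpha>) / 32 > 0" using c ab by simp
  then obtain j where j: "j \<in> J" "dist (f p) (X j) < c * (\<beta> - \<alpha>) / 32" using dense[OF p(1)] by blast
  define \<phi> where "\<phi> w = u j (x + w *\<^sub>R v)" for w
  define \<gamma> where "\<gamma> w = g j (x + w *\<^sub>R v)" for w
  have "\<phi> \<beta> - \<phi> \<alpha> \<le> (3/4 * c) * (\<beta> - \<alpha>) + M * measure lebesgue ({\<alpha>..\<beta>} - ?T)"
  proof (rule lipschitz_increment_le[OF _ Tcl, where c' = "c/2" and \<gamma> = \<gamma>])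
    show "M-lipschitz_on UNIV \<phi>"
    proof (rule lipschitz_onI[OF _ M])
      fix s t
      have "dist (\<phi> s) (\<phi> t) \<le> L * dist (x + s *\<^sub>R v) (x + t *\<^sub>R v)"
        unfolding \<phi>_def by (rule lipschitz_onD[OF u[OF j(1)]]) auto
      also have "dist (x + s *\<^sub>R v) (x + t *\<^sub>R v) = dist s t * norm v"
        by (simp add: dist_norm flip: scaleR_left_diff_distrib)
      finally show "dist (\<phi> s) (\<phi> t) \<le> M * dist s t" by (simp add: M_def mult_ac)
    qed
    fix t assume t: "t \<in> ?T"
    show "\<gamma> t = \<phi> t" using gu[OF j(1)] t by (simp add: \<gamma>_def \<phi>_def)
    let ?q = "x + t *\<^sub>R v"
    have q: "?q \<in> B" using t by simp
    interpret bl: bounded_linear "g' j ?q" using dg[OF j(1) q] by (rule has_derivative_bounded_linear)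
    have "((\<lambda>w. x + w *\<^sub>R v) has_derivative (\<lambda>h. h *\<^sub>R v)) (at t)" by (auto intro!: derivative_eq_intros)
    from has_derivative_compose[OF this dg[OF j(1) q]]
    have "(\<gamma> has_derivative (\<lambda>h. g' j ?q (h *\<^sub>R v))) (at t)" by (simp add: \<gamma>_def[abs_def])
    moreover have "(\<lambda>h. g' j ?q (h *\<^sub>R v)) = (*) (g' j ?q v)" by (rule ext) (simp add: bl.scaleR mult.commute)
    ultimately have "(\<gamma> has_real_derivative g' j ?q v) (at t)"
      by (simp add: has_field_derivative_def)
    then show "\<exists>d\<le>c/2. (\<gamma> has_real_derivative d) (at t)" using small[OF j(1) q] by blast
  qed (use c ab in auto)
  also have "M * measure lebesgue ({\<alpha>..\<beta>} - ?T) \<le> M * (\<eta> * (\<beta> - \<alpha>))" using ab(5) M by (rule mult_left_mono)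
  also have "\<dots> = (M * \<eta>) * (\<beta> - \<alpha>)" by simp
  also have "\<dots> \<le> c / 8 * (\<beta> - \<alpha>)" using M\<eta> ab by (intro mult_right_mono) auto
  finally have up: "\<phi> \<beta> - \<phi> \<alpha> \<le> (3/4 * c) * (\<beta> - \<alpha>) + c / 8 * (\<beta> - \<alpha>)" by simp
  have "\<phi> \<beta> = dist (f (x + \<beta> *\<^sub>R v)) (X j)" "\<phi> \<alpha> = dist (f p) (X j)"
    using uX[OF j(1)] ab by (auto simp: \<phi>_def p_def)
  then have "\<phi> \<beta> - \<phi> \<alpha> \<ge> dist (f (x + \<beta> *\<^sub>R v)) (f p) - 2 * dist (f p) (X j)"
    using dist_triangle[of "f (x + \<beta> *\<^sub>R v)" "f p" "X j"] by (simp add: dist_commute)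
  moreover have "(3/4 * c) * (\<beta> - \<alpha>) + c / 8 * (\<beta> - \<alpha>) = 7/8 * (c * (\<beta> - \<alpha>))" by simp
  moreover have "c * (\<beta> - \<alpha>) > 0" using c ab by simp
  ultimately show False using up lo j(2) by linarith
qed

text \<open>Otherwise \<open>B - Z\<close> would be locally negligible, and local negligibility
  implies negligibility.\<close>

lemma nonnegligible_density_centre:
  fixes B :: "'a::euclidean_space set"
  assumes "\<not> negligible (B - Z)" 
  obtains p where "p \<in> B" "p \<notin> Z" "\<And>e. e > 0 \<Longrightarrow> \<not> negligible (B \<inter> ball p e)"
proof (rule ccontr)
  assume neg: "\<not> thesis"
  note centre = that
  have ex: "\<exists>e>0. negligible (B \<inter> ball p e)" if p: "p \<in> B" "p \<notin> Z" for p
  proof (rule ccontr)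
    assume "\<not> ?thesis"
    then have thesis by (intro centre[OF p]) auto
    with neg show False ..
  qed
  have "negligible (B - Z)"
  proof (rule iffD2[OF locally_negligible_alt], rule ballI)
    fix p assume p: "p \<in> B - Z"
    then obtain e where e: "e > 0" "negligible (B \<inter> ball p e)" using ex[of p] by auto
    have "openin (top_of_set (B - Z)) ((B - Z) \<inter> ball p e)" by (simp add: openin_open_Int)
    moreover have "negligible ((B - Z) \<inter> ball p e)" by (rule negligible_subset[OF e(2)]) auto
    ultimately show "\<exists>U. openin (top_of_set (B - Z)) U \<and> p \<in> U \<and> negligible U"
      using p e(1) by (intro exI[of _ "(B - Z) \<inter> ball p e"]) auto
  qed
  then show False using assms by simp
qed

text \<open>The exceptional sets together take at most half of the measure of \<open>B\<close>, so a
  single nonnull compact set serves all indices.\<close>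

lemma C1_lusin_sequence:
  fixes u :: "nat \<Rightarrow> 'a::euclidean_space \<Rightarrow> real"
  assumes B: "compact B" "\<not> negligible B" and L: "L > 0" and u: "\<And>n. L-lipschitz_on UNIV (u n)"
  obtains g K where "\<And>n. C1_map (g n)" "\<And>n. (2 * L)-lipschitz_on UNIV (g n)" "compact K" "K \<subseteq> B" "\<not> negligible K"
    "\<And>n x. x \<in> K \<Longrightarrow> g n x = u n x"
proof -
  have Bm: "B \<in> lmeasurable" using B(1) by (rule lmeasurable_compact)
  define \<mu> where "\<mu> = measure lebesgue B"
  have \<mu>: "\<mu> > 0" using B(2) Bm by (simp add: \<mu>_def negligible_iff_measure0 zero_less_measure_iff)
  have "\<exists>g T. C1_map g \<and> (2 * L)-lipschitz_on UNIV g \<and> T \<in> lmeasurable \<and> measure lebesgue T < \<mu> / 2 ^ (n + 2) \<and> (\<forall>x\<in>B - T. u n x = g x)" for n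
  proof -
    have "\<mu> / 2 ^ (n + 2) > 0" using \<mu> by simp
    from lipschitz_C1_lusin[OF lipschitz_on_subset[OF u[of n] subset_UNIV] L compact_imp_bounded[OF B(1)] this]
    show ?thesis by metis
  qed
  then obtain g T where g: "\<And>n. C1_map (g n)" "\<And>n. (2 * L)-lipschitz_on UNIV (g n)"
    and T: "\<And>n. T n \<in> lmeasurable" "\<And>n. measure lebesgue (T n) < \<mu> / 2 ^ (n + 2)"
    and gu: "\<And>n x. x \<in> B - T n \<Longrightarrow> u n x = g n x" by metis
  let ?T = "\<Union>k. T k"
  have T': "?T \<in> lmeasurable" "measure lebesgue ?T \<le> \<mu> / 2"
    using measure_UN_geometric_le[OF T] \<mu> by auto
  have "\<not> negligible (B - ?T)"
  proof
    assume n: "negligible (B - ?T)"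
    have "measure lebesgue B \<le> measure lebesgue (?T \<union> (B - ?T))"
      by (rule measure_mono_fmeasurable) (use Bm T'(1) in \<open>auto intro!: fmeasurable.Un fmeasurable_Diff\<close>)
    also have "\<dots> = measure lebesgue ?T"
      using n T'(1) by (simp only: fmeasurableD measure_Un_null_set negligible_iff_null_sets)
    finally show False using T'(2) \<mu> by (simp add: \<mu>_def)
  qed
  moreover have "B - ?T \<in> sets lebesgue" using Bm T'(1) by (auto intro!: sets.Diff)
  ultimately obtain K where K: "compact K" "K \<subseteq> B - ?T" "\<not> negligible K"
    using lebesgue_inner_compact_nonnegligible by metis
  show ?thesis
  proof (rule that[OF g K(1) _ K(3)])
    show "K \<subseteq> B" using K(2) by blast
    show "g n x = u n x" if "x \<in> K" for n x using gu[of x n] K(2) that by auto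
  qed
qed

section \<open>Selection of independent gradients\<close>

lemma real_functional_inner:
  fixes F :: "'a::euclidean_space \<Rightarrow>\<^sub>L real"
  shows "blinfun_apply F h = (\<Sum>i\<in>Basis. blinfun_apply F i *\<^sub>R i) \<bullet> h"
proof -
  have "blinfun_apply F h = blinfun_apply F (\<Sum>i\<in>Basis. (h \<bullet> i) *\<^sub>R i)" by (simp add: euclidean_representation)
  also have "\<dots> = (\<Sum>i\<in>Basis. (h \<bullet> i) * blinfun_apply F i)" by (simp add: blinfun.sum_right blinfun.scaleR_right)
  also have "\<dots> = (\<Sum>i\<in>Basis. blinfun_apply F i *\<^sub>R i) \<bullet> h"
    by (simp add: inner_sum_left inner_commute[of h] mult.commute)
  finally show ?thesis .
qed

text \<open>The orthogonal complement of the span of all \<open>a n\<close> lies in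
  \<open>N\<close>. Hence the span has dimension at least the codimension of \<open>N\<close>, and a
  basis drawn from the family contains enough vectors.\<close>

lemma independent_selection:
  fixes a :: "nat \<Rightarrow> 'a::euclidean_space"
  assumes sub: "\<And>v. (\<And>n. a n \<bullet> v = 0) \<Longrightarrow> v \<in> N" and N: "DIM('a) - dim N = CARD('m::finite)"
  obtains i :: "'m::finite \<Rightarrow> nat" where "inj (a \<circ> i)" "independent (range (a \<circ> i))"
proof -
  let ?S = "span (range a)"
  have "{y. \<forall>x\<in>?S. orthogonal x y} \<subseteq> N"
  proof
    fix y assume "y \<in> {y. \<forall>x\<in>?S. orthogonal x y}"
    then have "a n \<bullet> y = 0" for n by (auto simp: orthogonal_def span_base)
    then show "y \<in> N" by (rule sub)
  qed
  then have "dim {y. \<forall>x\<in>?S. orthogonal x y} \<le> dim N" by (rule dim_subset)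
  moreover have "dim {y \<in> UNIV. \<forall>x\<in>?S. orthogonal x y} + dim ?S = dim (UNIV :: 'a set)"
    by (rule dim_subspace_orthogonal_to_vectors) auto
  ultimately have dimS: "CARD('m) \<le> dim (range a)" using N by simp
  obtain C where C: "C \<subseteq> range a" "independent C" "range a \<subseteq> span C" "card C = dim (range a)"
    using basis_exists[of "range a"] by blast
  obtain D where D: "D \<subseteq> C" "card D = CARD('m)" using obtain_subset_with_card_n[of "CARD('m)" C] dimS C(4) by metis
  have "finite D" using D(2) by (metis card.infinite zero_less_card_finite less_irrefl)
  then obtain h :: "'m \<Rightarrow> 'a" where h: "bij_betw h UNIV D"
    using finite_same_card_bij[of "UNIV :: 'm set" D] D(2) by auto
  have "h x \<in> range a" for x using bij_betwE[OF h] D(1) C(1) by blast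
  then have "\<exists>n. a n = h x" for x by (metis rangeE)
  then obtain i where i: "\<And>x. a (i x) = h x" by metis
  have eq: "a \<circ> i = h" using i by auto
  show ?thesis
  proof (rule that)
    show "inj (a \<circ> i)" unfolding eq using h by (simp add: bij_betw_def)
    show "independent (range (a \<circ> i))" unfolding eq bij_betw_imp_surj_on[OF h] by (rule independent_mono[OF C(2) D(1)])
  qed
qed

text \<open>Centres and gradients are fixed before \<delta>: the admissible \<delta> will later
  depend on a linear map built from \<open>a\<close>. Only the compact set shrinks with \<delta>,
  around a point where the gradients are continuous.\<close>

theorem exists_independent_distance_gradients:
  fixes f :: "'a::euclidean_space \<Rightarrow> 'x::metric_space"
  assumes B: "B \<in> sets lebesgue" "B \<subseteq> A" "\<not> negligible B"
    and f: "L-lipschitz_on A f" and L: "L > 0"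
    and md: "\<And>p. p \<in> B \<Longrightarrow> \<exists>\<sigma>. has_approx_metric_derivative f A p \<sigma> \<and> seminorm_rank \<sigma> = CARD('m::finite)"
  obtains X :: "'m::finite \<Rightarrow> 'x" and a :: "'m \<Rightarrow> 'a" where "inj a" "independent (range a)"
    "\<And>\<delta>. \<delta> > 0 \<Longrightarrow> \<exists>K. compact K \<and> K \<subseteq> B \<and> \<not> negligible K \<and> (\<forall>i. \<delta>-lipschitz_on K (\<lambda>p. dist (f p) (X i) - a i \<bullet> p))"
proof -
  obtain B1 where B1: "compact B1" "B1 \<subseteq> B" "\<not> negligible B1"
    using lebesgue_inner_compact_nonnegligible[OF B(1,3)] by blast
  obtain D where D: "countable D" "D \<subseteq> B1" "B1 \<subseteq> closure D" using separable[of B1] by metis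
  have "B1 \<noteq> {}" using B1(3) by auto
  then have "D \<noteq> {}" using D(3) by auto
  define d where "d = from_nat_into D"
  have d: "range d = D" using D(1) \<open>D \<noteq> {}\<close> by (simp add: d_def range_from_nat_into)
  have dA: "d n \<in> A" for n using d D(2) B1(2) B(2) by blast
  have "\<exists>w. L-lipschitz_on UNIV w \<and> (\<forall>p\<in>A. w p = dist (f p) (f (d n)))" for n
  proof -
    have "L-lipschitz_on A (\<lambda>p. dist (f p) (f (d n)))"
    proof (rule lipschitz_onI)
      fix x y assume "x \<in> A" "y \<in> A"
      then have "dist (f x) (f y) \<le> L * dist x y" by (rule lipschitz_onD[OF f])
      moreover have "\<bar>dist (f x) (f (d n)) - dist (f y) (f (d n))\<bar> \<le> dist (f x) (f y)"
        using dist_triangle[of "f x" "f (d n)" "f y"] dist_triangle[of "f y" "f (d n)" "f x"] by (simp add: abs_le_iff dist_commute)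
      ultimately show "dist (dist (f x) (f (d n))) (dist (f y) (f (d n))) \<le> L * dist x y" by (simp add: dist_real_def)
    qed (use L in simp)
    then show ?thesis by (rule lipschitz_on_real_extension) blast
  qed
  then obtain u where u: "\<And>n. L-lipschitz_on UNIV (u n)" and uA: "\<And>n p. p \<in> A \<Longrightarrow> u n p = dist (f p) (f (d n))" by metis
  obtain g B2 where g: "\<And>n. C1_map (g n)" "\<And>n. (2 * L)-lipschitz_on UNIV (g n)"
    and B2: "compact B2" "B2 \<subseteq> B1" "\<not> negligible B2" and gu: "\<And>n x. x \<in> B2 \<Longrightarrow> g n x = u n x"
    by (rule C1_lusin_sequence[where u = u, OF B1(1,3) L u], rule that)
  obtain g' where g': "\<And>n x. (g n has_derivative blinfun_apply (g' n x)) (at x)" "\<And>n. continuous_on UNIV (g' n)"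
    using g(1) unfolding C1_map_def by metis
  have B2A: "B2 \<subseteq> A" using B2(2) B1(2) B(2) by blast
  have fcont: "continuous_on B2 f" using lipschitz_on_continuous_on[OF f] B2A continuous_on_subset by blast
  have dense: "\<exists>n. dist (f p) (f (d n)) < \<tau>" if p: "p \<in> B2" and \<tau>: "\<tau> > 0" for p \<tau>
  proof -
    have "p \<in> closure D" using p B2(2) D(3) by blast
    moreover have "\<tau> / L > 0" using \<tau> L by simp
    ultimately obtain q where q: "q \<in> D" "dist q p < \<tau> / L" unfolding closure_approachable by blast
    then obtain n where n: "q = d n" using d by blast
    have "dist (f p) (f (d n)) \<le> L * dist p (d n)" using lipschitz_onD[OF f, of p "d n"] p B2A dA by auto
    also have "\<dots> < \<tau>" using q(2) L n by (simp add: pos_less_divide_eq dist_commute mult.commute)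
    finally show ?thesis by blast
  qed
  have g'b: "\<bar>blinfun_apply (g' n p) h\<bar> \<le> 2 * L * norm h" for n p h
    using lipschitz_derivative_bound[OF g(2) g'(1)] by simp
  \<comment> \<open>Outside \<open>Z\<close>, a vector annihilated by all gradients has seminorm
    zero. Both \<open>v\<close> and \<sigma> depend on \<open>p\<close>, so \<open>Z\<close> is
    covered by sets \<open>W\<close> with fixed data.\<close>
  define Z where "Z = {p \<in> B2. \<exists>v. (\<forall>n. blinfun_apply (g' n p) v = 0) \<and> (\<exists>\<sigma>. has_approx_metric_derivative f A p \<sigma> \<and> \<sigma> v > 0)}"
  obtain V :: "'a set" where V: "countable V" "\<And>U. open U \<Longrightarrow> U \<noteq> {} \<Longrightarrow> \<exists>v\<in>V. v \<in> U"
    using countable_dense_setE by metis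
  \<comment> \<open>A closed condition free of seminorms and density sets: \<open>c\<close> is the
    growth rate of \<open>f\<close> along \<open>v\<close>, and \<open>r\<close> bounds both the
    scale and the opening of the cone. The disjunction of two weak inequalities keeps it
    closed.\<close>
  define W where "W v c r = {p \<in> B2. (\<forall>n. blinfun_apply (g' n p) v \<le> c / 2) \<and>
      (\<forall>t y. 0 < t \<and> t < r \<and> y \<in> B2 \<longrightarrow> r * t \<le> dist y (p + t *\<^sub>R v) \<or> c * t \<le> dist (f y) (f p))}" for v c r
  have Wneg: "negligible (W v c r)" if "c > 0" "r > 0" for v c r
  proof -
    have c1: "closed {p \<in> B2. blinfun_apply (g' n p) v \<le> c / 2}" for n
      by (intro continuous_on_closed_Collect_le continuous_intros compact_imp_closed B2(1)
          continuous_on_subset[OF g'(2)]) auto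
    have c2: "closed ({p \<in> B2. r * t \<le> dist y (p + t *\<^sub>R v)} \<union> {p \<in> B2. c * t \<le> dist (f y) (f p)})" for t y
      by (intro closed_Un continuous_on_closed_Collect_le continuous_intros compact_imp_closed B2(1) fcont)
    have "W v c r = B2 \<inter> (\<Inter>n. {p \<in> B2. blinfun_apply (g' n p) v \<le> c / 2}) \<inter>
      (\<Inter>(t, y)\<in>{(t, y). 0 < t \<and> t < r \<and> y \<in> B2}. {p \<in> B2. r * t \<le> dist y (p + t *\<^sub>R v)} \<union> {p \<in> B2. c * t \<le> dist (f y) (f p)})"
      unfolding W_def by auto
    also have "compact \<dots>"
      unfolding Int_assoc by (intro compact_Int_closed B2(1) closed_Int closed_INT ballI) (use c1 c2 in auto)
    finally have cW: "compact (W v c r)" .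
    show ?thesis
    proof (rule negligible_small_distance_slopes[OF cW that, where J = UNIV and u = u and g = g and f = f and X = "\<lambda>n. f (d n)"])
      show "(g n has_derivative blinfun_apply (g' n p)) (at p)" for n p by (rule g'(1))
      fix p assume p: "p \<in> W v c r"
      then have pB: "p \<in> B2" by (simp add: W_def)
      show "u n p = dist (f p) (f (d n))" for n using uA pB B2A by blast
      show "\<exists>j\<in>UNIV. dist (f p) (f (d j)) < \<tau>" if "\<tau> > 0" for \<tau> using dense[OF pB that] by blast
      show "g n p = u n p" for n using gu pB by blast
      show "blinfun_apply (g' n p) v \<le> c / 2" for n using p by (simp add: W_def)
      fix t :: real assume t: "0 < t" "t < r" and y: "p + t *\<^sub>R v \<in> W v c r"
      then have "p + t *\<^sub>R v \<in> B2" by (simp add: W_def)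
      \<comment> \<open>On the ray itself the distance to the ray is zero, so the first alternative
        in \<open>W\<close> fails and the growth bound remains.\<close>
      moreover have "\<not> r * t \<le> dist (p + t *\<^sub>R v) (p + t *\<^sub>R v)" using t that by (simp add: not_le)
      ultimately show "c * t \<le> dist (f (p + t *\<^sub>R v)) (f p)" using p t unfolding W_def by blast
    qed (rule u)
  qed
  have "negligible (\<Union>(v, k, l)\<in>V \<times> (UNIV :: nat set) \<times> (UNIV :: nat set). W v (1 / Suc k) (1 / Suc l))"
  proof (rule negligible_countable_Union)
    show "countable ((\<lambda>(v, k, l). W v (1 / real (Suc k)) (1 / real (Suc l))) ` (V \<times> UNIV \<times> UNIV))"
      by (intro countable_image countable_SIGMA V(1) countableI_type)
  next
    fix S assume "S \<in> (\<lambda>(v, k, l). W v (1 / real (Suc k)) (1 / real (Suc l))) ` (V \<times> UNIV \<times> UNIV)"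
    then show "negligible S" using Wneg by auto
  qed
  moreover have "Z \<subseteq> (\<Union>(v, k, l)\<in>V \<times> (UNIV :: nat set) \<times> (UNIV :: nat set). W v (1 / Suc k) (1 / Suc l))"
  proof
    fix p assume "p \<in> Z"
    then obtain v \<sigma> where p: "p \<in> B2" and v: "\<And>n. blinfun_apply (g' n p) v = 0" and \<sigma>: "has_approx_metric_derivative f A p \<sigma>" "\<sigma> v > 0"
      unfolding Z_def by blast
    have sn: "is_seminorm \<sigma>" using \<sigma>(1) by (simp add: has_approx_metric_derivative_def)
    obtain C where C: "C > 0" "\<And>v. \<sigma> v \<le> C * norm v" using is_seminorm_bounded[OF sn] by blast
    obtain k :: nat where k: "1 / Suc k < \<sigma> v / 2" using nat_approx_posE[of "\<sigma> v / 2"] \<sigma>(2) by auto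
    define c where "c = 1 / real (Suc k)"
    have c: "c > 0" "c < \<sigma> v / 2" using k by (auto simp: c_def)
    \<comment> \<open>The first term keeps \<open>\<sigma> v'\<close> above
      \<open>\<sigma> v / 2\<close> and hence above \<open>c\<close>; the second keeps the slopes at
      \<open>v'\<close> below \<open>c / 2\<close>, the gradients having norm at most
      \<open>2 * L\<close>.\<close>
    define e where "e = min (\<sigma> v / (2 * C)) (c / (4 * L))"
    have e: "e > 0" using \<sigma>(2) C c L by (simp add: e_def)
    obtain v' where v': "v' \<in> V" "dist v v' < e" using V(2)[of "ball v e"] e by auto
    have nv': "norm (v - v') < \<sigma> v / (2 * C)" "norm (v - v') < c / (4 * L)" using v' by (auto simp: e_def dist_norm)
    have "\<sigma> v - \<sigma> v' \<le> C * norm (v - v')" using is_seminorm_diff[OF sn, of v v'] C(2)[of "v - v'"] by linarith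
    also have "\<dots> < \<sigma> v / 2" using nv'(1) C(1) by (simp add: pos_less_divide_eq algebra_simps)
    finally have cv': "c < \<sigma> v'" using c by linarith
    have small: "blinfun_apply (g' n p) v' \<le> c / 2" for n
    proof -
      have "\<bar>blinfun_apply (g' n p) (v' - v)\<bar> \<le> 2 * L * norm (v' - v)" by (rule g'b)
      also have "\<dots> \<le> c / 2" using nv'(2) L by (simp add: pos_less_divide_eq norm_minus_commute algebra_simps)
      finally show ?thesis using v by (simp add: blinfun.diff_right)
    qed
    have pA: "p \<in> A" using p B2A by blast
    obtain r \<kappa> where r: "r > 0" "\<kappa> > 0"
      "\<And>t y. 0 < t \<Longrightarrow> t < r \<Longrightarrow> y \<in> A \<Longrightarrow> dist y (p + t *\<^sub>R v') \<le> \<kappa> * t \<Longrightarrow> c * t \<le> dist (f y) (f p)"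
      using has_approx_metric_derivative_cone_lower_bound[OF \<sigma>(1) f pA _ cv'] c by auto
    obtain l :: nat where l: "1 / Suc l < min r \<kappa>" using nat_approx_posE[of "min r \<kappa>"] r by auto
    have "p \<in> W v' c (1 / Suc l)"
      unfolding W_def
    proof (intro CollectI conjI allI impI p small)
      fix t y assume ty: "0 < t \<and> t < 1 / real (Suc l) \<and> y \<in> B2"
      show "1 / real (Suc l) * t \<le> dist y (p + t *\<^sub>R v') \<or> c * t \<le> dist (f y) (f p)"
      proof (rule disjCI)
        assume "\<not> c * t \<le> dist (f y) (f p)"
        moreover have "t < r" "y \<in> A" using ty l B2A by auto
        ultimately have "\<kappa> * t < dist y (p + t *\<^sub>R v')" using r(3)[of t y] ty not_less by blast
        moreover have "1 / real (Suc l) * t \<le> \<kappa> * t" using l ty by (intro mult_right_mono) auto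
        ultimately show "1 / real (Suc l) * t \<le> dist y (p + t *\<^sub>R v')" by linarith
      qed
    qed
    then show "p \<in> (\<Union>(v, k, l)\<in>V \<times> (UNIV :: nat set) \<times> (UNIV :: nat set). W v (1 / Suc k) (1 / Suc l))"
      using v'(1) by (auto simp: c_def)
  qed
  ultimately have "negligible Z" by (rule negligible_subset)
  then have "\<not> negligible (B2 - Z)"
    using B2(3) negligible_subset[OF negligible_Un[of Z "B2 - Z"], of B2] by blast
  then obtain p0 where p0: "p0 \<in> B2" "p0 \<notin> Z" "\<And>e. e > 0 \<Longrightarrow> \<not> negligible (B2 \<inter> ball p0 e)"
    using nonnegligible_density_centre by metis
  obtain \<sigma> where \<sigma>: "has_approx_metric_derivative f A p0 \<sigma>" "seminorm_rank \<sigma> = CARD('m)"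
    using md p0(1) B2(2) B1(2) by blast
  have sn: "is_seminorm \<sigma>" using \<sigma>(1) by (simp add: has_approx_metric_derivative_def)
  define a where "a n = (\<Sum>i\<in>Basis. blinfun_apply (g' n p0) i *\<^sub>R i)" for n
  have a: "blinfun_apply (g' n p0) h = a n \<bullet> h" for n h unfolding a_def by (rule real_functional_inner)
  obtain i :: "'m \<Rightarrow> nat" where i: "inj (a \<circ> i)" "independent (range (a \<circ> i))"
  proof (rule independent_selection[of a "{v. \<sigma> v = 0}"])
    fix v assume "\<And>n. a n \<bullet> v = 0"
    then have "\<not> \<sigma> v > 0" using p0(1,2) \<sigma>(1) unfolding Z_def a[symmetric] by blast
    then show "v \<in> {v. \<sigma> v = 0}" using is_seminormD(1)[OF sn, of v] by simp
  next
    show "DIM('a) - dim {v. \<sigma> v = 0} = CARD('m)" using \<sigma>(2) by (simp add: seminorm_rank_def)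
  qed
  show ?thesis
  proof (rule that[OF i, of "\<lambda>x. f (d (i x))"])
    fix \<delta> :: real assume \<delta>: "\<delta> > 0"
    have "\<forall>\<^sub>F p in nhds p0. \<forall>x. dist (g' (i x) p) (g' (i x) p0) < \<delta>"
    proof (rule eventually_all_finite)
      fix x
      have "isCont (g' (i x)) p0" using g'(2) by (simp add: continuous_on_eq_continuous_at)
      then have "((g' (i x)) \<longlongrightarrow> g' (i x) p0) (nhds p0)" by (simp add: isCont_def tendsto_at_iff_tendsto_nhds)
      then show "\<forall>\<^sub>F p in nhds p0. dist (g' (i x) p) (g' (i x) p0) < \<delta>" using \<delta> by (rule tendstoD)
    qed
    then obtain e where e: "e > 0" "\<And>p x. dist p p0 < e \<Longrightarrow> dist (g' (i x) p) (g' (i x) p0) < \<delta>"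
      unfolding eventually_nhds_metric by blast
    let ?K = "B2 \<inter> cball p0 (e/2)"
    have "B2 \<inter> ball p0 (e/2) \<subseteq> ?K" using ball_subset_cball by blast
    then have "\<not> negligible ?K"
      using p0(3)[of "e/2"] e(1) negligible_subset[of ?K "B2 \<inter> ball p0 (e/2)"] by auto
    moreover have "compact ?K" using B2(1) by (simp add: compact_Int_closed)
    moreover have "\<delta>-lipschitz_on ?K (\<lambda>p. dist (f p) (f (d (i x))) - (a \<circ> i) x \<bullet> p)" for x
    proof (rule lipschitz_onI)
      fix p q assume p: "p \<in> ?K" and q: "q \<in> ?K"
      \<comment> \<open>The mean value estimate is made for the extended function
        \<open>g (i x)\<close> on the convex ball, since \<open>?K\<close> need not be
        convex.\<close>
      let ?h = "\<lambda>p. g (i x) p - a (i x) \<bullet> p"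
      have "norm (?h p - ?h q) \<le> \<delta> * norm (p - q)"
      proof (rule differentiable_bound[of "cball p0 (e/2)" ?h "\<lambda>p. blinfun_apply (g' (i x) p - g' (i x) p0)"])
        fix z assume z: "z \<in> cball p0 (e/2)"
        show "(?h has_derivative blinfun_apply (g' (i x) z - g' (i x) p0)) (at z within cball p0 (e/2))"
          unfolding minus_blinfun.rep_eq a
          by (intro has_derivative_diff has_derivative_at_withinI[OF g'(1)]) (auto intro!: derivative_eq_intros simp: a)
        have "dist z p0 < e" using z e(1) by (simp add: dist_commute)
        then show "onorm (blinfun_apply (g' (i x) z - g' (i x) p0)) \<le> \<delta>"
          using e(2)[of z x] by (simp add: norm_blinfun.rep_eq[symmetric] dist_norm less_imp_le)
      qed (use p q in auto)
      moreover have "g (i x) p = dist (f p) (f (d (i x)))" "g (i x) q = dist (f q) (f (d (i x)))"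
        using p q gu uA B2A by auto
      ultimately show "dist (dist (f p) (f (d (i x))) - (a \<circ> i) x \<bullet> p) (dist (f q) (f (d (i x))) - (a \<circ> i) x \<bullet> q) \<le> \<delta> * dist p q"
        by (simp add: dist_norm)
    qed (use \<delta> in simp)
    ultimately show "\<exists>K. compact K \<and> K \<subseteq> B \<and> \<not> negligible K \<and>
        (\<forall>x. \<delta>-lipschitz_on K (\<lambda>p. dist (f p) (f (d (i x))) - (a \<circ> i) x \<bullet> p))"
      using B2(2) B1(2) by (intro exI[of _ ?K]) auto
  qed
qed

section \<open>Countable fibres and slices\<close>

lemma diameter_ball_cover:
  fixes \<psi> :: "'x::metric_space \<Rightarrow> 'e::euclidean_space"
  assumes \<psi>: "L-lipschitz_on UNIV \<psi>" and U: "bounded U" "p \<in> U" "q \<in> U"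
  shows "\<psi> p \<in> cball (\<psi> q) (L * diameter U)"
proof -
  have L: "L \<ge> 0" using \<psi> by (simp add: lipschitz_on_def)
  have "dist (\<psi> q) (\<psi> p) \<le> L * dist q p" by (rule lipschitz_onD[OF \<psi>]) auto
  also have "\<dots> \<le> L * diameter U" using diameter_bounded_bound[OF U(1,3,2)] L by (rule mult_left_mono)
  finally show ?thesis by simp
qed

text \<open>
  Fatou's lemma for the counting functions of the images of finer and finer covers of \<open>S\<close>.
\<close>

lemma negligible_infinite_fibres:
  fixes \<psi> :: "'x::metric_space \<Rightarrow> 'e::euclidean_space"
  assumes \<psi>: "L-lipschitz_on UNIV \<psi>" and fin: "hausdorff DIM('e) S < \<infinity>"
  shows "negligible {x. infinite (\<psi> -` {x} \<inter> S)}"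
proof -
  have L: "L \<ge> 0" using \<psi> by (simp add: lipschitz_on_def)
  let ?d = "DIM('e)"
  obtain h where h: "h \<ge> 0" "hausdorff ?d S = ennreal h" using fin by (cases "hausdorff ?d S") auto
  define wt where "wt U = (if U = {} then 0 else ennreal (unit_ball_vol (real ?d) * (diameter U / 2) ^ ?d))" for U :: "'x set"
  have "\<exists>U. S \<subseteq> (\<Union>i. U i) \<and> (\<forall>i. bounded (U i) \<and> diameter (U i) \<le> 1 / Suc k) \<and> (\<Sum>i. wt (U i)) < ennreal (h + 1)" for k
  proof -
    have "hausdorff_content ?d (1 / Suc k) S \<le> hausdorff ?d S"
      unfolding hausdorff_def by (rule SUP_upper) simp
    also have "\<dots> < ennreal (h + 1)" using h by (simp add: ennreal_less_iff)
    finally show ?thesis unfolding hausdorff_content_def INF_less_iff wt_def by auto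
  qed
  then obtain U :: "nat \<Rightarrow> nat \<Rightarrow> 'x set" where U: "\<And>k. S \<subseteq> (\<Union>i. U k i)" "\<And>k i. bounded (U k i)" "\<And>k i. diameter (U k i) \<le> 1 / Suc k"
    "\<And>k. (\<Sum>i. wt (U k i)) < ennreal (h + 1)" by metis
  \<comment> \<open>Balls containing the images of the covering sets. Their radius is
    \<open>L\<close> times the diameter, against half the diameter in the weight, whence the factor
    \<open>(2 * L) ^ ?d\<close> in \<open>M\<close>.\<close>
  define B where "B k i = (if U k i = {} then {} else cball (\<psi> (SOME p. p \<in> U k i)) (L * diameter (U k i)))" for k i
  have B: "\<psi> p \<in> B k i" if "p \<in> U k i" for p k i
  proof -
    have "(SOME p. p \<in> U k i) \<in> U k i" using that by (rule someI)
    then show ?thesis using diameter_ball_cover[OF \<psi> U(2) that] that by (auto simp: B_def)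
  qed
  have Bm[measurable]: "B k i \<in> sets borel" for k i by (simp add: B_def)
  define F where "F k x = (\<Sum>i. indicator (B k i) x :: ennreal)" for k x
  have Fm: "F k \<in> borel_measurable lborel" for k unfolding F_def by measurable
  define M where "M = ennreal ((2 * L) ^ ?d) * (ennreal (h + 1))"
  have Mfin: "M < \<infinity>" by (simp add: M_def ennreal_mult_less_top)
  have int: "(\<integral>\<^sup>+x. F k x \<partial>lborel) \<le> M" for k
  proof -
    have "(\<integral>\<^sup>+x. F k x \<partial>lborel) = (\<Sum>i. emeasure lborel (B k i))"
      unfolding F_def by (subst nn_integral_suminf) auto
    also have "\<dots> \<le> (\<Sum>i. ennreal ((2 * L) ^ ?d) * wt (U k i))"
    proof (rule suminf_le)
      fix i
      show "emeasure lborel (B k i) \<le> ennreal ((2 * L) ^ ?d) * wt (U k i)"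
      proof (cases "U k i = {}")
        case False
        have dp: "diameter (U k i) \<ge> 0" using U(2) by (rule diameter_ge_0)
        have "emeasure lborel (B k i) = ennreal (unit_ball_vol (real ?d) * (L * diameter (U k i)) ^ ?d)"
          using False dp L by (simp add: B_def emeasure_cball)
        also have "unit_ball_vol (real ?d) * (L * diameter (U k i)) ^ ?d = (2 * L) ^ ?d * (unit_ball_vol (real ?d) * (diameter (U k i) / 2) ^ ?d)"
          by (simp add: power_mult_distrib power_divide)
        also have "ennreal \<dots> = ennreal ((2 * L) ^ ?d) * wt (U k i)"
          using False dp L by (simp add: wt_def ennreal_mult)
        finally show ?thesis by simp
      qed (simp add: B_def)
    qed auto
    also have "\<dots> = ennreal ((2 * L) ^ ?d) * (\<Sum>i. wt (U k i))" by (rule ennreal_suminf_cmult)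
    also have "\<dots> \<le> M" unfolding M_def using U(4)[of k] by (intro mult_left_mono) auto
    finally show ?thesis .
  qed
  have lim: "(\<integral>\<^sup>+x. liminf (\<lambda>k. F k x) \<partial>lborel) \<le> M"
  proof -
    have "(\<integral>\<^sup>+x. liminf (\<lambda>k. F k x) \<partial>lborel) \<le> liminf (\<lambda>k. \<integral>\<^sup>+x. F k x \<partial>lborel)"
      by (rule nn_integral_liminf[OF Fm])
    also have "\<dots> \<le> liminf (\<lambda>k::nat. M)" by (rule Liminf_mono) (simp add: int)
    also have "\<dots> = M" by (simp add: Liminf_const)
    finally show ?thesis .
  qed
  have lm: "(\<lambda>x. liminf (\<lambda>k. F k x)) \<in> borel_measurable lborel" using Fm by measurable
  have "AE x in lborel. liminf (\<lambda>k. F k x) \<noteq> \<infinity>"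
    by (rule nn_integral_PInf_AE[OF lm]) (use lim Mfin in auto)
  then obtain N where N: "{x. liminf (\<lambda>k. F k x) = \<infinity>} \<subseteq> N" "N \<in> null_sets lborel"
    by (auto elim!: AE_E simp: null_sets_def)
  have "{x. infinite (\<psi> -` {x} \<inter> S)} \<subseteq> N"
  proof
    fix x assume "x \<in> {x. infinite (\<psi> -` {x} \<inter> S)}"
    then have inf: "infinite (\<psi> -` {x} \<inter> S)" by simp
    have "of_nat n \<le> liminf (\<lambda>k. F k x)" for n :: nat
    proof -
      obtain P where P: "P \<subseteq> \<psi> -` {x} \<inter> S" "finite P" "card P = n"
        using infinite_arbitrarily_large[OF inf] by blast
      \<comment> \<open>The element 1 keeps \<open>D\<close> nonempty. Once the diameters fall below
        \<open>Min D\<close>, distinct points of \<open>P\<close> lie in covering sets with distinct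
        indices, so at least \<open>n\<close> balls contain \<open>x\<close>.\<close>
      define D where "D = insert 1 ((\<lambda>(p, q). dist p q) ` {(p, q) \<in> P \<times> P. p \<noteq> q})"
      have "finite {(p, q) \<in> P \<times> P. p \<noteq> q}" by (rule finite_subset[of _ "P \<times> P"]) (use P in auto)
      then have D: "finite D" "D \<noteq> {}" by (auto simp: D_def)
      have "0 < Min D" using D by (subst Min_gr_iff) (auto simp: D_def)
      then obtain k0 :: nat where k0: "1 / Suc k0 < Min D" using nat_approx_posE by blast
      have "of_nat n \<le> F k x" if k: "k \<ge> k0" for k
      proof -
        have "\<exists>i. p \<in> U k i" if "p \<in> P" for p using P(1) U(1)[of k] that by blast
        then obtain i where i: "\<And>p. p \<in> P \<Longrightarrow> p \<in> U k (i p)" by metis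
        have "inj_on i P"
        proof (rule inj_onI, rule ccontr)
          fix p q assume pq: "p \<in> P" "q \<in> P" "i p = i q" "p \<noteq> q"
          have "dist p q \<le> diameter (U k (i p))" using i[OF pq(1)] i[OF pq(2)] pq(3) by (intro diameter_bounded_bound U) auto
          also have "\<dots> \<le> 1 / Suc k" by (rule U(3))
          also have "\<dots> \<le> 1 / Suc k0" using k by (simp add: frac_le)
          also have "\<dots> < Min D" by (rule k0)
          also have "\<dots> \<le> dist p q" using pq D by (intro Min_le) (auto simp: D_def)
          finally show False by simp
        qed
        then have "of_nat n = (\<Sum>j\<in>i ` P. 1 :: ennreal)" using P(3) by (simp add: card_image)
        also have "\<dots> = (\<Sum>j\<in>i ` P. indicator (B k j) x)"
        proof (rule sum.cong[OF refl])
          fix j assume "j \<in> i ` P"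
          then obtain p where p: "p \<in> P" "j = i p" by blast
          then have "x \<in> B k j" using B[OF i[OF p(1)]] P(1) by auto
          then show "1 = (indicator (B k j) x :: ennreal)" by simp
        qed
        also have "\<dots> \<le> F k x" unfolding F_def by (rule sum_le_suminf) (use P in auto)
        finally show ?thesis .
      qed
      then show ?thesis by (intro Liminf_bounded) (auto simp: eventually_sequentially)
    qed
    then have "(SUP n. of_nat n :: ennreal) \<le> liminf (\<lambda>k. F k x)" by (rule SUP_least)
    then have "liminf (\<lambda>k. F k x) = \<infinity>" by (simp add: ennreal_SUP_of_nat_eq_top top_unique)
    then show "x \<in> N" using N by blast
  qed
  moreover have "negligible N" using N(2) by (simp add: negligible_iff_null_sets null_sets_completionI)
  ultimately show ?thesis by (meson negligible_subset)
qed

lemma negligible_uncountable_fibres: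
  fixes \<psi> :: "'x::metric_space \<Rightarrow> 'e::euclidean_space"
  assumes \<psi>: "L-lipschitz_on UNIV \<psi>" and fin: "hausdorff_sigma_finite DIM('e) (UNIV :: 'x set)"
  shows "negligible {x. uncountable (\<psi> -` {x})}"
proof -
  obtain \<S> :: "'x set set" where \<S>: "countable \<S>" "\<Union>\<S> = UNIV" "\<And>S. S \<in> \<S> \<Longrightarrow> hausdorff DIM('e) S < \<infinity>"
    using fin unfolding hausdorff_sigma_finite_def by blast
  have "negligible (\<Union>S\<in>\<S>. {x. infinite (\<psi> -` {x} \<inter> S)})"
    by (rule negligible_countable_Union) (use \<S> negligible_infinite_fibres[OF \<psi>] in auto)
  moreover have "{x. uncountable (\<psi> -` {x})} \<subseteq> (\<Union>S\<in>\<S>. {x. infinite (\<psi> -` {x} \<inter> S)})"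
  proof (rule subsetI, rule ccontr)
    fix x assume x: "x \<in> {x. uncountable (\<psi> -` {x})}" "x \<notin> (\<Union>S\<in>\<S>. {x. infinite (\<psi> -` {x} \<inter> S)})"
    then have "countable (\<Union>S\<in>\<S>. \<psi> -` {x} \<inter> S)" by (intro countable_UN[OF \<S>(1)]) (auto intro: countable_finite)
    moreover have "(\<Union>S\<in>\<S>. \<psi> -` {x} \<inter> S) = \<psi> -` {x} \<inter> \<Union>\<S>" by auto
    ultimately show False using x(1) \<S>(2) by simp
  qed
  ultimately show ?thesis by (rule negligible_subset)
qed

section \<open>Null sets in products and under splitting of coordinates\<close>

lemma null_sets_lborel_pair_iff_AE:
  fixes Q :: "('a::euclidean_space \<times> 'b::euclidean_space) set"
  assumes Q: "Q \<in> sets borel"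
  shows "Q \<in> null_sets lborel \<longleftrightarrow> (AE x in lborel. {y. (x, y) \<in> Q} \<in> null_sets lborel)" (is ?A)
    and "Q \<in> null_sets lborel \<longleftrightarrow> (AE y in lborel. {x. (x, y) \<in> Q} \<in> null_sets lborel)" (is ?B)
proof -
  have Q': "Q \<in> sets (lborel \<Otimes>\<^sub>M lborel)" using Q unfolding lborel_prod by simp
  have s1: "{y. (x, y) \<in> Q} \<in> sets borel" for x using sets_Pair1[OF Q', of x] by (simp add: vimage_def)
  have s2: "{x. (x, y) \<in> Q} \<in> sets borel" for y using sets_Pair2[OF Q', of y] by (simp add: vimage_def)
  have m1: "(\<lambda>x. emeasure lborel {y. (x, y) \<in> Q}) \<in> borel_measurable lborel"
    using lborel.measurable_emeasure_Pair[OF Q'] by (simp add: vimage_def)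
  have m2: "(\<lambda>y. emeasure lborel {x. (x, y) \<in> Q}) \<in> borel_measurable lborel"
    using lborel_pair.measurable_emeasure_Pair2[OF Q'] by (simp add: vimage_def)
  have e1: "emeasure lborel Q = (\<integral>\<^sup>+x. emeasure lborel {y. (x, y) \<in> Q} \<partial>lborel)"
    using lborel.emeasure_pair_measure_alt[OF Q'] by (simp add: vimage_def lborel_prod)
  have e2: "emeasure lborel Q = (\<integral>\<^sup>+y. emeasure lborel {x. (x, y) \<in> Q} \<partial>lborel)"
    using lborel_pair.emeasure_pair_measure_alt2[OF Q'] by (simp add: vimage_def lborel_prod)
  show ?A using e1 Q s1 by (simp add: null_sets_def nn_integral_0_iff_AE[OF m1])
  show ?B using e2 Q s2 by (simp add: null_sets_def nn_integral_0_iff_AE[OF m2])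
qed

lemma null_sets_lborel_translate:
  fixes N :: "'a::euclidean_space set"
  assumes "N \<in> sets borel"
  shows "{x. x + c \<in> N} \<in> null_sets lborel \<longleftrightarrow> N \<in> null_sets lborel"
proof -
  have "{x. x + c \<in> N} \<in> sets borel"
    using measurable_sets[OF borel_measurable_continuous_onI, of "\<lambda>x. x + c" N] assms by (simp add: vimage_def continuous_intros)
  moreover have "emeasure lborel N = emeasure (distr lborel borel ((+) c)) N" by (simp add: lborel_distr_plus)
  then have "emeasure lborel N = emeasure lborel {x. x + c \<in> N}"
    using assms by (subst (asm) emeasure_distr) (auto simp: vimage_def add.commute)
  ultimately show ?thesis using assms by (simp add: null_sets_def)
qed

definition coord_emb :: "('m \<Rightarrow> 'n) \<Rightarrow> real ^ 'm \<Rightarrow> real ^ 'n" where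
  "coord_emb \<iota> x = (\<chi> k. if k \<in> range \<iota> then x $ inv \<iota> k else 0)"

text \<open>The complementary factor is kept inside \<open>real ^ 'n\<close>, as the vectors
  vanishing on the coordinates in \<open>range \<iota>\<close>; an empty complement then needs no
  separate treatment.\<close>

definition coord_rest :: "('m \<Rightarrow> 'n) \<Rightarrow> real ^ 'n \<Rightarrow> real ^ 'n" where
  "coord_rest \<iota> z = (\<chi> k. if k \<in> range \<iota> then 0 else z $ k)"

lemma coord_split: "inj \<iota> \<Longrightarrow> coord_emb \<iota> (coord_proj \<iota> z) + coord_rest \<iota> z = z"
  by (auto simp: vec_eq_iff coord_emb_def coord_rest_def coord_proj_def)

lemma coord_proj_simps:
  "coord_proj \<iota> (z + w) = coord_proj \<iota> z + coord_proj \<iota> w"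
  "coord_proj \<iota> (coord_rest \<iota> w) = 0"
  "inj \<iota> \<Longrightarrow> coord_proj \<iota> (coord_emb \<iota> x) = x"
  "coord_rest \<iota> (z + w) = coord_rest \<iota> z + coord_rest \<iota> w"
  "coord_rest \<iota> (coord_rest \<iota> z) = coord_rest \<iota> z"
  "coord_rest \<iota> (coord_emb \<iota> x) = 0"
  by (auto simp: vec_eq_iff coord_emb_def coord_rest_def coord_proj_def)

lemma linear_coord:
  "linear (coord_emb \<iota> :: real ^ 'm::finite \<Rightarrow> real ^ 'n::finite)"
  "linear (coord_rest \<iota> :: real ^ 'n::finite \<Rightarrow> real ^ 'n)"
  "linear (coord_proj \<iota> :: real ^ 'n::finite \<Rightarrow> real ^ 'm::finite)"
  by (rule linearI; auto simp: vec_eq_iff coord_emb_def coord_rest_def coord_proj_def)+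

lemmas continuous_on_coord [continuous_intros] =
  linear_continuous_on_compose[OF _ linear_coord(1)]
  linear_continuous_on_compose[OF _ linear_coord(2)]
  linear_continuous_on_compose[OF _ linear_coord(3)]

text \<open>The cylinder over a null set is null: in the directions of
  \<open>coord_emb \<iota>\<close> its slices are translates of that set.\<close>

lemma AE_coord_proj:
  fixes \<iota> :: "'m::finite \<Rightarrow> 'n::finite" and N :: "(real ^ 'm) set"
  assumes \<iota>: "inj \<iota>" and N: "negligible N"
  shows "AE p in lborel. coord_proj \<iota> p \<notin> N"
proof -
  obtain N' where N': "N \<subseteq> N'" "N' \<in> null_sets lborel"
    using N null_sets_completion_iff2 by (metis negligible_iff_null_sets)
  then have b: "N' \<in> sets borel" by auto
  define M where "M = coord_proj \<iota> -` N'"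
  have "coord_proj \<iota> \<in> borel_measurable borel"
    by (intro borel_measurable_continuous_onI linear_continuous_on linear_linear[THEN iffD2] linear_coord)
  then have M: "M \<in> sets borel" using b unfolding M_def by (metis inf_top_right measurable_sets space_borel)
  have "{y. x + coord_emb \<iota> y \<in> M} \<in> null_sets lborel" for x
  proof -
    have "{y. x + coord_emb \<iota> y \<in> M} = {y. y + coord_proj \<iota> x \<in> N'}"
      by (simp add: M_def coord_proj_simps \<iota> add.commute)
    then show ?thesis using null_sets_lborel_translate[OF b] N'(2) by simp
  qed
  then have "M \<in> null_sets lborel"
    by (subst null_sets_lborel_iff_AE_slices[OF M, of "coord_emb \<iota>"]) (auto intro!: continuous_intros)
  then have "AE p in lborel. p \<notin> M" by (rule AE_not_in)
  then show ?thesis by (rule AE_mp) (use N'(1) in \<open>auto simp: M_def\<close>)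
qed

text \<open>
  If all slices \<open>E q\<close> were null, then so would be the set of \<open>((q, w), p)\<close> for which \<open>q\<close> and \<open>p + w\<close> lie
  on the same level of \<open>h\<close> above \<open>p\<close>; but for almost every \<open>p\<close> one of the countably many levels has
  positive measure.
\<close>

lemma exists_nonnegligible_slice:
  fixes \<iota> :: "'m::finite \<Rightarrow> 'n::finite" and h :: "real ^ 'n \<Rightarrow> 'x::metric_space" and \<psi> :: "'x \<Rightarrow> real ^ 'm"
  assumes \<iota>: "inj \<iota>" and K: "compact K" "\<not> negligible K" and h: "continuous_on K h"
    and \<psi>: "\<And>p. p \<in> K \<Longrightarrow> \<psi> (h p) = coord_proj \<iota> p"
    and fibres: "negligible {x. uncountable (\<psi> -` {x})}"
  obtains q where "\<not> negligible {p \<in> K. p + coord_rest \<iota> (q - p) \<in> K \<and> h (p + coord_rest \<iota> (q - p)) = h p}"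
proof (rule ccontr)
  assume neg: "\<not> thesis"
  let ?P = "coord_rest \<iota>"
  have Kcl: "closed K" using K(1) by (rule compact_imp_closed)
  have Kb: "K \<in> sets borel" using Kcl by simp
  define E where "E q = {p \<in> K. p + ?P (q - p) \<in> K \<and> h (p + ?P (q - p)) = h p}" for q
  have En: "negligible (E q)" for q using neg that unfolding E_def by blast
  define Q where "Q = {z :: ((real ^ 'n) \<times> (real ^ 'n)) \<times> (real ^ 'n).
      snd z + ?P (snd (fst z)) \<in> K \<and> snd z + ?P (fst (fst z) - snd z) \<in> K \<and>
      h (snd z + ?P (fst (fst z) - snd z)) = h (snd z + ?P (snd (fst z)))}"
  have Qcl: "closed Q"
  proof -
    let ?a = "\<lambda>z :: ((real ^ 'n) \<times> (real ^ 'n)) \<times> (real ^ 'n). snd z + ?P (snd (fst z))"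
    let ?b = "\<lambda>z :: ((real ^ 'n) \<times> (real ^ 'n)) \<times> (real ^ 'n). snd z + ?P (fst (fst z) - snd z)"
    define C where "C = {z. ?a z \<in> K} \<inter> {z. ?b z \<in> K}"
    have ca: "continuous_on UNIV ?a" and cb: "continuous_on UNIV ?b" by (intro continuous_intros)+
    have C: "closed C"
      unfolding C_def using closed_vimage[OF Kcl ca] closed_vimage[OF Kcl cb] by (auto simp: vimage_def)
    have "continuous_on C (\<lambda>z. h (?a z))" "continuous_on C (\<lambda>z. h (?b z))"
      by (rule continuous_on_compose2[OF h]; auto simp: C_def intro: continuous_on_subset[OF ca] continuous_on_subset[OF cb])+
    then have "closed {z \<in> C. dist (h (?b z)) (h (?a z)) \<le> 0}"
      by (intro continuous_on_closed_Collect_le continuous_intros C)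
    also have "{z \<in> C. dist (h (?b z)) (h (?a z)) \<le> 0} = Q" by (auto simp: C_def Q_def)
    finally show ?thesis .
  qed
  have Qb: "Q \<in> sets borel" using Qcl by simp
  have "{p. ((q, w), p) \<in> Q} \<in> null_sets lborel" for q w
  proof -
    \<comment> \<open>Moving \<open>p\<close> by \<open>?P w\<close> leaves the point at height
      \<open>q\<close> unchanged, so this section is a translate of the set \<open>E q\<close>, null
      by assumption.\<close>
    have "{p. ((q, w), p) \<in> Q} = {p. p + ?P w \<in> E q}"
    proof -
      have eq: "p + ?P w + ?P (q - (p + ?P w)) = p + ?P (q - p)" for p
      proof -
        have "?P (q - (p + ?P w)) + ?P w = ?P (q - p)"
          using coord_proj_simps(4)[of \<iota> "q - (p + ?P w)" "?P w"] by (simp add: coord_proj_simps(5) algebra_simps)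
        then show ?thesis by (simp add: algebra_simps)
      qed
      show ?thesis unfolding Q_def E_def by (simp only: mem_Collect_eq fst_conv snd_conv eq)
    qed
    also have "negligible \<dots>"
      using negligible_translation[OF En[of q], of "- ?P w"] by (auto simp: image_def algebra_simps elim!: negligible_subset intro!: exI bexI[of _ "_ + ?P w"])
    finally have "negligible {p. ((q, w), p) \<in> Q}" .
    moreover have "{p. ((q, w), p) \<in> Q} \<in> sets borel"
      using closed_vimage[OF Qcl, of "\<lambda>p. ((q, w), p)"] by (simp add: vimage_def continuous_intros)
    ultimately show ?thesis by (simp add: negligible_iff_null_sets_lborel)
  qed
  then have "Q \<in> null_sets lborel" by (subst null_sets_lborel_pair_iff_AE(1)[OF Qb]) (auto simp: split_paired_all)
  then have AE1: "AE p in lborel. {qw. (qw, p) \<in> Q} \<in> null_sets lborel" using null_sets_lborel_pair_iff_AE(2)[OF Qb] by simp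
  have AE2: "AE p in lborel. coord_proj \<iota> p \<notin> {x. uncountable (\<psi> -` {x})}" by (rule AE_coord_proj[OF \<iota> fibres])
  have "AE p in lborel. {w. p + ?P w \<in> K} \<in> null_sets lborel"
    using AE1 AE2
  proof eventually_elim
    case (elim p)
    let ?T = "{w. p + ?P w \<in> K}"
    define T where "T v = {w \<in> ?T. h (p + ?P w) = v}" for v
    have Tcl: "closed ?T"
      using closed_vimage[OF Kcl, of "\<lambda>w. p + ?P w"] by (simp add: vimage_def continuous_intros)
    have Tvcl: "closed (T v)" for v
    proof -
      have "continuous_on ?T (\<lambda>w. h (p + ?P w))"
        by (rule continuous_on_compose2[OF h]) (auto intro!: continuous_intros)
      then have "closed {w \<in> ?T. dist (h (p + ?P w)) v \<le> 0}"
        by (intro continuous_on_closed_Collect_le continuous_intros Tcl)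
      then show ?thesis by (simp add: T_def)
    qed
    have sQ: "{qw. (qw, p) \<in> Q} \<in> sets borel"
      using closed_vimage[OF Qcl, of "\<lambda>qw. (qw, p)"] by (simp add: vimage_def continuous_intros)
    have "AE w in lborel. {q. ((q, w), p) \<in> Q} \<in> null_sets lborel"
      using elim(1) null_sets_lborel_pair_iff_AE(2)[OF sQ] by simp
    then obtain N where N: "N \<in> null_sets lborel" "\<And>w. w \<notin> N \<Longrightarrow> {q. ((q, w), p) \<in> Q} \<in> null_sets lborel"
      by (auto elim!: AE_E3)
    have Tv: "negligible (T v)" for v
    proof (rule ccontr)
      \<comment> \<open>A typical \<open>w\<close> on the level \<open>v\<close> has as its
        \<open>q\<close>-section in \<open>Q\<close> a translate of the same level; the section is
        null, hence so is the level.\<close>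
      assume nT: "\<not> negligible (T v)"
      have "\<exists>w. w \<in> T v \<and> w \<notin> N"
      proof (rule ccontr)
        assume "\<not> ?thesis"
        then have "T v \<subseteq> N" by blast
        moreover have "negligible N" using N(1) by (simp add: negligible_iff_null_sets null_sets_completionI)
        ultimately show False using nT negligible_subset by blast
      qed
      then obtain w where w: "w \<in> T v" "w \<notin> N" by blast
      have "{q. ((q, w), p) \<in> Q} = {q. q + (- p) \<in> T v}" using w(1) by (auto simp: Q_def T_def)
      then have "{q. q + (- p) \<in> T v} \<in> null_sets lborel" using N(2)[OF w(2)] by simp
      then have "T v \<in> null_sets lborel" using null_sets_lborel_translate[of "T v" "- p"] Tvcl by simp
      then show False using nT by (simp add: negligible_iff_null_sets null_sets_completionI)
    qed
    \<comment> \<open>All values of \<open>h\<close> on the vertical slice through \<open>p\<close>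
      lie in a single fibre of \<psi>, which is countable for almost every \<open>p\<close>.\<close>
    have "?T \<subseteq> (\<Union>v\<in>\<psi> -` {coord_proj \<iota> p}. T v)"
      using \<psi> by (auto simp: T_def coord_proj_simps)
    moreover have "negligible (\<Union>v\<in>\<psi> -` {coord_proj \<iota> p}. T v)"
      by (rule negligible_countable_Union) (use elim(2) Tv in auto)
    ultimately have "negligible ?T" by (meson negligible_subset)
    then show ?case using Tcl by (simp add: negligible_iff_null_sets_lborel)
  qed
  then have "K \<in> null_sets lborel"
    using null_sets_lborel_iff_AE_slices[OF Kb, of ?P] by (simp add: continuous_intros)
  then show False using K(2) by (simp add: negligible_iff_null_sets null_sets_completionI)
qed

section \<open>Straightening diffeomorphisms\<close>

lemma linear_bij_bounded_below:
  fixes T :: "'a::euclidean_space \<Rightarrow> 'a"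
  assumes "linear T" "bij T"
  obtains c where "c > 0" "\<And>x. c * norm x \<le> norm (T x)"
proof -
  have "inj T" using assms(2) by (simp add: bij_def)
  then obtain B where "B > 0" "\<And>x. B * norm x \<le> norm (T x)"
    using linear_inj_bounded_below_pos[OF assms(1)] by blast
  then show ?thesis using that by blast
qed

text \<open>Surjectivity is the contraction principle applied to \<open>x \<mapsto> T\<inverse> (y - E x)\<close>.\<close>

lemma C1_diffeomorphism_linear_plus_small:
  fixes T E :: "'a::euclidean_space \<Rightarrow> 'a"
  assumes T: "linear T" "bij T" and c: "\<And>x. c * norm x \<le> norm (T x)" and e: "e < c"
    and E: "C1_map E" "e-lipschitz_on UNIV E"
  shows "C1_diffeomorphism (\<lambda>x. T x + E x)"
    and "\<And>x y. (c - e) * dist x y \<le> dist (T x + E x) (T y + E y)"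
proof -
  let ?G = "\<lambda>x. T x + E x"
  have e0: "e \<ge> 0" using E(2) by (simp add: lipschitz_on_def)
  then have c0: "c > 0" using e by simp
  show lower: "(c - e) * dist x y \<le> dist (?G x) (?G y)" for x y
  proof -
    have "c * dist x y \<le> norm (T x - T y)" using c[of "x - y"] by (simp add: dist_norm linear_diff[OF T(1)])
    moreover have "norm (E x - E y) \<le> e * dist x y" using lipschitz_onD[OF E(2), of x y] by (simp add: dist_norm)
    moreover have "norm (T x - T y) \<le> norm (?G x - ?G y) + norm (E x - E y)"
      using norm_triangle_ineq4[of "?G x - ?G y" "E x - E y"] by (simp add: algebra_simps)
    ultimately show ?thesis by (simp add: dist_norm algebra_simps)
  qed
  have inj: "inj ?G"
  proof (rule injI)
    fix x y assume "?G x = ?G y"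
    then have "(c - e) * dist x y \<le> 0" using lower[of x y] by simp
    then show "x = y" using e by (simp add: mult_le_0_iff)
  qed
  have linT': "linear (inv T)" using inj_linear_imp_inv_linear[OF T(1)] T(2) by (simp add: bij_is_inj)
  have nT': "norm (inv T z) \<le> norm z / c" for z
    using c[of "inv T z"] c0 T(2) by (simp add: bij_is_surj surj_f_inv_f pos_le_divide_eq mult.commute)
  have surj: "surj ?G"
  proof (rule surjI)
    fix y
    define \<Theta> where "\<Theta> x = inv T (y - E x)" for x
    have "\<exists>!x\<in>UNIV. \<Theta> x = x"
    proof (rule Banach_fix[of UNIV "e / c"])
      show "dist (\<Theta> x) (\<Theta> x') \<le> e / c * dist x x'" if "x \<in> UNIV" "x' \<in> UNIV" for x x'
      proof -
        have "\<Theta> x - \<Theta> x' = inv T (E x' - E x)" by (simp add: \<Theta>_def flip: linear_diff[OF linT'])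
        then have "dist (\<Theta> x) (\<Theta> x') \<le> norm (E x' - E x) / c" using nT' by (simp add: dist_norm)
        also have "norm (E x' - E x) \<le> e * dist x x'" using lipschitz_onD[OF E(2), of x' x] by (simp add: dist_norm norm_minus_commute)
        finally show ?thesis using c0 by (simp add: divide_right_mono)
      qed
    qed (use e e0 c0 in \<open>auto simp: complete_UNIV\<close>)
    then obtain x where "\<Theta> x = x" by blast
    then have "T x = y - E x" using T(2) unfolding \<Theta>_def by (metis bij_is_surj surj_f_inv_f)
    then show "?G (SOME x. ?G x = y) = y" by (intro someI[of "\<lambda>x. ?G x = y" x]) simp
  qed
  have bij: "bij ?G" using inj surj by (simp add: bij_def)
  have Ginv: "T (inv ?G z) + E (inv ?G z) = z" for z using surj_f_inv_f[OF surj, of z] .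
  obtain E' where E': "\<And>x. (E has_derivative blinfun_apply (E' x)) (at x)" "continuous_on UNIV E'"
    using E(1) unfolding C1_map_def by metis
  define G' where "G' x = Blinfun T + E' x" for x
  have blT: "bounded_linear T" using T(1) by (simp add: linear_linear)
  have derG: "(?G has_derivative blinfun_apply (G' x)) (at x)" for x
    unfolding G'_def by (auto intro!: derivative_eq_intros E'(1) bounded_linear_imp_has_derivative[OF blT]
        simp: blinfun.add_left bounded_linear_Blinfun_apply[OF blT])
  have contG': "continuous_on UNIV G'" unfolding G'_def by (intro continuous_intros E'(2))
  have C1G: "C1_map ?G" unfolding C1_map_def using derG contG' by blast
  \<comment> \<open>The lower bound passes to the derivative, so all derivatives are invertible with
    inverses bounded by \<open>1 / (c - e)\<close>.\<close>
  have lowG': "(c - e) * norm h \<le> norm (blinfun_apply (G' x) h)" for x h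
  proof -
    have "norm (blinfun_apply (E' x) h) \<le> e * norm h" by (rule lipschitz_derivative_bound[OF E(2) E'(1)])
    moreover have "norm (T h) \<le> norm (T h + blinfun_apply (E' x) h) + norm (blinfun_apply (E' x) h)"
      using norm_triangle_ineq4[of "T h + blinfun_apply (E' x) h" "blinfun_apply (E' x) h"] by simp
    ultimately show ?thesis using c[of h]
      by (simp add: G'_def blinfun.add_left bounded_linear_Blinfun_apply[OF blT] algebra_simps)
  qed
  have injG': "inj (blinfun_apply (G' x))" for x
  proof (rule linear_injective_0[THEN iffD2, rule_format])
    show "linear (blinfun_apply (G' x))" by (simp add: blinfun.bounded_linear_right bounded_linear.linear)
    fix h assume "blinfun_apply (G' x) h = 0"
    then have "(c - e) * norm h \<le> 0" using lowG'[of h x] by simp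
    then show "h = 0" using e by (simp add: mult_le_0_iff)
  qed
  have bijG': "bij (blinfun_apply (G' x))" for x
    using injG' by (simp add: bij_def linear_injective_imp_surjective blinfun.bounded_linear_right bounded_linear.linear)
  define H' where "H' y = Blinfun (inv (blinfun_apply (G' (inv ?G y))))" for y
  have blinv: "bounded_linear (inv (blinfun_apply (G' x)))" for x
    by (rule inj_linear_imp_inv_bounded_linear[OF blinfun.bounded_linear_right injG'])
  have H'_apply: "blinfun_apply (H' y) = inv (blinfun_apply (G' (inv ?G y)))" for y
    unfolding H'_def by (rule bounded_linear_Blinfun_apply[OF blinv])
  have nH': "norm (H' y) \<le> 1 / (c - e)" for y
  proof (rule norm_blinfun_bound)
    fix z
    have "(c - e) * norm (blinfun_apply (H' y) z) \<le> norm z"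
      using lowG'[of "blinfun_apply (H' y) z" "inv ?G y"] bijG' by (simp add: H'_apply bij_is_surj surj_f_inv_f)
    then show "norm (blinfun_apply (H' y) z) \<le> 1 / (c - e) * norm z" using e by (simp add: pos_le_divide_eq mult.commute)
  qed (use e in simp)
  have "(1 / (c - e))-lipschitz_on UNIV (inv ?G)"
  proof (rule lipschitz_onI)
    fix y z
    show "dist (inv ?G y) (inv ?G z) \<le> 1 / (c - e) * dist y z"
      using lower[of "inv ?G y" "inv ?G z"] e unfolding Ginv by (simp add: pos_le_divide_eq mult.commute)
  qed (use e in simp)
  then have contH: "continuous_on UNIV (inv ?G)" by (rule lipschitz_on_continuous_on)
  have derH: "(inv ?G has_derivative blinfun_apply (H' y)) (at y)" for y
  proof (rule has_derivative_inverse_basic[of ?G "blinfun_apply (G' (inv ?G y))" _ _ _ UNIV])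
    show "blinfun_apply (H' y) \<circ> blinfun_apply (G' (inv ?G y)) = id"
      using bijG' by (simp add: H'_apply fun_eq_iff bij_is_inj)
    show "continuous (at y) (inv ?G)" using contH by (simp add: continuous_on_eq_continuous_at)
    show "?G (inv ?G z) = z" for z by (rule Ginv)
  qed (use derG in \<open>auto simp: blinfun.bounded_linear_right\<close>)
  have contH': "continuous_on UNIV H'"
    unfolding continuous_on_def
  proof
    fix y :: 'a
    have "((\<lambda>z. G' (inv ?G z)) \<longlongrightarrow> G' (inv ?G y)) (at y within UNIV)"
      using continuous_on_compose2[OF contG' contH] by (auto simp: continuous_on_def)
    then have "((\<lambda>z. norm (G' (inv ?G y) - G' (inv ?G z))) \<longlongrightarrow> 0) (at y within UNIV)"
      by (subst norm_minus_commute) (rule tendsto_norm_zero[OF LIM_zero])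
    then have lim: "((\<lambda>z. (1 / (c - e)) * norm (G' (inv ?G y) - G' (inv ?G z)) * (1 / (c - e))) \<longlongrightarrow> 0) (at y within UNIV)"
      by (intro tendsto_mult_left_zero tendsto_mult_right_zero)
    show "(H' \<longlongrightarrow> H' y) (at y within UNIV)"
    proof (rule LIM_zero_cancel, rule Lim_null_comparison[OF _ lim], rule always_eventually, rule allI)
      fix z
      \<comment> \<open>The resolvent identity for inverses; with the uniform bound on
        \<open>H'\<close> it reduces continuity of the inverse derivative to that of
        \<open>G'\<close>.\<close>
      have "H' z - H' y = H' z o\<^sub>L (G' (inv ?G y) - G' (inv ?G z)) o\<^sub>L H' y"
      proof (rule blinfun_eqI)
        fix w
        have "blinfun_apply (G' (inv ?G y)) (blinfun_apply (H' y) w) = w"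
          using bijG' by (simp add: H'_apply bij_is_surj surj_f_inv_f)
        moreover have "blinfun_apply (H' z) (blinfun_apply (G' (inv ?G z)) (blinfun_apply (H' y) w)) = blinfun_apply (H' y) w"
          using bijG' by (simp add: H'_apply bij_is_inj)
        ultimately show "blinfun_apply (H' z - H' y) w = blinfun_apply (H' z o\<^sub>L (G' (inv ?G y) - G' (inv ?G z)) o\<^sub>L H' y) w"
          by (simp add: blinfun.diff_left blinfun.diff_right)
      qed
      also have "norm \<dots> \<le> norm (H' z) * norm (G' (inv ?G y) - G' (inv ?G z)) * norm (H' y)"
        by (intro order_trans[OF norm_blinfun_compose] mult_right_mono norm_blinfun_compose) auto
      also have "\<dots> \<le> (1 / (c - e)) * norm (G' (inv ?G y) - G' (inv ?G z)) * (1 / (c - e))"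
        using e by (intro mult_mono nH') auto
      finally show "norm (H' z - H' y) \<le> (1 / (c - e)) * norm (G' (inv ?G y) - G' (inv ?G z)) * (1 / (c - e))" .
    qed
  qed
  have "C1_map (inv ?G)" unfolding C1_map_def using derH contH' by blast
  then show "C1_diffeomorphism ?G" unfolding C1_diffeomorphism_def using bij C1G by blast
qed

text \<open>Complete the vectors to a basis, number it so that \<open>a i\<close> receives the
  number \<open>\<iota> i\<close>, and take inner products with it. Only zero is orthogonal to a
  basis, which gives injectivity.\<close>

lemma independent_family_coordinates:
  fixes \<iota> :: "'m::finite \<Rightarrow> 'n::finite" and a :: "'m \<Rightarrow> real ^ 'n"
  assumes \<iota>: "inj \<iota>" and a: "inj a" "independent (range a)"
  obtains T :: "real ^ 'n \<Rightarrow> real ^ 'n" where "linear T" "bij T" "\<And>i p. T p $ \<iota> i = a i \<bullet> p"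
proof -
  obtain B where B: "range a \<subseteq> B" "independent B" "UNIV \<subseteq> span B"
    by (rule maximal_independent_subset_extend[OF subset_UNIV a(2)])
  then have B: "range a \<subseteq> B" "independent B" "span B = UNIV" by auto
  have finB: "finite B" using B(2) by (rule independent_imp_finite)
  have cardB: "card B = CARD('n)"
    using dim_eq_card_independent[OF B(2)] dim_span[of B] unfolding B(3) by simp
  have "card (B - range a) = card (- range \<iota>)"
  proof -
    have "card (B - range a) = card B - card (range a)" using B(1) by (simp add: card_Diff_subset)
    also have "\<dots> = CARD('n) - card (range \<iota>)" using cardB a(1) \<iota> by (simp add: card_image)
    also have "\<dots> = card (- range \<iota>)" by (simp add: card_Diff_subset Compl_eq_Diff_UNIV)
    finally show ?thesis .
  qed
  then obtain b where b: "bij_betw b (- range \<iota>) (B - range a)"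
    using finite_same_card_bij[of "- range \<iota>" "B - range a"] finB by auto
  define v where "v k = (if k \<in> range \<iota> then a (inv \<iota> k) else b k)" for k
  have "bij_betw v (range \<iota> \<union> - range \<iota>) (range a \<union> (B - range a))"
  proof (rule bij_betw_combine)
    have "bij_betw (\<lambda>k. a (inv \<iota> k)) (range \<iota>) (range a)"
    proof (rule bij_betw_imageI)
      show "inj_on (\<lambda>k. a (inv \<iota> k)) (range \<iota>)"
        using \<iota> a(1) by (auto intro!: inj_onI dest: injD)
      show "(\<lambda>k. a (inv \<iota> k)) ` range \<iota> = range a" using \<iota> by (simp add: image_image)
    qed
    then show "bij_betw v (range \<iota>) (range a)" by (rule bij_betw_cong[THEN iffD1, rotated]) (simp add: v_def)
    show "bij_betw v (- range \<iota>) (B - range a)" using b by (rule bij_betw_cong[THEN iffD1, rotated]) (simp add: v_def)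
  qed auto
  moreover have "range \<iota> \<union> - range \<iota> = UNIV" "range a \<union> (B - range a) = B" using B(1) by auto
  ultimately have v: "bij_betw v UNIV B" by simp
  define T where "T p = (\<chi> k. v k \<bullet> p)" for p
  have lin: "linear T" by (rule linearI) (auto simp: T_def vec_eq_iff inner_add_right)
  have "inj T"
  proof (rule linear_injective_0[OF lin, THEN iffD2, rule_format])
    fix p assume "T p = 0"
    then have "v k \<bullet> p = 0" for k by (simp add: T_def vec_eq_iff)
    then have "orthogonal p x" if "x \<in> B" for x using v that by (auto simp: bij_betw_def orthogonal_def inner_commute)
    then have "orthogonal p p" using B(3) orthogonal_to_span[of p B p] by auto
    then show "p = 0" by (simp add: orthogonal_def)
  qed
  then have "bij T" using lin by (simp add: bij_def linear_injective_imp_surjective)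
  moreover have "T p $ \<iota> i = a i \<bullet> p" for i p using \<iota> by (simp add: T_def v_def)
  ultimately show ?thesis using that lin by blast
qed

lemma C1_map_coordinates:
  fixes g :: "'n::finite \<Rightarrow> 'a::euclidean_space \<Rightarrow> real"
  assumes "\<And>k. C1_map (g k)" shows "C1_map (\<lambda>x. \<chi> k. g k x)"
proof -
  obtain g' where g': "\<And>k x. (g k has_derivative blinfun_apply (g' k x)) (at x)" "\<And>k. continuous_on UNIV (g' k)"
    using assms unfolding C1_map_def by metis
  define G' where "G' x = (\<Sum>k\<in>UNIV. blinfun_scaleR_left (axis k 1 :: real ^ 'n) o\<^sub>L g' k x)" for x
  have "((\<lambda>x. \<chi> k. g k x) has_derivative blinfun_apply (G' x)) (at x)" for x
  proof -
    have "((\<lambda>x. \<Sum>k\<in>UNIV. g k x *\<^sub>R (axis k 1 :: real ^ 'n)) has_derivative (\<lambda>h. \<Sum>k\<in>UNIV. blinfun_apply (g' k x) h *\<^sub>R axis k 1)) (at x)"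
      by (intro has_derivative_sum has_derivative_scaleR_left g'(1))
    moreover have "(\<Sum>k\<in>UNIV. c k *\<^sub>R (axis k 1 :: real ^ 'n)) = (\<chi> k. c k)" for c
      by (simp add: vec_eq_iff axis_def if_distrib sum.delta cong: if_cong)
    moreover have "(\<lambda>h. \<Sum>k\<in>UNIV. blinfun_apply (g' k x) h *\<^sub>R (axis k 1 :: real ^ 'n)) = blinfun_apply (G' x)"
      by (simp add: G'_def fun_eq_iff blinfun.sum_left)
    ultimately show ?thesis by simp
  qed
  moreover have "continuous_on UNIV G'" unfolding G'_def by (intro continuous_intros g'(2))
  ultimately show ?thesis unfolding C1_map_def by blast
qed

section \<open>Hausdorff null sets and exhaustion\<close>

text \<open>The definition asks for a sequence of sets. A countable family is enumerated and padded
  by empty sets of weight zero, so that bounds on finite subfamilies suffice.\<close>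

lemma hausdorff_content_le_of_cover:
  fixes E :: "'a::metric_space set"
  assumes "countable \<C>" "E \<subseteq> \<Union>\<C>" "\<And>U. U \<in> \<C> \<Longrightarrow> bounded U \<and> diameter U \<le> \<delta>" and "\<delta> \<ge> 0"
    and le: "\<And>\<F>. finite \<F> \<Longrightarrow> \<F> \<subseteq> \<C> \<Longrightarrow> (\<Sum>U\<in>\<F>. unit_ball_vol (real d) * (diameter U / 2) ^ d) \<le> m"
  shows "hausdorff_content d \<delta> E \<le> ennreal m"
proof (cases "\<C> = {}")
  case True
  then have "E = {}" using assms(2) by simp
  have "hausdorff_content d \<delta> E \<le> (\<Sum>i::nat. if ({}::'a set) = {} then 0 else ennreal (unit_ball_vol (real d) * (diameter ({}::'a set) / 2) ^ d))"
    unfolding hausdorff_content_def by (rule INF_lower2[of "\<lambda>_. {}"]) (use \<open>E = {}\<close> \<open>\<delta> \<ge> 0\<close> in auto)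
  then show ?thesis by simp
next
  case False
  define wt where "wt U = (if U = {} then 0 else ennreal (unit_ball_vol (real d) * (diameter U / 2) ^ d))" for U :: "'a set"
  obtain e :: "'a set \<Rightarrow> nat" where e: "inj_on e \<C>" using assms(1) by (auto elim: countableE)
  define U where "U n = (if n \<in> e ` \<C> then inv_into \<C> e n else {})" for n
  have U: "U n \<in> \<C>" if "n \<in> e ` \<C>" for n using that by (simp add: U_def inv_into_into)
  have Ue: "U (e C) = C" if "C \<in> \<C>" for C using that e by (simp add: U_def)
  have "E \<subseteq> (\<Union>n. U n)"
  proof
    fix x assume "x \<in> E"
    then obtain C where C: "C \<in> \<C>" "x \<in> C" using assms(2) by blast
    then have "x \<in> U (e C)" using Ue by simp
    then show "x \<in> (\<Union>n. U n)" by blast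
  qed
  moreover have "bounded (U n) \<and> diameter (U n) \<le> \<delta>" for n
    using assms(3)[OF U[of n]] \<open>\<delta> \<ge> 0\<close> by (cases "n \<in> e ` \<C>") (auto simp: U_def)
  ultimately have "hausdorff_content d \<delta> E \<le> (\<Sum>n. wt (U n))"
    unfolding hausdorff_content_def wt_def by (intro INF_lower) auto
  also have "\<dots> \<le> ennreal m"
  proof (rule suminf_le_const)
    show "summable (\<lambda>n. wt (U n))" by simp
    fix N
    define F where "F = {n. n < N \<and> n \<in> e ` \<C>}"
    have F: "finite F" "F \<subseteq> {..<N}" by (auto simp: F_def)
    have dn: "0 \<le> diameter (U n)" if "n \<in> F" for n using assms(3)[OF U] that by (intro diameter_ge_0) (auto simp: F_def)
    have "(\<Sum>n<N. wt (U n)) = (\<Sum>n\<in>F. wt (U n))"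
      by (rule sum.mono_neutral_right) (auto simp: F_def U_def wt_def)
    also have "\<dots> \<le> (\<Sum>n\<in>F. ennreal (unit_ball_vol (real d) * (diameter (U n) / 2) ^ d))"
      by (rule sum_mono) (simp add: wt_def)
    also have "\<dots> = ennreal (\<Sum>n\<in>F. unit_ball_vol (real d) * (diameter (U n) / 2) ^ d)"
      by (rule sum_ennreal) (use dn in auto)
    also have "(\<Sum>n\<in>F. unit_ball_vol (real d) * (diameter (U n) / 2) ^ d) = (\<Sum>C\<in>U ` F. unit_ball_vol (real d) * (diameter C / 2) ^ d)"
    proof (rule sum.reindex[symmetric, unfolded o_def])
      show "inj_on U F"
      proof (rule inj_onI)
        fix n k assume "n \<in> F" "k \<in> F" "U n = U k"
        moreover have "e (U n) = n" "e (U k) = k"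
          using \<open>n \<in> F\<close> \<open>k \<in> F\<close> by (simp_all add: F_def U_def f_inv_into_f)
        ultimately show "n = k" by metis
      qed
    qed
    also have "ennreal \<dots> \<le> ennreal m"
    proof (intro ennreal_leI le)
      show "U ` F \<subseteq> \<C>" using U by (auto simp: F_def)
    qed (use F in simp)
    finally show "(\<Sum>n<N. wt (U n)) \<le> ennreal m" .
  qed
  finally show ?thesis .
qed

text \<open>A dyadic covering inside an open set of small measure consists of nonoverlapping boxes,
  and these are cubes because the initial box is one. For cubes the weight is bounded by a multiple
  of the volume, and the volumes add up to at most that of the open set.\<close>

lemma negligible_box_cover:
  fixes N :: "'a::euclidean_space set"
  assumes N: "negligible N" and Nk: "N \<subseteq> cbox (- (real (Suc k) *\<^sub>R One)) (real (Suc k) *\<^sub>R One)" and \<delta>: "\<delta> > 0" and \<epsilon>: "\<epsilon> > 0"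
  obtains \<D> where "countable \<D>" "N \<subseteq> \<Union>\<D>" "\<And>U. U \<in> \<D> \<Longrightarrow> bounded U \<and> diameter U \<le> \<delta>"
    "\<And>\<F>. finite \<F> \<Longrightarrow> \<F> \<subseteq> \<D> \<Longrightarrow> (\<Sum>U\<in>\<F>. unit_ball_vol (real DIM('a)) * (diameter U / 2) ^ DIM('a)) \<le> \<epsilon>"
proof -
  let ?n = "DIM('a)"
  define a :: 'a where "a = - (real (Suc k) *\<^sub>R One)"
  define b :: 'a where "b = real (Suc k) *\<^sub>R One"
  have ab: "b \<bullet> i - a \<bullet> i = 2 * real (Suc k)" if "i \<in> Basis" for i using that by (simp add: a_def b_def)
  have ne: "box a b \<noteq> {}" by (auto simp: box_ne_empty a_def b_def)
  \<comment> \<open>Half the diameter of a cube of side \<open>s\<close> is at most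
    \<open>?n * s\<close>, so \<open>C\<close> turns volume into weight; the summand 1 yields
    positivity.\<close>
  define C where "C = unit_ball_vol (real ?n) * real ?n ^ ?n + 1"
  have C: "C > 0" by (simp add: C_def add_nonneg_pos)
  obtain U where U: "open U" "N \<subseteq> U" "U - N \<in> lmeasurable" "emeasure lebesgue (U - N) < ennreal (\<epsilon> / C)"
    using sets_lebesgue_outer_open[of N "\<epsilon> / C"] N \<epsilon> C by (auto simp: negligible_imp_sets)
  have Um: "U \<in> lmeasurable" "measure lebesgue U \<le> \<epsilon> / C"
  proof -
    have "U = (U - N) \<union> N" using U(2) by blast
    moreover have "N \<in> lmeasurable" using N by (rule negligible_imp_measurable)
    ultimately show 1: "U \<in> lmeasurable" using U(3) fmeasurable.Un by metis
    have "measure lebesgue U = measure lebesgue ((U - N) \<union> N)" using U(2) by (simp add: Un_absorb2)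
    also have "\<dots> = measure lebesgue (U - N)"
      using N U(3) by (simp only: fmeasurableD measure_Un_null_set negligible_iff_null_sets)
    also have "\<dots> \<le> \<epsilon> / C"
      using U(4) \<epsilon> C emeasure_eq_measure2[OF U(3)] by (simp add: ennreal_less_iff)
    finally show "measure lebesgue U \<le> \<epsilon> / C" .
  qed
  \<comment> \<open>The tags lie in \<open>N\<close>, hence in \<open>U\<close>, where the gauge
    keeps the cubes inside \<open>U\<close> and their diameter at most \<delta>.\<close>
  define g where "g x = (if x \<in> U then U \<inter> ball x (\<delta>/2) else ball x 1)" for x
  have g: "gauge g" unfolding gauge_def g_def using U(1) \<delta> by auto
  obtain \<D> where D: "countable \<D>" "\<Union>\<D> \<subseteq> cbox a b"
    "\<And>K. K \<in> \<D> \<Longrightarrow> interior K \<noteq> {} \<and> (\<exists>c d. K = cbox c d)"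
    "pairwise (\<lambda>A B. interior A \<inter> interior B = {}) \<D>"
    "\<And>K. K \<in> \<D> \<Longrightarrow> \<exists>x \<in> N \<inter> K. K \<subseteq> g x"
    "\<And>u v. cbox u v \<in> \<D> \<Longrightarrow> \<exists>n. \<forall>i \<in> Basis. v \<bullet> i - u \<bullet> i = (b \<bullet> i - a \<bullet> i) / 2^n"
    "N \<subseteq> \<Union>\<D>"
    by (rule covering_lemma[OF Nk[folded a_def b_def] ne g], rule that)
  have KU: "K \<subseteq> U" "diameter K \<le> \<delta>" if K: "K \<in> \<D>" for K
  proof -
    obtain x where x: "x \<in> N" "K \<subseteq> g x" using D(5)[OF K] by blast
    then have g: "K \<subseteq> U" "K \<subseteq> ball x (\<delta>/2)" using U(2) by (auto simp: g_def split: if_splits)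
    then show "K \<subseteq> U" by simp
    have "diameter K \<le> diameter (ball x (\<delta>/2))" using g(2) by (intro diameter_subset) auto
    then show "diameter K \<le> \<delta>" using \<delta> by (simp add: diameter_ball)
  qed
  have wt: "unit_ball_vol (real ?n) * (diameter K / 2) ^ ?n \<le> C * measure lebesgue K" if K: "K \<in> \<D>" for K
  proof -
    obtain c d where cd: "K = cbox c d" "interior K \<noteq> {}" using D(3)[OF K] by blast
    obtain n where n: "\<And>i. i \<in> Basis \<Longrightarrow> d \<bullet> i - c \<bullet> i = 2 * real (Suc k) / 2 ^ n"
      using D(6)[of c d] K cd(1) ab by auto
    define s where "s = 2 * real (Suc k) / 2 ^ n"
    have s: "s > 0" by (simp add: s_def)
    have "c \<bullet> i \<le> d \<bullet> i" if "i \<in> Basis" for i using n[OF that] s unfolding s_def by linarith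
    then have cd_le: "\<forall>i\<in>Basis. c \<bullet> i \<le> d \<bullet> i" by blast
    have "diameter K \<le> norm (d - c)"
    proof -
      have "diameter K = dist c d" unfolding cd(1) by (rule diameter_cbox[OF cd_le])
      then show ?thesis by (simp add: dist_norm norm_minus_commute)
    qed
    also have "\<dots> \<le> (\<Sum>i\<in>Basis. \<bar>(d - c) \<bullet> i\<bar>)" by (rule norm_le_l1)
    also have "\<dots> = real ?n * s" using n s by (simp add: inner_diff_left s_def)
    finally have "diameter K / 2 \<le> real ?n * s" using diameter_ge_0[OF bounded_cbox[of c d]] by (simp add: cd(1))
    moreover have "0 \<le> diameter K" unfolding cd(1) by (rule diameter_ge_0[OF bounded_cbox])
    ultimately have "(diameter K / 2) ^ ?n \<le> (real ?n * s) ^ ?n" by (intro power_mono) auto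
    then have "unit_ball_vol (real ?n) * (diameter K / 2) ^ ?n \<le> unit_ball_vol (real ?n) * (real ?n * s) ^ ?n"
      by (intro mult_left_mono) auto
    also have "\<dots> = (C - 1) * s ^ ?n" by (simp add: C_def power_mult_distrib)
    also have "\<dots> \<le> C * s ^ ?n" using s by (intro mult_right_mono) auto
    also have "s ^ ?n = measure lebesgue K"
      using n cd_le unfolding cd(1) by (simp add: content_cbox_if box_eq_empty s_def not_less[symmetric])
    finally show ?thesis .
  qed
  show ?thesis
  proof (rule that[OF D(1,7)])
    show "bounded K \<and> diameter K \<le> \<delta>" if "K \<in> \<D>" for K using KU(2)[OF that] D(3)[OF that] bounded_cbox by auto
    fix \<F> assume F: "finite \<F>" "\<F> \<subseteq> \<D>"
    have Fm: "K \<in> lmeasurable" if "K \<in> \<F>" for K using D(3)[of K] F(2) that by auto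
    have "(\<Sum>K\<in>\<F>. unit_ball_vol (real ?n) * (diameter K / 2) ^ ?n) \<le> (\<Sum>K\<in>\<F>. C * measure lebesgue K)"
      by (rule sum_mono) (use wt F in auto)
    also have "\<dots> = C * measure lebesgue (\<Union>\<F>)"
    proof -
      have "measure lebesgue (\<Union>\<F>) = (\<Sum>K\<in>\<F>. measure lebesgue K)"
      proof (rule measure_negligible_finite_Union[OF F(1) Fm])
        show "pairwise (\<lambda>S T. negligible (S \<inter> T)) \<F>"
        proof (rule pairwiseI)
          fix S T assume ST: "S \<in> \<F>" "T \<in> \<F>" "S \<noteq> T"
          then have "interior (S \<inter> T) = {}" using D(4) F(2) unfolding pairwise_def by (auto simp: interior_Int)
          moreover have "convex (S \<inter> T)" using D(3)[of S] D(3)[of T] ST F(2) by (auto intro!: convex_Int convex_box)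
          ultimately show "negligible (S \<inter> T)" by (simp add: negligible_convex_interior)
        qed
      qed
      then show ?thesis by (simp add: sum_distrib_left)
    qed
    also have "\<dots> \<le> C * measure lebesgue U"
      by (intro mult_left_mono measure_mono_fmeasurable) (use KU(1) F Fm Um C in \<open>auto intro!: sets.finite_Union fmeasurableD\<close>)
    also have "\<dots> \<le> C * (\<epsilon> / C)" using Um(2) C by (intro mult_left_mono) auto
    also have "\<dots> = \<epsilon>" using C by simp
    finally show "(\<Sum>K\<in>\<F>. unit_ball_vol (real ?n) * (diameter K / 2) ^ ?n) \<le> \<epsilon>" .
  qed
qed

lemma sum_le_sum_cover:
  fixes w :: "'b \<Rightarrow> real"
  assumes "finite F" "F \<subseteq> (\<Union>k<K. D k)" "\<And>x. x \<in> F \<Longrightarrow> 0 \<le> w x"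
  shows "sum w F \<le> (\<Sum>k<(K::nat). sum w (F \<inter> D k))"
proof -
  have "w x \<le> (\<Sum>k<K. if x \<in> D k then w x else 0)" if x: "x \<in> F" for x
  proof -
    obtain k where k: "k < K" "x \<in> D k" using x assms(2) by blast
    have "w x = (\<Sum>j\<in>{k}. if x \<in> D j then w x else 0)" using k by simp
    also have "\<dots> \<le> (\<Sum>k<K. if x \<in> D k then w x else 0)"
      by (rule sum_mono2) (use k assms(3)[OF x] in auto)
    finally show ?thesis .
  qed
  then have "sum w F \<le> (\<Sum>x\<in>F. \<Sum>k<K. if x \<in> D k then w x else 0)" by (rule sum_mono)
  also have "\<dots> = (\<Sum>k<K. \<Sum>x\<in>F. if x \<in> D k then w x else 0)" by (rule sum.swap)
  also have "\<dots> = (\<Sum>k<K. sum w (F \<inter> D k))" using assms(1) by (simp add: sum.inter_restrict)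
  finally show ?thesis .
qed

text \<open>The bounded pieces of \<open>N\<close> are covered with budgets
  \<open>\<epsilon> / 2 ^ Suc k\<close>. This passes from Lebesgue null sets, in which the
  construction is carried out, to the Hausdorff measure of the conclusion.\<close>

theorem negligible_imp_hausdorff_0:
  fixes N :: "'a::euclidean_space set"
  assumes N: "negligible N" shows "hausdorff DIM('a) N = 0"
proof -
  let ?n = "DIM('a)"
  have "hausdorff_content ?n \<delta> N \<le> 0" if \<delta>: "\<delta> > 0" for \<delta>
  proof (rule ennreal_le_epsilon)
    fix \<epsilon> :: real assume \<epsilon>: "\<epsilon> > 0"
    define Nk where "Nk k = N \<inter> cbox (- (real (Suc k) *\<^sub>R One)) (real (Suc k) *\<^sub>R One)" for k
    have "\<exists>\<D>. countable \<D> \<and> Nk k \<subseteq> \<Union>\<D> \<and> (\<forall>U\<in>\<D>. bounded U \<and> diameter U \<le> \<delta>) \<and>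
      (\<forall>\<F>. finite \<F> \<longrightarrow> \<F> \<subseteq> \<D> \<longrightarrow> (\<Sum>U\<in>\<F>. unit_ball_vol (real ?n) * (diameter U / 2) ^ ?n) \<le> \<epsilon> / 2 ^ Suc k)" for k
    proof -
      have "negligible (Nk k)" unfolding Nk_def by (rule negligible_subset[OF N]) auto
      moreover have "Nk k \<subseteq> cbox (- (real (Suc k) *\<^sub>R One)) (real (Suc k) *\<^sub>R One)" by (simp add: Nk_def)
      moreover have "\<epsilon> / 2 ^ Suc k > 0" using \<epsilon> by simp
      ultimately show ?thesis using negligible_box_cover[of "Nk k" k \<delta> "\<epsilon> / 2 ^ Suc k"] \<delta> by metis
    qed
    then obtain \<D> where D: "\<And>k. countable (\<D> k)" "\<And>k. Nk k \<subseteq> \<Union>(\<D> k)" "\<And>k U. U \<in> \<D> k \<Longrightarrow> bounded U \<and> diameter U \<le> \<delta>"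
      "\<And>k \<F>. finite \<F> \<Longrightarrow> \<F> \<subseteq> \<D> k \<Longrightarrow> (\<Sum>U\<in>\<F>. unit_ball_vol (real ?n) * (diameter U / 2) ^ ?n) \<le> \<epsilon> / 2 ^ Suc k"
      by metis
    have "hausdorff_content ?n \<delta> N \<le> ennreal \<epsilon>"
    proof (rule hausdorff_content_le_of_cover[of "\<Union>k. \<D> k"])
      show "countable (\<Union>k. \<D> k)" using D(1) by simp
      show "N \<subseteq> \<Union>(\<Union>k. \<D> k)"
      proof
        fix x assume x: "x \<in> N"
        obtain k :: nat where k: "norm x \<le> real k" using real_arch_simple by blast
        have "x \<in> Nk k"
          unfolding Nk_def mem_box
        proof (intro IntI x CollectI ballI)
          show "x \<in> cbox (- (real (Suc k) *\<^sub>R One)) (real (Suc k) *\<^sub>R One)"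
            unfolding mem_box
          proof
            fix i :: 'a assume i: "i \<in> Basis"
            then show "- (real (Suc k) *\<^sub>R One) \<bullet> i \<le> x \<bullet> i \<and> x \<bullet> i \<le> (real (Suc k) *\<^sub>R One) \<bullet> i"
              using Basis_le_norm[OF i, of x] k by (simp add: abs_le_iff)
          qed
        qed
        then have "x \<in> \<Union>(\<D> k)" using D(2)[of k] by blast
        then show "x \<in> \<Union>(\<Union>k. \<D> k)" by blast
      qed
      show "bounded U \<and> diameter U \<le> \<delta>" if "U \<in> (\<Union>k. \<D> k)" for U using D(3) that by blast
      fix \<F> assume F: "finite \<F>" "\<F> \<subseteq> (\<Union>k. \<D> k)"
      let ?w = "\<lambda>U :: 'a set. unit_ball_vol (real ?n) * (diameter U / 2) ^ ?n"
      have "\<exists>K. \<F> \<subseteq> (\<Union>k<K. \<D> k)"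
        using F
      proof (induction rule: finite_induct)
        case (insert x F)
        then obtain K j where "F \<subseteq> (\<Union>k<K. \<D> k)" "x \<in> \<D> j" by auto
        then have "insert x F \<subseteq> (\<Union>k<max K (Suc j). \<D> k)" by fastforce
        then show ?case by blast
      qed simp
      then obtain K where K: "\<F> \<subseteq> (\<Union>k<K. \<D> k)" by blast
      have "sum ?w \<F> \<le> (\<Sum>k<K. sum ?w (\<F> \<inter> \<D> k))"
      proof (rule sum_le_sum_cover[OF F(1) K])
        fix U assume "U \<in> \<F>"
        then have "0 \<le> diameter U" using F(2) D(3) by (intro diameter_ge_0) blast
        then show "0 \<le> ?w U" by simp
      qed
      also have "\<dots> \<le> (\<Sum>k<K. \<epsilon> / 2 ^ Suc k)" by (rule sum_mono) (use D(4) F(1) in auto)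
      also have "\<dots> \<le> (\<Sum>k. \<epsilon> / 2 ^ Suc k)"
        by (rule sum_le_suminf) (use \<epsilon> power_half_series[THEN sums_mult[of _ _ \<epsilon>]] in \<open>auto simp: power_divide dest: sums_summable\<close>)
      also have "\<dots> = \<epsilon>"
        using sums_unique[OF power_half_series[THEN sums_mult[of _ _ \<epsilon>]]] by (simp add: power_divide)
      finally show "sum ?w \<F> \<le> \<epsilon>" .
    qed (use \<delta> in simp)
    then show "hausdorff_content ?n \<delta> N \<le> 0 + ennreal \<epsilon>" by simp
  qed
  then have "hausdorff ?n N \<le> 0" unfolding hausdorff_def by (intro SUP_least) auto
  then show ?thesis by simp
qed

text \<open>Only finitely many disjoint sets of measure above \<open>1 / Suc m\<close> fit into a
  given ball.\<close>

lemma countable_disjoint_nonnegligible: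
  fixes \<K> :: "'a::euclidean_space set set"
  assumes dis: "disjoint \<K>" and K: "\<And>K. K \<in> \<K> \<Longrightarrow> compact K \<and> \<not> negligible K"
  shows "countable \<K>"
proof -
  define \<L> where "\<L> m n = {K \<in> \<K>. K \<subseteq> cball 0 (real n) \<and> 1 / real (Suc m) < measure lebesgue K}" for m n :: nat
  have "finite (\<L> m n)" for m n
  proof (rule conjunct1[OF finite_if_finite_subsets_card_bdd])
    fix F assume F: "F \<subseteq> \<L> m n" "finite F"
    have Fm: "S \<in> lmeasurable" if "S \<in> F" for S using F(1) K that by (auto simp: \<L>_def intro: lmeasurable_compact)
    have "real (card F) * (1 / real (Suc m)) = (\<Sum>S\<in>F. 1 / real (Suc m))" by simp
    also have "\<dots> \<le> (\<Sum>S\<in>F. measure lebesgue S)" by (rule sum_mono) (use F in \<open>auto simp: \<L>_def\<close>)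
    also have "\<dots> = measure lebesgue (\<Union>F)"
    proof (rule measure_negligible_finite_Union[OF F(2) Fm, symmetric])
      show "pairwise (\<lambda>S T. negligible (S \<inter> T)) F"
        using dis F(1) unfolding pairwise_def disjnt_def \<L>_def by (metis (mono_tags, lifting) mem_Collect_eq negligible_empty subsetD)
    qed
    also have "\<dots> \<le> measure lebesgue (cball (0::'a) (real n))"
      by (intro measure_mono_fmeasurable) (use F Fm in \<open>auto simp: \<L>_def intro!: sets.finite_Union fmeasurableD\<close>)
    finally have "real (card F) \<le> measure lebesgue (cball (0::'a) (real n)) * real (Suc m)" by (simp add: pos_divide_le_eq)
    then show "card F \<le> nat \<lceil>measure lebesgue (cball (0::'a) (real n)) * real (Suc m)\<rceil>" by linarith
  qed
  then have "countable (\<Union>m n. \<L> m n)" by (intro countable_UN countableI_type countable_finite)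
  moreover have "\<K> \<subseteq> (\<Union>m n. \<L> m n)"
  proof
    fix S assume S: "S \<in> \<K>"
    obtain r where r: "S \<subseteq> cball 0 r" using K[OF S] by (metis ball_subset_cball bounded_subset_ballD compact_imp_bounded subset_trans)
    obtain n :: nat where n: "r \<le> real n" using real_arch_simple by blast
    have "measure lebesgue S > 0"
      using K[OF S] lmeasurable_compact[of S] by (simp add: negligible_iff_measure0 zero_less_measure_iff)
    then obtain m :: nat where "1 / real (Suc m) < measure lebesgue S" using nat_approx_posE by blast
    then have "S \<in> \<L> m n" using S r n by (auto simp: \<L>_def)
    then show "S \<in> (\<Union>m n. \<L> m n)" by blast
  qed
  ultimately show ?thesis using countable_subset by blast
qed

text \<open>A maximal disjoint family of good nonnull compact sets is countable, so its union is
  measurable; a nonnull remainder would contain a further member.\<close>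

lemma lebesgue_exhaustion:
  fixes A :: "'a::euclidean_space set"
  assumes A: "A \<in> sets lebesgue"
    and good: "\<And>B. B \<in> sets lebesgue \<Longrightarrow> B \<subseteq> A \<Longrightarrow> \<not> negligible B \<Longrightarrow> \<exists>K. compact K \<and> K \<subseteq> B \<and> \<not> negligible K \<and> P K"
  obtains \<K> where "countable \<K>" "disjoint \<K>" "\<And>K. K \<in> \<K> \<Longrightarrow> compact K \<and> K \<subseteq> A \<and> P K" "negligible (A - \<Union>\<K>)"
proof -
  define \<Z> where "\<Z> = {\<K>. disjoint \<K> \<and> (\<forall>K\<in>\<K>. compact K \<and> K \<subseteq> A \<and> \<not> negligible K \<and> P K)}"
  have "\<exists>M\<in>\<Z>. \<forall>X\<in>\<Z>. M \<subseteq> X \<longrightarrow> X = M"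
  proof (rule subset_Zorn')
    fix \<C> assume C: "subset.chain \<Z> \<C>"
    then have CZ: "\<C> \<subseteq> \<Z>" and lin: "\<And>X Y. X \<in> \<C> \<Longrightarrow> Y \<in> \<C> \<Longrightarrow> X \<subseteq> Y \<or> Y \<subseteq> X"
      by (auto simp: subset_chain_def)
    have "disjoint (\<Union>\<C>)"
    proof (rule pairwiseI)
      fix S T assume ST: "S \<in> \<Union>\<C>" "T \<in> \<Union>\<C>" "S \<noteq> T"
      then obtain X where "X \<in> \<C>" "S \<in> X" "T \<in> X" using lin by blast
      then show "disjnt S T" using CZ ST(3) unfolding \<Z>_def pairwise_def by blast
    qed
    then show "\<Union>\<C> \<in> \<Z>" using CZ unfolding \<Z>_def by blast
  qed
  then obtain \<K> where M: "\<K> \<in> \<Z>" "\<And>X. X \<in> \<Z> \<Longrightarrow> \<K> \<subseteq> X \<Longrightarrow> X = \<K>" by blast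
  have dis: "disjoint \<K>" and K: "\<And>K. K \<in> \<K> \<Longrightarrow> compact K \<and> K \<subseteq> A \<and> \<not> negligible K \<and> P K" using M(1) by (auto simp: \<Z>_def)
  have cK: "countable \<K>" by (rule countable_disjoint_nonnegligible[OF dis]) (use K in blast)
  have "negligible (A - \<Union>\<K>)"
  proof (rule ccontr)
    assume nn: "\<not> negligible (A - \<Union>\<K>)"
    have "\<Union>\<K> \<in> sets lebesgue"
      by (rule sets.countable_Union[OF cK]) (use K in \<open>auto intro!: fmeasurableD lmeasurable_compact\<close>)
    then have "A - \<Union>\<K> \<in> sets lebesgue" using A by blast
    then obtain S where S: "compact S" "S \<subseteq> A - \<Union>\<K>" "\<not> negligible S" "P S" using good nn by (metis Diff_subset)
    have "disjoint (insert S \<K>)" using dis S(2) by (auto simp: pairwise_insert disjnt_def)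
    then have "insert S \<K> \<in> \<Z>" using K S by (auto simp: \<Z>_def)
    then have "S \<in> \<K>" using M(2) by blast
    then have "S = {}" using S(2) by blast
    then show False using S(3) by simp
  qed
  then show ?thesis using that cK dis K by blast
qed

section \<open>Factorization\<close>

lemma C1_map_const: "C1_map (\<lambda>_. c)"
  unfolding C1_map_def by (intro exI[of _ "\<lambda>_. 0"]) (auto simp: zero_blinfun.rep_eq)

lemma negligible_C1_image:
  fixes g :: "'a::euclidean_space \<Rightarrow> 'a"
  assumes "C1_map g" "negligible S" shows "negligible (g ` S)"
proof (rule negligible_differentiable_image_negligible[OF order_refl assms(2)])
  show "g differentiable_on S"
    using assms(1) unfolding C1_map_def differentiable_on_def differentiable_def by (meson has_derivative_at_withinI)
qed

lemma dist_coordinates_lipschitz: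
  fixes X :: "'m::finite \<Rightarrow> 'x::metric_space"
  shows "CARD('m)-lipschitz_on UNIV (\<lambda>x. \<chi> i. dist x (X i))"
proof (rule lipschitz_onI)
  fix x y
  have "dist (\<chi> i. dist x (X i)) (\<chi> i. dist y (X i)) \<le> (\<Sum>i\<in>UNIV. \<bar>((\<chi> i. dist x (X i)) - (\<chi> i. dist y (X i))) $ i\<bar>)"
    unfolding dist_norm by (rule norm_le_l1_cart)
  also have "\<dots> \<le> (\<Sum>i\<in>(UNIV::'m set). dist x y)"
  proof (rule sum_mono)
    fix i
    show "\<bar>((\<chi> i. dist x (X i)) - (\<chi> i. dist y (X i))) $ i\<bar> \<le> dist x y"
      using dist_triangle[of x "X i" y] dist_triangle[of y "X i" x] by (simp add: abs_le_iff dist_commute)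
  qed
  finally show "dist (\<chi> i. dist x (X i)) (\<chi> i. dist y (X i)) \<le> CARD('m) * dist x y" by simp
qed simp

text \<open>Only the deviation of the distance functions from their linear parts is approximated.
  The linear parts go into \<open>T\<close> exactly, so \<open>G\<close> is an isomorphism plus a
  perturbation with half of the lower bound of \<open>T\<close> as Lipschitz constant.\<close>

lemma exists_straightening_diffeomorphism:
  fixes f :: "real ^ 'n::finite \<Rightarrow> 'x::metric_space" and \<iota> :: "'m::finite \<Rightarrow> 'n"
  assumes \<iota>: "inj \<iota>" and B: "B \<in> sets lebesgue" "B \<subseteq> A" "\<not> negligible B"
    and f: "L-lipschitz_on A f" and L: "L > 0"
    and md: "\<And>p. p \<in> B \<Longrightarrow> \<exists>\<sigma>. has_approx_metric_derivative f A p \<sigma> \<and> seminorm_rank \<sigma> = CARD('m)"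
  obtains K G X M where "compact K" "K \<subseteq> B" "\<not> negligible K" "C1_diffeomorphism G" "M-lipschitz_on UNIV (inv G)"
    "\<And>p. p \<in> K \<Longrightarrow> coord_proj \<iota> (G p) = (\<chi> i. dist (f p) (X i))"
proof -
  obtain X :: "'m \<Rightarrow> 'x" and a :: "'m \<Rightarrow> real ^ 'n" where a: "inj a" "independent (range a)"
    and Xa: "\<And>\<delta>. \<delta> > 0 \<Longrightarrow> \<exists>K. compact K \<and> K \<subseteq> B \<and> \<not> negligible K \<and> (\<forall>i. \<delta>-lipschitz_on K (\<lambda>p. dist (f p) (X i) - a i \<bullet> p))"
    by (rule exists_independent_distance_gradients[OF B f L md], assumption, rule that)
  obtain T :: "real ^ 'n \<Rightarrow> real ^ 'n" where T: "linear T" "bij T" "\<And>i p. T p $ \<iota> i = a i \<bullet> p"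
    using independent_family_coordinates[OF \<iota> a] by metis
  obtain c where c: "c > 0" "\<And>x. c * norm x \<le> norm (T x)" using linear_bij_bounded_below[OF T(1,2)] by blast
  \<comment> \<open>The approximation doubles the Lipschitz constant and the sum over coordinates
    multiplies it by the dimension; the result for \<open>E\<close> is \<open>c / 2\<close>.\<close>
  define \<delta> where "\<delta> = c / (4 * real CARD('n))"
  have \<delta>: "\<delta> > 0" using c(1) by (simp add: \<delta>_def)
  obtain K1 where K1: "compact K1" "K1 \<subseteq> B" "\<not> negligible K1" "\<And>i. \<delta>-lipschitz_on K1 (\<lambda>p. dist (f p) (X i) - a i \<bullet> p)"
    using Xa[OF \<delta>] by blast
  have "\<exists>w. \<delta>-lipschitz_on UNIV w \<and> (\<forall>p\<in>K1. w p = dist (f p) (X i) - a i \<bullet> p)" for i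
    using lipschitz_on_real_extension[OF K1(4)[of i]] by metis
  then obtain w where w: "\<And>i. \<delta>-lipschitz_on UNIV (w i)" "\<And>i p. p \<in> K1 \<Longrightarrow> w i p = dist (f p) (X i) - a i \<bullet> p" by metis
  \<comment> \<open>\<open>from_nat\<close> spreads the finite index type over a sequence; below,
    \<open>to_nat\<close> picks a position for each index.\<close>
  obtain g K where g: "\<And>n. C1_map (g n)" "\<And>n. (2 * \<delta>)-lipschitz_on UNIV (g n)" and K: "compact K" "K \<subseteq> K1" "\<not> negligible K"
    and gw: "\<And>n x. x \<in> K \<Longrightarrow> g n x = w (from_nat n) x"
    by (rule C1_lusin_sequence[where u = "\<lambda>n. w (from_nat n)", OF K1(1,3) \<delta> w(1)], rule that)
  define E where "E p = (\<chi> k. if k \<in> range \<iota> then g (to_nat (inv \<iota> k)) p else 0)" for p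
  have "C1_map (if k \<in> range \<iota> then g (to_nat (inv \<iota> k)) else (\<lambda>_. 0))" for k by (simp add: g(1) C1_map_const)
  from C1_map_coordinates[of "\<lambda>k. if k \<in> range \<iota> then g (to_nat (inv \<iota> k)) else (\<lambda>_. 0)", OF this]
  have E1: "C1_map E" unfolding E_def by (simp add: if_distrib[of "\<lambda>f. f _"])
  have E2: "(c / 2)-lipschitz_on UNIV E"
  proof (rule lipschitz_onI)
    fix x y
    have "dist (E x) (E y) \<le> (\<Sum>k\<in>UNIV. \<bar>(E x - E y) $ k\<bar>)" unfolding dist_norm by (rule norm_le_l1_cart)
    also have "\<dots> \<le> (\<Sum>k\<in>(UNIV::'n set). 2 * \<delta> * dist x y)"
    proof (rule sum_mono)
      fix k
      show "\<bar>(E x - E y) $ k\<bar> \<le> 2 * \<delta> * dist x y"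
        using lipschitz_onD[OF g(2)[of "to_nat (inv \<iota> k)"], of x y] \<delta> by (auto simp: E_def dist_real_def)
    qed
    also have "\<dots> = c / 2 * dist x y" by (simp add: \<delta>_def)
    finally show "dist (E x) (E y) \<le> c / 2 * dist x y" .
  qed (use c in simp)
  define G where "G p = T p + E p" for p
  have e: "c / 2 < c" using c(1) by simp
  note diff = C1_diffeomorphism_linear_plus_small[OF T(1,2) c(2) e E1 E2, folded G_def]
  show ?thesis
  proof (rule that[of K G "1 / (c - c / 2)" X])
    show "K \<subseteq> B" using K(2) K1(2) by blast
    show "C1_diffeomorphism G" using diff(1) by (simp add: G_def[abs_def])
    then have surj: "surj G" by (simp add: C1_diffeomorphism_def bij_is_surj)
    show "(1 / (c - c / 2))-lipschitz_on UNIV (inv G)"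
    proof (rule lipschitz_onI)
      fix y z
      show "dist (inv G y) (inv G z) \<le> 1 / (c - c / 2) * dist y z"
        using diff(2)[of "inv G y" "inv G z"] e surj by (simp add: surj_f_inv_f pos_le_divide_eq mult.commute)
    qed (use e in simp)
    fix p assume p: "p \<in> K"
    then have "p \<in> K1" using K(2) by blast
    then show "coord_proj \<iota> (G p) = (\<chi> i. dist (f p) (X i))"
      using gw[OF p] w(2) by (simp add: vec_eq_iff coord_proj_def G_def T(3) E_def \<iota>)
  qed (use K in auto)
qed

lemma exists_nonnegligible_factorization:
  fixes f :: "real ^ 'n::finite \<Rightarrow> 'x::metric_space" and \<iota> :: "'m::finite \<Rightarrow> 'n"
  assumes \<iota>: "inj \<iota>" and B: "B \<in> sets lebesgue" "B \<subseteq> A" "\<not> negligible B"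
    and f: "L-lipschitz_on A f" and L: "L > 0"
    and sf: "hausdorff_sigma_finite CARD('m) (UNIV :: 'x set)"
    and md: "\<And>p. p \<in> B \<Longrightarrow> \<exists>\<sigma>. has_approx_metric_derivative f A p \<sigma> \<and> seminorm_rank \<sigma> = CARD('m)"
  obtains K G \<phi> where "compact K" "K \<subseteq> B" "\<not> negligible K" "C1_diffeomorphism G"
    "bilipschitz_on (coord_proj \<iota> ` G ` K) \<phi>" "\<And>z. z \<in> G ` K \<Longrightarrow> (f \<circ> inv G) z = \<phi> (coord_proj \<iota> z)"
proof -
  obtain K0 G X M where K0: "compact K0" "K0 \<subseteq> B" "\<not> negligible K0" and G: "C1_diffeomorphism G" "M-lipschitz_on UNIV (inv G)"
    and GX: "\<And>p. p \<in> K0 \<Longrightarrow> coord_proj \<iota> (G p) = (\<chi> i. dist (f p) (X i))"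
    by (rule exists_straightening_diffeomorphism[OF \<iota> B f L md], assumption, rule that)
  \<comment> \<open>Defined on all of the target space, so that the fibre count applies to it and
    the inverse of \<phi> inherits its Lipschitz constant.\<close>
  define \<psi> where "\<psi> x = (\<chi> i. dist x (X i))" for x
  have \<psi>: "CARD('m)-lipschitz_on UNIV \<psi>" unfolding \<psi>_def by (rule dist_coordinates_lipschitz)
  have bijG: "bij G" and C1G: "C1_map G" "C1_map (inv G)" using G(1) by (auto simp: C1_diffeomorphism_def)
  have GinvG: "inv G (G p) = p" for p using bijG by (simp add: bij_is_inj)
  define C where "C = G ` K0"
  define h where "h = f \<circ> inv G"
  have contG: "continuous_on S G" for S
    using C1G(1) unfolding C1_map_def by (meson has_derivative_continuous continuous_at_imp_continuous_on)
  have C: "compact C" unfolding C_def by (rule compact_continuous_image[OF contG K0(1)])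
  have invC: "inv G z \<in> K0" if "z \<in> C" for z using that GinvG by (auto simp: C_def)
  have nC: "\<not> negligible C"
  proof
    assume "negligible C"
    then have "negligible (inv G ` C)" by (rule negligible_C1_image[OF C1G(2)])
    moreover have "inv G ` C = K0" by (simp add: C_def image_image GinvG)
    ultimately show False using K0(3) by simp
  qed
  have M: "M \<ge> 0" using G(2) by (simp add: lipschitz_on_def)
  have h_lip: "dist (h y) (h z) \<le> L * M * dist y z" if "y \<in> C" "z \<in> C" for y z
  proof -
    have "dist (h y) (h z) \<le> L * dist (inv G y) (inv G z)"
      unfolding h_def o_def by (rule lipschitz_onD[OF f]) (use invC that K0(2) B(2) in blast)+
    also have "\<dots> \<le> L * (M * dist y z)" using L lipschitz_onD[OF G(2), of y z] by (intro mult_left_mono) auto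
    finally show ?thesis by simp
  qed
  have conth: "continuous_on C h"
    by (rule lipschitz_on_continuous_on[of "L * M"], rule lipschitz_onI) (use h_lip L M in auto)
  have \<psi>h: "\<psi> (h z) = coord_proj \<iota> z" if "z \<in> C" for z
    using that GX by (auto simp: C_def h_def \<psi>_def GinvG)
  have fib: "negligible {x. uncountable (\<psi> -` {x})}"
    by (rule negligible_uncountable_fibres[OF \<psi>]) (use sf in simp)
  obtain q where q: "\<not> negligible {p \<in> C. p + coord_rest \<iota> (q - p) \<in> C \<and> h (p + coord_rest \<iota> (q - p)) = h p}"
    by (rule exists_nonnegligible_slice[OF \<iota> C nC conth \<psi>h fib])
  \<comment> \<open>The point above \<open>x\<close> on the horizontal slice through
    \<open>q\<close>.\<close>
  define sl where "sl x = coord_emb \<iota> x + coord_rest \<iota> q" for x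
  have mix: "p + coord_rest \<iota> (q - p) = sl (coord_proj \<iota> p)" for p
  proof -
    have "coord_rest \<iota> (q - p) = coord_rest \<iota> q - coord_rest \<iota> p" by (rule linear_diff[OF linear_coord(2)])
    moreover have "coord_emb \<iota> (coord_proj \<iota> p) = p - coord_rest \<iota> p"
      using coord_split[OF \<iota>, of p] by (simp add: eq_diff_eq)
    ultimately show ?thesis by (simp add: sl_def)
  qed
  define D where "D = {p \<in> C. sl (coord_proj \<iota> p) \<in> C \<and> h (sl (coord_proj \<iota> p)) = h p}"
  have nD: "\<not> negligible D" using q by (simp add: mix D_def)
  have contsl: "continuous_on S (\<lambda>p. sl (coord_proj \<iota> p))" for S
    unfolding sl_def by (intro continuous_intros)
  have "compact D"
  proof -
    define C' where "C' = C \<inter> (\<lambda>p. sl (coord_proj \<iota> p)) -` C"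
    have cl: "closed C'" unfolding C'_def using C contsl[of C] compact_imp_closed
      by (intro continuous_closed_preimage) auto
    have "continuous_on C' (\<lambda>p. h (sl (coord_proj \<iota> p)))"
      by (rule continuous_on_compose2[OF conth contsl]) (auto simp: C'_def)
    moreover have "continuous_on C' h" by (rule continuous_on_subset[OF conth]) (auto simp: C'_def)
    ultimately have "closed {p \<in> C'. dist (h (sl (coord_proj \<iota> p))) (h p) \<le> 0}"
      by (intro continuous_on_closed_Collect_le continuous_intros cl)
    moreover have "{p \<in> C'. dist (h (sl (coord_proj \<iota> p))) (h p) \<le> 0} = D" by (auto simp: C'_def D_def)
    moreover have "D = C \<inter> D" by (auto simp: D_def)
    ultimately show ?thesis using C compact_Int_closed by metis
  qed
  define K where "K = inv G ` D"
  have GK: "G ` K = D" using bijG by (simp add: K_def image_image bij_is_surj surj_f_inv_f)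
  define \<phi> where "\<phi> x = h (sl x)" for x
  obtain Q where Q: "Q > 0" "\<And>x. norm (coord_emb \<iota> x) \<le> Q * norm (x :: real ^ 'm)"
    using linear_bounded_pos[OF linear_coord(1)[of \<iota>]] by metis
  show ?thesis
  proof (rule that[of K G \<phi>])
    show "compact K" unfolding K_def
      by (rule compact_continuous_image[OF continuous_on_subset[OF lipschitz_on_continuous_on[OF G(2)] subset_UNIV] \<open>compact D\<close>])
    show "K \<subseteq> B" using invC K0(2) by (auto simp: K_def D_def)
    show "\<not> negligible K" using nD negligible_C1_image[OF C1G(1), of K] GK by auto
    show "C1_diffeomorphism G" by (rule G(1))
    show "(f \<circ> inv G) z = \<phi> (coord_proj \<iota> z)" if "z \<in> G ` K" for z
      using that unfolding GK by (simp add: D_def \<phi>_def h_def)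
    \<comment> \<open>The lower bound comes from \<psi>, a left inverse of \<phi> on this set; the
      upper one from the constants of \<open>f\<close>, of \<open>inv G\<close> and of the embedding
      of the slice.\<close>
    show "bilipschitz_on (coord_proj \<iota> ` G ` K) \<phi>"
      unfolding bilipschitz_on_def GK
    proof (intro exI[of _ "max 1 (max (real CARD('m)) (L * M * Q))"] conjI ballI)
      let ?L = "max 1 (max (real CARD('m)) (L * M * Q))"
      fix x y assume "x \<in> coord_proj \<iota> ` D" "y \<in> coord_proj \<iota> ` D"
      then have x: "sl x \<in> C" and y: "sl y \<in> C" by (auto simp: D_def)
      have proj: "coord_proj \<iota> (sl x) = x" for x by (simp add: sl_def coord_proj_simps \<iota>)
      have "dist x y = dist (\<psi> (\<phi> x)) (\<psi> (\<phi> y))" using \<psi>h[OF x] \<psi>h[OF y] by (simp add: \<phi>_def proj)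
      also have "\<dots> \<le> CARD('m) * dist (\<phi> x) (\<phi> y)" by (rule lipschitz_onD[OF \<psi>]) auto
      also have "\<dots> \<le> ?L * dist (\<phi> x) (\<phi> y)" by (intro mult_right_mono) auto
      finally show "dist x y / ?L \<le> dist (\<phi> x) (\<phi> y)" by (simp add: pos_divide_le_eq mult.commute)
      have "dist (\<phi> x) (\<phi> y) \<le> L * M * dist (sl x) (sl y)" unfolding \<phi>_def by (rule h_lip[OF x y])
      also have "dist (sl x) (sl y) = norm (coord_emb \<iota> (x - y))"
        by (simp add: sl_def dist_norm linear_diff[OF linear_coord(1)])
      also have "L * M * norm (coord_emb \<iota> (x - y)) \<le> L * M * (Q * norm (x - y))"
        using L M Q(2) by (intro mult_left_mono) auto
      also have "\<dots> = L * M * Q * dist x y" by (simp add: dist_norm)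
      also have "\<dots> \<le> ?L * dist x y" by (intro mult_right_mono) auto
      finally show "dist (\<phi> x) (\<phi> y) \<le> ?L * dist x y" .
    qed simp
  qed
qed

theorem theorem5p12:
  fixes f :: "real ^ 'n::finite \<Rightarrow> 'x::metric_space"
    and A :: "(real ^ 'n) set"
    and \<iota> :: "'m::finite \<Rightarrow> 'n"
  assumes "inj \<iota>"
    and "hausdorff_sigma_finite CARD('m) (UNIV :: 'x set)"
    and "A \<in> sets lebesgue"
    and "hausdorff CARD('n) A > 0"
    and "\<exists>L. L-lipschitz_on A f"
    and "AE p in lebesgue. p \<in> A \<longrightarrow>
           approx_metric_differentiable f A p \<and> seminorm_rank (md_a f A p) = CARD('m)"
  shows "\<exists>\<K> :: (real ^ 'n) set set.
           countable \<K> \<and> disjoint \<K> \<and> (\<forall>K\<in>\<K>. compact K \<and> K \<subseteq> A) \<and>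
           hausdorff CARD('n) (A - \<Union>\<K>) = 0 \<and>
           (\<forall>K\<in>\<K>. \<exists>(G :: real ^ 'n \<Rightarrow> real ^ 'n) (\<phi> :: real ^ 'm \<Rightarrow> 'x).
              C1_diffeomorphism G \<and>
              bilipschitz_on (coord_proj \<iota> ` G ` K) \<phi> \<and>
              (\<forall>z\<in>G ` K. (f \<circ> inv G) z = \<phi> (coord_proj \<iota> z)))"
proof -
  obtain L0 where L0: "L0-lipschitz_on A f" using assms(5) by blast
  \<comment> \<open>Several constants above are quotients by the Lipschitz constant, so it is made
    positive.\<close>
  define L where "L = max 1 L0"
  have L: "L > 0" "L-lipschitz_on A f" using lipschitz_on_le[OF L0, of L] by (auto simp: L_def)
  obtain N where N: "N \<in> null_sets lebesgue"
    "\<And>p. p \<in> A \<Longrightarrow> p \<notin> N \<Longrightarrow> approx_metric_differentiable f A p \<and> seminorm_rank (md_a f A p) = CARD('m)"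
    using assms(6) by (auto elim!: AE_E3)
  define P where "P K \<longleftrightarrow> (\<exists>(G :: real ^ 'n \<Rightarrow> real ^ 'n) (\<phi> :: real ^ 'm \<Rightarrow> 'x).
              C1_diffeomorphism G \<and> bilipschitz_on (coord_proj \<iota> ` G ` K) \<phi> \<and>
              (\<forall>z\<in>G ` K. (f \<circ> inv G) z = \<phi> (coord_proj \<iota> z)))" for K
  have good: "\<exists>K. compact K \<and> K \<subseteq> B \<and> \<not> negligible K \<and> P K"
    if B: "B \<in> sets lebesgue" "B \<subseteq> A" "\<not> negligible B" for B
  proof -
    \<comment> \<open>The factorization asks for a metric derivative of the right rank at every
      point, so the exceptional null set is removed before it is applied.\<close>
    have "B - N \<in> sets lebesgue" "B - N \<subseteq> A" using B N(1) by auto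
    moreover have "\<not> negligible (B - N)"
    proof
      assume "negligible (B - N)"
      moreover have "negligible N" using N(1) by (simp add: negligible_iff_null_sets)
      ultimately have "negligible ((B - N) \<union> N)" by (rule negligible_Un)
      then show False using B(3) negligible_subset[of "(B - N) \<union> N" B] by blast
    qed
    moreover have "\<exists>\<sigma>. has_approx_metric_derivative f A p \<sigma> \<and> seminorm_rank \<sigma> = CARD('m)" if "p \<in> B - N" for p
      using N(2)[of p] has_approx_metric_derivative_md_a that B(2) by blast
    ultimately obtain K G \<phi> where "compact K" "K \<subseteq> B - N" "\<not> negligible K" "C1_diffeomorphism G"
      "bilipschitz_on (coord_proj \<iota> ` G ` K) \<phi>" "\<And>z. z \<in> G ` K \<Longrightarrow> (f \<circ> inv G) z = \<phi> (coord_proj \<iota> z)"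
      using exists_nonnegligible_factorization[OF assms(1) _ _ _ L(2,1) assms(2), of "B - N"] by metis
    then show ?thesis unfolding P_def by (intro exI[of _ K]) blast
  qed
  obtain \<K> where \<K>: "countable \<K>" "disjoint \<K>" "\<And>K. K \<in> \<K> \<Longrightarrow> compact K \<and> K \<subseteq> A \<and> P K" "negligible (A - \<Union>\<K>)"
    using lebesgue_exhaustion[of A P, OF assms(3) good] by blast
  have "hausdorff CARD('n) (A - \<Union>\<K>) = 0" using negligible_imp_hausdorff_0[OF \<K>(4)] by simp
  then show ?thesis using \<K>(1,2,3) unfolding P_def by (intro exI[of _ \<K>]) blast
qed

end
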